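(* Let $f:\mathcal{M}\to\mathbb{R}$ be a multigraph parameter. The following are equivalent: (a) $f\in\mathcal{T}$, i.e. there is a sequence $(G_n)_{n=1}^{\infty}$ of multigraphs such that $f(F)=\lim_{n\to\infty}t_{\leq}(F,G_n)$ for every multigraph $F\in\mathcal{M}$, and $f$ is non-defective. (b) There exists a multigraphon $W$ such that $f(F)=t_{\leq}(F,W)$ for every $F\in\mathcal{M}$. (c) $f$ is normalized, multiplicative, non-defective and reflection positive. (d) $f$ is normalized, multiplicative, non-defective and $f^{\dagger}\geq 0$ (i.e. $f^\dagger(A)\ge 0$ for every $k\in\mathbb{N}$ and $A\in\mathcal{A}_k$).
   Context: $\mathbb{N}=\{1,2,\dots\}$, $\mathbb{N}_0=\{0,1,2,\dots\}$, $[k]=\{1,\dots,k\}$. **Multigraphs.** $\mathcal{M}$ is the set of isomorphism types of finite undirected multigraphs (multiple edges and loops allowed). If the vertices of $F$ are labeled by $[k]$, its adjacency matrix is $A=(A(i,j))_{i,j=1}^k$, where for $i\ne j$, $A(i,j)$ is the number of edges between $i$ and $j$, and $A(i,i)$ is twice the number of loops at $i$. The set of adjacency matrices of multigraphs on $k$ vertices is $\mathcal{A}_k=\{A\in\mathbb{N}_0^{k\times k}: A^T=A,\ A(i,i)\text{ even for all } i\}$. The number of edges is $e(A)=\frac12\sum_{i,j=1}^k A(i,j)$. A multigraph parameter is a function $f:\mathcal{M}\to\mathbb{R}$; write $f(A):=f(F)$ if $A$ is the adjacency matrix of a labeling of $F$. **Homomorphism densities.** If $F,G$ have adjacency matrices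 $A\in\mathcal{A}_k$, $B\in\mathcal{A}_n$, then $t_{\leq}(F,G)=n^{-k}\cdot\#\{\varphi:[k]\to[n] : A(i,j)\le B(\varphi(i),\varphi(j))\ \forall i,j\in[k]\}$ (here $\varphi$ need not be injective). **Multigraphons.** A multigraphon is a Borel measurable function $W:[0,1]\times[0,1]\times\mathbb{N}_0\to[0,1]$ with, for all $x,y\in[0,1]$ and $k\in\mathbb{N}_0$: $W(x,y,k)=W(y,x,k)$; $\sum_{k=0}^\infty W(x,y,k)=1$; $W(x,x,2k+1)=0$. For $F$ with adjacency matrix $A\in\mathcal{A}_k$, $$t_{\leq}(F,W)=\int_{[0,1]^k}\prod_{1\le i\leq j\leq k}\ \sum_{l=A(i,j)}^{\infty}W(x_i,x_j,l)\,dx_1\cdots dx_k .$$ **Properties of parameters.** $f$ is: - *normalized* if $f$ equals $1$ on the graph with one vertex and no edges; - *multiplicative* if $f(F_1F_2)=f(F_1)f(F_2)$ for all $F_1,F_2\in\mathcal{M}$, where $F_1F_2$ is the disjoint union; - *non-defective* if for every $k$ and every sequence $A_1,A_2,\dots\in\mathcal{A}_k$ with $e(A_n)\to\infty$, one has $f(A_n)\to0$; - *reflection positive* if for each integer $k\ge0$ the connection matrix $M(k,f)$ is positive semidefinite (i.e. all its finite principal submatrices are positive semidefinite). Here a $k$-labeled multigraph is a finite multigraph with at least $k$ vertices, $k$ of which are labeled by $1,\dots,k$ (the others unlabeled). For $k$-labeled $F_1,F_2$, the product $F_1F_2$ is obtained by taking the disjoint union, identifying vertices with the same label, and letting the number of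 edges between two labeled vertices (and the number of loops at a labeled vertex) be the maximum of the corresponding numbers in $F_1$ and $F_2$; all edges involving an unlabeled vertex are kept. The rows and columns of $M(k,f)$ are indexed by isomorphism classes of $k$-labeled multigraphs, and its $(F_1,F_2)$ entry is $f(F_1F_2)$ (with labels forgotten when evaluating $f$). **Möbius transform.** Let $\mathcal{E}_k=\{E\in\mathcal{A}_k: E(i,j)\in\{0,1\}\text{ for } i\ne j,\ E(i,i)\in\{0,2\}\}$. For $A\in\mathcal{A}_k$, $f^{\dagger}(A)=\sum_{E\in\mathcal{E}_k}(-1)^{e(E)}f(A+E)$. *)

theory Defs
  imports "HOL-Analysis.Analysis" "HOL-Combinatorics.Permutations" "Jordan_Normal_Form.Matrix"
begin

text \<open>
  Vertices are numbered from \<open>0\<close>, so \<open>[k]\<close> becomes \<open>{..<k}\<close>. A multigraph is handled through an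
  adjacency matrix of one of its labelings; a parameter of isomorphism types is a function of
  adjacency matrices that is invariant under renumbering the vertices.
\<close>

definition adjacency_mats :: "nat \<Rightarrow> nat mat set" where
  "adjacency_mats k =
     {A \<in> carrier_mat k k. transpose_mat A = A \<and> (\<forall>i<k. even (A $$ (i, i)))}"

text \<open>Multigraphs have at least one vertex.\<close>

definition multigraphs :: "nat mat set" where
  "multigraphs = (\<Union>k\<in>{1..}. adjacency_mats k)"

text \<open>The sum below is even on adjacency matrices, so the division is exact.\<close>

definition num_edges :: "nat mat \<Rightarrow> nat" where
  "num_edges A = (\<Sum>i<dim_row A. \<Sum>j<dim_col A. A $$ (i, j)) div 2"

text \<open>
  A \<open>k\<close>-labeled multigraph is a multigraph whose vertices \<open>0, \<dots>, k - 1\<close> carry the labels; its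
  remaining vertices are unlabeled, so isomorphisms may permute only those.
\<close>

definition labeled_multigraphs :: "nat \<Rightarrow> nat mat set" where
  "labeled_multigraphs k = {F \<in> multigraphs. k \<le> dim_row F}"

definition labeled_iso :: "nat \<Rightarrow> nat mat \<Rightarrow> nat mat \<Rightarrow> bool" where
  "labeled_iso k F G \<longleftrightarrow> dim_row F = dim_row G \<and>
     (\<exists>\<pi>. \<pi> permutes {..<dim_row F} \<and> (\<forall>i<k. \<pi> i = i) \<and>
       (\<forall>i<dim_row F. \<forall>j<dim_row F. G $$ (i, j) = F $$ (\<pi> i, \<pi> j)))"

abbreviation isomorphic :: "nat mat \<Rightarrow> nat mat \<Rightarrow> bool" where
  "isomorphic \<equiv> labeled_iso 0"

definition multigraph_parameter :: "(nat mat \<Rightarrow> real) \<Rightarrow> bool" where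
  "multigraph_parameter f \<longleftrightarrow>
     (\<forall>F\<in>multigraphs. \<forall>G\<in>multigraphs. isomorphic F G \<longrightarrow> f F = f G)"

definition hom_density :: "nat mat \<Rightarrow> nat mat \<Rightarrow> real" where
  "hom_density F G =
     real (card {\<phi> \<in> {..<dim_row F} \<rightarrow>\<^sub>E {..<dim_row G}.
                  \<forall>i<dim_row F. \<forall>j<dim_row F. F $$ (i, j) \<le> G $$ (\<phi> i, \<phi> j)})
     / real (dim_row G) ^ dim_row F"

definition multigraphon :: "(real \<Rightarrow> real \<Rightarrow> nat \<Rightarrow> real) \<Rightarrow> bool" where
  "multigraphon W \<longleftrightarrow>
     (\<lambda>(x, y, k). W x y k) \<in> borel_measurable (restrict_space borel ({0..1} \<times> {0..1} \<times> UNIV)) \<and>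
     (\<forall>x\<in>{0..1}. \<forall>y\<in>{0..1}.
        (\<forall>k. W x y k \<in> {0..1} \<and> W x y k = W y x k) \<and>
        (\<lambda>k. W x y k) sums 1 \<and>
        (\<forall>k. W x x (2 * k + 1) = 0))"

definition multigraphon_density :: "nat mat \<Rightarrow> (real \<Rightarrow> real \<Rightarrow> nat \<Rightarrow> real) \<Rightarrow> real" where
  "multigraphon_density F W =
     (\<integral>x. (\<Prod>j<dim_row F. \<Prod>i\<le>j. \<Sum>l. W (x i) (x j) (F $$ (i, j) + l))
        \<partial>(\<Pi>\<^sub>M i\<in>{..<dim_row F}. restrict_space lborel {0..1}))"

definition is_density_limit :: "(nat mat \<Rightarrow> real) \<Rightarrow> bool" where
  "is_density_limit f \<longleftrightarrow>
     (\<exists>G. (\<forall>n::nat. G n \<in> multigraphs) \<and>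
          (\<forall>F\<in>multigraphs. (\<lambda>n. hom_density F (G n)) \<longlonglongrightarrow> f F))"

definition normalized :: "(nat mat \<Rightarrow> real) \<Rightarrow> bool" where
  "normalized f \<longleftrightarrow> f (0\<^sub>m 1 1) = 1"

definition disjoint_union :: "nat mat \<Rightarrow> nat mat \<Rightarrow> nat mat" where
  "disjoint_union F G =
     four_block_mat F (0\<^sub>m (dim_row F) (dim_col G)) (0\<^sub>m (dim_row G) (dim_col F)) G"

definition multiplicative :: "(nat mat \<Rightarrow> real) \<Rightarrow> bool" where
  "multiplicative f \<longleftrightarrow>
     (\<forall>F\<in>multigraphs. \<forall>G\<in>multigraphs. f (disjoint_union F G) = f F * f G)"

definition non_defective :: "(nat mat \<Rightarrow> real) \<Rightarrow> bool" where
  "non_defective f \<longleftrightarrow>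
     (\<forall>k\<ge>1. \<forall>A. (\<forall>n::nat. A n \<in> adjacency_mats k) \<longrightarrow>
        filterlim (\<lambda>n. num_edges (A n)) at_top sequentially \<longrightarrow> (\<lambda>n. f (A n)) \<longlonglongrightarrow> 0)"

text \<open>
  In the product of two \<open>k\<close>-labeled multigraphs the vertices \<open>0, \<dots>, dim_row F - 1\<close> are those
  of \<open>F\<close> (the first \<open>k\<close> of them shared with \<open>G\<close>), and the later vertices are the unlabeled vertices
  of \<open>G\<close>: the vertex \<open>v \<ge> dim_row F\<close> stands for the vertex \<open>v - dim_row F + k\<close> of \<open>G\<close>.
\<close>

definition labeled_product :: "nat \<Rightarrow> nat mat \<Rightarrow> nat mat \<Rightarrow> nat mat" where
  "labeled_product k F G =
     (let m = dim_row F; n = m + dim_row G - k;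
          \<sigma> = (\<lambda>v. if v < k then v else v - m + k)
      in Matrix.mat n n (\<lambda>(i, j).
           if i < k \<and> j < k then max (F $$ (i, j)) (G $$ (i, j))
           else if i < m \<and> j < m then F $$ (i, j)
           else if (i < k \<or> m \<le> i) \<and> (j < k \<or> m \<le> j) then G $$ (\<sigma> i, \<sigma> j)
           else 0))"

definition psd_on :: "'a set \<Rightarrow> ('a \<Rightarrow> 'a \<Rightarrow> real) \<Rightarrow> bool" where
  "psd_on S K \<longleftrightarrow>
     (\<forall>x\<in>S. \<forall>y\<in>S. K x y = K y x) \<and>
     (\<forall>c :: 'a \<Rightarrow> real. 0 \<le> (\<Sum>x\<in>S. \<Sum>y\<in>S. c x * c y * K x y))"

text \<open>
  The connection matrix is indexed by isomorphism classes, so a finite principal submatrix is given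
  by finitely many pairwise non-isomorphic representatives.
\<close>

definition reflection_positive :: "(nat mat \<Rightarrow> real) \<Rightarrow> bool" where
  "reflection_positive f \<longleftrightarrow>
     (\<forall>k. \<forall>S. finite S \<longrightarrow> S \<subseteq> labeled_multigraphs k \<longrightarrow>
        pairwise (\<lambda>F G. \<not> labeled_iso k F G) S \<longrightarrow>
        psd_on S (\<lambda>F G. f (labeled_product k F G)))"

definition simple_mats :: "nat \<Rightarrow> nat mat set" where
  "simple_mats k = {E \<in> adjacency_mats k.
     (\<forall>i<k. \<forall>j<k. i \<noteq> j \<longrightarrow> E $$ (i, j) \<in> {0, 1}) \<and> (\<forall>i<k. E $$ (i, i) \<in> {0, 2})}"

definition moebius_transform :: "(nat mat \<Rightarrow> real) \<Rightarrow> nat mat \<Rightarrow> real" where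
  "moebius_transform f A = (\<Sum>E\<in>simple_mats (dim_row A). (-1) ^ num_edges E * f (A + E))"

text \<open>The index set of this sum is finite, so the sum does not degenerate.\<close>

lemma finite_simple_mats: "finite (simple_mats k)"
proof (rule finite_subset)
  let ?P = "({..<k} \<times> {..<k}) \<rightarrow>\<^sub>E {0, 1, 2::nat}"
  show "finite ((\<lambda>g. Matrix.mat k k g) ` ?P)"
    by (intro finite_imageI finite_PiE) auto
  show "simple_mats k \<subseteq> (\<lambda>g. Matrix.mat k k g) ` ?P"
  proof
    fix E assume E: "E \<in> simple_mats k"
    let ?g = "restrict (\<lambda>p. E $$ p) ({..<k} \<times> {..<k})"
    have "E $$ (i, j) \<in> {0, 1, 2}" if "i < k" "j < k" for i j
      using E that by (cases "i = j") (fastforce simp: simple_mats_def)+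
    then have "?g \<in> ?P" by (auto simp: PiE_iff)
    moreover have "E = Matrix.mat k k ?g"
      using E by (intro eq_matI) (auto simp: simple_mats_def adjacency_mats_def)
    ultimately show "E \<in> (\<lambda>g. Matrix.mat k k g) ` ?P" by blast
  qed
qed

end

theory Submission
  imports Defs "HOL-Library.Diagonal_Subsequence" "HOL-Probability.Probability"
begin

text \<open>
  From (a) to (c): counting homomorphisms out of a labeled product by their values on the labeled
  vertices writes the connection matrix of a density as a sum of squares. From (c) to (d):
  \<open>f\<^sup>\<dagger>\<close> is a value of the quadratic form of a connection matrix of fully labeled graphs. From (d) to
  (a): by non-defectiveness \<open>f\<^sup>\<dagger>\<close> is the law of a random multigraph on \<open>n\<close> vertices with tail probabilities
  \<open>f\<close>, and a second moment estimate produces a deterministic sequence. From (b) to (d): the transform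
  of a multigraphon density integrates a product of point probabilities.

  From (a) to (b): in a finite multigraph, classify the vertices by their truncated edge
  multiplicities to finitely many reference vertices. Replacing edge indicators by their averages
  over pairs of classes changes densities little once no further choice of \<open>j\<close> reference vertices
  raises the \<open>L\<^sup>2\<close> energy of these averages by more than \<open>\<epsilon>\<close>: a product of the remaining edge
  indicators depends on two vertices only through their classes and their multiplicities to the other
  vertices, which then act as reference vertices. Truncation bounds the number of classes
  independently of the graph, so the nested class weights and averages converge along a subsequence.
  The limit is realised on \<open>[0, 1]\<close> by nested intervals; the averages form an \<open>L\<^sup>2\<close>-bounded martingale
  and converge almost everywhere along a subsequence to the tails of a multigraphon.
\<close>

subsection \<open>Adjacency matrices and the Moebius transform\<close>

text \<open>Multiplicities are unbounded, so in a limit mass can escape to infinity.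
  Non-defectiveness prevents this at two places: summed over growing boxes, the Moebius transform
  telescopes to corner values of f, of which all but one vanish; and the limiting tail functions are
  shown to decrease to 0 by testing f on a single multiple edge and on a vertex with many loops.

  Loops are the second obstacle. In a multigraphon they live on the diagonal, a null set that no
  average over pairs of classes can see. Truncated loop multiplicities are therefore written into
  the classes themselves, and their limits form a separate family next to the pair averages; only at
  the end are they placed on the diagonal, where they leave the edge factors unchanged almost
  everywhere.

  Passing to deterministic multigraphs rests on f(FF) = f(F)^2, which makes the variance of the
  sampled densities vanish. Thresholds, class numbers and errors at level j depend on j alone, so
  the trees of all multigraphs have the same shape and can converge entrywise.\<close>

definition vertex_pairs :: "nat \<Rightarrow> (nat \<times> nat) set" where
  "vertex_pairs k = {(i, j). i \<le> j \<and> j < k}"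

text \<open>Edge counts on pairs \<open>i \<le> j\<close> are free coordinates for adjacency
  matrices: symmetry and the even diagonal hold automatically, a loop counting twice. Values of
  \<open>h\<close> off \<open>vertex_pairs k\<close> are ignored.\<close>

definition edge_mat :: "nat \<Rightarrow> (nat \<times> nat \<Rightarrow> nat) \<Rightarrow> nat mat" where
  "edge_mat k h = Matrix.mat k k (\<lambda>(i, j). if i = j then 2 * h (i, i) else h (min i j, max i j))"

definition edge_count :: "nat mat \<Rightarrow> nat \<times> nat \<Rightarrow> nat" where
  "edge_count A = (\<lambda>(i, j). if i = j then A $$ (i, i) div 2 else A $$ (i, j))"

lemma vertex_pairs_Sigma: "vertex_pairs k = prod.swap ` (SIGMA j:{..<k}. {..j})"
  by (auto simp: vertex_pairs_def image_iff)

lemma finite_vertex_pairs [simp, intro]: "finite (vertex_pairs k)"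
  unfolding vertex_pairs_Sigma by (intro finite_imageI finite_SigmaI) auto

lemma dim_edge_mat [simp]: "dim_row (edge_mat k h) = k" "dim_col (edge_mat k h) = k"
  by (simp_all add: edge_mat_def)

lemma edge_mat_index:
  "i < k \<Longrightarrow> j < k \<Longrightarrow> edge_mat k h $$ (i, j) = (if i = j then 2 * h (i, i) else h (min i j, max i j))"
  by (simp add: edge_mat_def)

lemma edge_mat_in: "edge_mat k h \<in> adjacency_mats k"
  by (auto simp: adjacency_mats_def edge_mat_index min.commute max.commute intro!: eq_matI)

lemma adjacency_mats_sym:
  assumes "A \<in> adjacency_mats k" "i < k" "j < k"
  shows "A $$ (i, j) = A $$ (j, i)"
proof -
  have "transpose_mat A = A" "A \<in> carrier_mat k k" using assms(1) by (auto simp: adjacency_mats_def)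
  then show ?thesis using assms(2,3) by (metis carrier_matD index_transpose_mat(1))
qed

lemma adjacency_mats_dim:
  "A \<in> adjacency_mats k \<Longrightarrow> dim_row A = k" "A \<in> adjacency_mats k \<Longrightarrow> dim_col A = k"
  by (auto simp: adjacency_mats_def)

lemma adjacency_mats_even: "A \<in> adjacency_mats k \<Longrightarrow> i < k \<Longrightarrow> even (A $$ (i, i))"
  by (auto simp: adjacency_mats_def)

lemma adjacency_matsI:
  assumes "A \<in> carrier_mat k k" "\<And>i j. i < k \<Longrightarrow> j < k \<Longrightarrow> A $$ (i, j) = A $$ (j, i)"
    "\<And>i. i < k \<Longrightarrow> even (A $$ (i, i))"
  shows "A \<in> adjacency_mats k"
  using assms by (auto simp: adjacency_mats_def intro!: eq_matI)

lemma multigraphs_iff: "A \<in> multigraphs \<longleftrightarrow> A \<in> adjacency_mats (dim_row A) \<and> 1 \<le> dim_row A"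
  by (auto simp: multigraphs_def adjacency_mats_dim)

lemma adjacency_mats_multigraphs: "A \<in> adjacency_mats k \<Longrightarrow> 1 \<le> k \<Longrightarrow> A \<in> multigraphs"
  by (auto simp: multigraphs_def)

lemma edge_mat_edge_count:
  assumes "A \<in> adjacency_mats k"
  shows "edge_mat k (edge_count A) = A"
proof (rule eq_matI)
  fix i j assume "i < dim_row A" "j < dim_col A"
  with adjacency_mats_dim[OF assms] have ij: "i < k" "j < k" by auto
  then show "edge_mat k (edge_count A) $$ (i, j) = A $$ (i, j)"
    using adjacency_mats_even[OF assms ij(1)] adjacency_mats_sym[OF assms ij]
    by (auto simp: edge_mat_index edge_count_def min_def max_def)
qed (use adjacency_mats_dim[OF assms] in auto)

lemma edge_mat_cong: "(\<And>p. p \<in> vertex_pairs k \<Longrightarrow> h p = h' p) \<Longrightarrow> edge_mat k h = edge_mat k h'"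
  by (intro eq_matI) (auto simp: edge_mat_index vertex_pairs_def)

lemma edge_mat_add: "edge_mat k h + edge_mat k h' = edge_mat k (\<lambda>p. h p + h' p)"
  by (intro eq_matI) (auto simp: edge_mat_index)

lemma edge_mat_le_iff:
  "(\<forall>i<k. \<forall>j<k. edge_mat k h $$ (i, j) \<le> edge_mat k h' $$ (i, j)) \<longleftrightarrow>
   (\<forall>p\<in>vertex_pairs k. h p \<le> h' p)"
proof safe
  fix i j assume le: "\<forall>i<k. \<forall>j<k. edge_mat k h $$ (i, j) \<le> edge_mat k h' $$ (i, j)"
    and "(i, j) \<in> vertex_pairs k"
  then have "i \<le> j" "i < k" "j < k" by (auto simp: vertex_pairs_def)
  then show "h (i, j) \<le> h' (i, j)"
    using le[rule_format, of i j] by (auto simp: edge_mat_index split: if_splits)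
next
  fix i j assume le: "\<forall>p\<in>vertex_pairs k. h p \<le> h' p" and ij: "i < k" "j < k"
  have "(min i j, max i j) \<in> vertex_pairs k" using ij by (auto simp: vertex_pairs_def)
  with le have "h (min i j, max i j) \<le> h' (min i j, max i j)" by blast
  then show "edge_mat k h $$ (i, j) \<le> edge_mat k h' $$ (i, j)"
    using ij by (auto simp: edge_mat_index)
qed

text \<open>Appending vertex \<open>k\<close> contributes a row and a column with equal sums and the
  doubled loop count. The factor 2 makes the division in \<open>num_edges\<close> exact.\<close>

lemma sum_edge_mat:
  "(\<Sum>i<k. \<Sum>j<k. edge_mat k h $$ (i, j)) = 2 * (\<Sum>p\<in>vertex_pairs k. h p)"
proof (induction k)
  case (Suc k)
  have vp: "vertex_pairs (Suc k) = vertex_pairs k \<union> (\<lambda>i. (i, k)) ` {..k}"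
    by (auto simp: vertex_pairs_def less_Suc_eq)
  have 1: "edge_mat (Suc k) h $$ (i, j) = edge_mat k h $$ (i, j)" if "i < k" "j < k" for i j
    using that by (simp add: edge_mat_index)
  have "(\<Sum>i<Suc k. \<Sum>j<Suc k. edge_mat (Suc k) h $$ (i, j))
      = (\<Sum>i<k. \<Sum>j<k. edge_mat k h $$ (i, j)) + (\<Sum>i<k. h (i, k)) + (\<Sum>j<k. h (j, k)) + 2 * h (k, k)"
    by (simp add: sum.distrib 1 edge_mat_index)
  also have "\<dots> = 2 * ((\<Sum>p\<in>vertex_pairs k. h p) + (\<Sum>i\<le>k. h (i, k)))"
    by (simp add: Suc lessThan_Suc_atMost[symmetric])
  also have "(\<Sum>i\<le>k. h (i, k)) = sum h ((\<lambda>i. (i, k)) ` {..k})"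
    by (subst sum.reindex) (auto simp: inj_on_def)
  also have "(\<Sum>p\<in>vertex_pairs k. h p) + sum h ((\<lambda>i. (i, k)) ` {..k}) = sum h (vertex_pairs (Suc k))"
    unfolding vp by (subst sum.union_disjoint) (auto, auto simp: vertex_pairs_def)
  finally show ?case .
qed (auto simp: vertex_pairs_def)

lemma num_edges_edge_mat: "num_edges (edge_mat k h) = (\<Sum>p\<in>vertex_pairs k. h p)"
  by (simp add: num_edges_def sum_edge_mat)

section \<open>Alternating sums over sets of vertex pairs\<close>

abbreviation add_ind :: "('a \<Rightarrow> nat) \<Rightarrow> 'a set \<Rightarrow> 'a \<Rightarrow> nat" where
  "add_ind h S \<equiv> (\<lambda>p. h p + of_bool (p \<in> S))"

text \<open>Identifies the index set of the Moebius transform with the subsets of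
  \<open>vertex_pairs k\<close>; the diagonal entries 0 and 2 stand for no loop and one
  loop.\<close>

lemma simple_mats_bij:
  "bij_betw (\<lambda>S. edge_mat k (\<lambda>p. of_bool (p \<in> S))) (Pow (vertex_pairs k)) (simple_mats k)"
proof (rule bij_betwI[where g = "\<lambda>E. {p \<in> vertex_pairs k. edge_count E p \<noteq> 0}"])
  show "(\<lambda>S. edge_mat k (\<lambda>p. of_bool (p \<in> S))) \<in> Pow (vertex_pairs k) \<rightarrow> simple_mats k"
    by (auto simp: simple_mats_def edge_mat_in edge_mat_index)
  show "(\<lambda>E. {p \<in> vertex_pairs k. edge_count E p \<noteq> 0}) \<in> simple_mats k \<rightarrow> Pow (vertex_pairs k)"
    by auto
  show "{p \<in> vertex_pairs k. edge_count (edge_mat k (\<lambda>p. of_bool (p \<in> S))) p \<noteq> 0} = S"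
    if "S \<in> Pow (vertex_pairs k)" for S
    using that by (auto simp: edge_count_def edge_mat_index vertex_pairs_def split: if_splits)
  show "edge_mat k (\<lambda>p. of_bool (p \<in> {p \<in> vertex_pairs k. edge_count E p \<noteq> 0})) = E"
    if "E \<in> simple_mats k" for E
  proof -
    have E: "E \<in> adjacency_mats k" using that by (simp add: simple_mats_def)
    have "edge_mat k (\<lambda>p. of_bool (p \<in> {p \<in> vertex_pairs k. edge_count E p \<noteq> 0})) = edge_mat k (edge_count E)"
    proof (rule edge_mat_cong)
      fix p assume p: "p \<in> vertex_pairs k"
      then obtain i j where ij: "p = (i, j)" "i < k" "j < k" by (auto simp: vertex_pairs_def)
      have "edge_count E p \<in> {0, 1}"
        using that ij unfolding simple_mats_def edge_count_def by (cases "i = j") fastforce+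
      then show "of_bool (p \<in> {p \<in> vertex_pairs k. edge_count E p \<noteq> 0}) = edge_count E p"
        using p by auto
    qed
    then show ?thesis using edge_mat_edge_count[OF E] by simp
  qed
qed

lemma moebius_transform_edge_mat:
  "moebius_transform f (edge_mat k h) =
   (\<Sum>S\<in>Pow (vertex_pairs k). (-1) ^ card S * f (edge_mat k (add_ind h S)))"
proof -
  have "moebius_transform f (edge_mat k h) = (\<Sum>S\<in>Pow (vertex_pairs k).
     (-1) ^ num_edges (edge_mat k (\<lambda>p. of_bool (p \<in> S))) * f (edge_mat k h + edge_mat k (\<lambda>p. of_bool (p \<in> S))))"
    unfolding moebius_transform_def by (simp add: sum.reindex_bij_betw[OF simple_mats_bij, symmetric])
  also have "\<dots> = (\<Sum>S\<in>Pow (vertex_pairs k). (-1) ^ card S * f (edge_mat k (add_ind h S)))"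
    by (intro sum.cong) (auto simp: num_edges_edge_mat edge_mat_add Int_absorb1)
  finally show ?thesis .
qed

lemma sum_Pow_insert:
  assumes "finite A" "a \<notin> A"
  shows "(\<Sum>S\<in>Pow (insert a A). \<phi> S) = (\<Sum>S\<in>Pow A. \<phi> S + \<phi> (insert a S))"
proof -
  have "inj_on (insert a) (Pow A)" using assms by (auto simp: inj_on_def)
  moreover have "Pow A \<inter> insert a ` Pow A = {}" using assms by auto
  ultimately show ?thesis
    using assms by (simp add: Pow_insert sum.union_disjoint sum.reindex sum.distrib)
qed

text \<open>For one element the four terms \<open>\<phi> {}\<close>, \<open>- \<phi> {a}\<close>,
  \<open>- \<phi> {a}\<close>, \<open>\<phi> {a}\<close> collapse to
  \<open>\<phi> {} - \<phi> {a}\<close>; induction treats the elements one at a time. Unions appear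
  because products of fully labeled graphs take maxima of edge counts.\<close>

lemma alternating_sum_Un:
  fixes \<phi> :: "'a set \<Rightarrow> real"
  assumes "finite A"
  shows "(\<Sum>S\<in>Pow A. \<Sum>T\<in>Pow A. (-1) ^ card S * (-1) ^ card T * \<phi> (S \<union> T))
       = (\<Sum>S\<in>Pow A. (-1) ^ card S * \<phi> S)"
  using assms
proof (induction A arbitrary: \<phi>)
  case (insert a A)
  have card: "card (insert a S) = Suc (card S)" if "S \<subseteq> A" for S
    using that insert.hyps by (subst card_insert_disjoint) (auto intro: finite_subset)
  let ?D = "\<lambda>\<phi>. \<Sum>S\<in>Pow A. (-1) ^ card S * \<phi> S"
  let ?DD = "\<lambda>\<phi>. \<Sum>S\<in>Pow A. \<Sum>T\<in>Pow A. (-1) ^ card S * (-1) ^ card T * \<phi> (S \<union> T)"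
  let ?\<phi>' = "\<lambda>S. \<phi> (insert a S)"
  have "(\<Sum>S\<in>Pow (insert a A). \<Sum>T\<in>Pow (insert a A). (-1) ^ card S * (-1) ^ card T * \<phi> (S \<union> T))
     = (\<Sum>S\<in>Pow A. \<Sum>T\<in>Pow A. (-1) ^ card S * (-1) ^ card T * \<phi> (S \<union> T) - (-1) ^ card S * (-1) ^ card T * ?\<phi>' (S \<union> T))"
    using insert.hyps by (simp add: sum_Pow_insert card sum.distrib[symmetric] sum_subtractf algebra_simps)
  also have "\<dots> = ?D \<phi> - ?D ?\<phi>'"
    by (simp add: sum_subtractf insert.IH[of \<phi>] insert.IH[of ?\<phi>'])
  also have "\<dots> = (\<Sum>S\<in>Pow (insert a A). (-1) ^ card S * \<phi> S)"
    using insert.hyps by (simp add: sum_Pow_insert card sum.distrib sum_subtractf sum_negf)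
  finally show ?case .
qed auto

lemma labeled_product_edge_mat:
  "labeled_product k (edge_mat k h) (edge_mat k h') = edge_mat k (\<lambda>p. max (h p) (h' p))"
  by (intro eq_matI) (auto simp: labeled_product_def Let_def edge_mat_index)

lemma edge_mat_inj:
  assumes "edge_mat k h = edge_mat k h'" "p \<in> vertex_pairs k"
  shows "h p = h' p"
proof -
  obtain i j where p: "p = (i, j)" "i \<le> j" "i < k" "j < k" using assms(2) by (auto simp: vertex_pairs_def)
  then show ?thesis using arg_cong[OF assms(1), of "\<lambda>A. A $$ (i, j)"]
    by (auto simp: edge_mat_index split: if_splits)
qed

lemma psd_on_nonneg: "psd_on S K \<Longrightarrow> 0 \<le> (\<Sum>x\<in>S. \<Sum>y\<in>S. c x * c y * K x y)"
  by (simp add: psd_on_def)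

text \<open>The alternating vector \<open>(-1)\<^sup>|\<^sup>S\<^sup>|\<close> turns a principal submatrix of the connection
  matrix of fully labeled graphs into the Moebius transform.\<close>

lemma reflection_positive_imp_moebius_nonneg:
  assumes "reflection_positive f" "1 \<le> k" "A \<in> adjacency_mats k"
  shows "0 \<le> moebius_transform f A"
proof -
  define h where "h = edge_count A"
  have A: "A = edge_mat k h" using assms(3) by (simp add: h_def edge_mat_edge_count)
  let ?F = "\<lambda>S. edge_mat k (add_ind h S)" and ?P = "Pow (vertex_pairs k)"
  have inj: "inj_on ?F ?P"
  proof (rule inj_onI)
    fix S T assume S: "S \<in> ?P" and T: "T \<in> ?P" and eq: "?F S = ?F T"
    have "p \<in> S \<longleftrightarrow> p \<in> T" if "p \<in> vertex_pairs k" for p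
      using edge_mat_inj[OF eq that] by (auto simp: of_bool_def split: if_splits)
    with S T show "S = T" by auto
  qed
  have prod: "labeled_product k (?F S) (?F T) = ?F (S \<union> T)" for S T
    unfolding labeled_product_edge_mat by (intro edge_mat_cong) (auto simp: of_bool_def)
  \<comment> \<open>With all \<open>k\<close> vertices labeled, the only admissible renumbering is
    the identity, so distinct matrices lie in distinct classes.\<close>
  have "pairwise (\<lambda>F G. \<not> labeled_iso k F G) (?F ` ?P)"
  proof (rule pairwiseI)
    fix F G assume "F \<in> ?F ` ?P" "G \<in> ?F ` ?P" "F \<noteq> G"
    then have d: "dim_row F = k" "dim_col F = k" "dim_row G = k" "dim_col G = k" by auto
    show "\<not> labeled_iso k F G"
    proof
      assume "labeled_iso k F G"
      then obtain \<pi> where "\<forall>i<k. \<pi> i = i" "\<forall>i<k. \<forall>j<k. G $$ (i, j) = F $$ (\<pi> i, \<pi> j)"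
        unfolding labeled_iso_def d by auto
      then have "F = G" using d by (intro eq_matI) auto
      with \<open>F \<noteq> G\<close> show False ..
    qed
  qed
  moreover have "?F ` ?P \<subseteq> labeled_multigraphs k"
    using assms(2) by (auto simp: labeled_multigraphs_def intro!: adjacency_mats_multigraphs[OF edge_mat_in])
  ultimately have "psd_on (?F ` ?P) (\<lambda>F G. f (labeled_product k F G))"
    using assms(1) by (auto simp: reflection_positive_def)
  \<comment> \<open>Test vectors are indexed by graphs, so the sign is read off from the set that
    \<open>?F\<close> sends to the graph.\<close>
  from psd_on_nonneg[OF this, of "\<lambda>F. (-1) ^ card (the_inv_into ?P ?F F)"]
  have "0 \<le> (\<Sum>F\<in>?F ` ?P. \<Sum>G\<in>?F ` ?P.
       (-1) ^ card (the_inv_into ?P ?F F) * (-1) ^ card (the_inv_into ?P ?F G) * f (labeled_product k F G))" .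
  also have "\<dots> = (\<Sum>S\<in>?P. \<Sum>T\<in>?P. (-1) ^ card S * (-1) ^ card T * f (?F (S \<union> T)))"
    unfolding sum.reindex[OF inj] o_def by (intro sum.cong) (simp_all add: the_inv_into_f_f[OF inj] prod)
  also have "\<dots> = moebius_transform f A"
    unfolding A moebius_transform_edge_mat
    by (rule alternating_sum_Un[where \<phi> = "\<lambda>S. f (?F S)"]) simp
  finally show ?thesis .
qed

subsection \<open>Densities in finite multigraphs\<close>

definition mat_homs :: "nat mat \<Rightarrow> nat mat \<Rightarrow> (nat \<Rightarrow> nat) set" where
  "mat_homs F G = {\<phi> \<in> {..<dim_row F} \<rightarrow>\<^sub>E {..<dim_row G}.
     \<forall>i<dim_row F. \<forall>j<dim_row F. F $$ (i, j) \<le> G $$ (\<phi> i, \<phi> j)}"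

lemma hom_density_mat_homs: "hom_density F G = card (mat_homs F G) / real (dim_row G) ^ dim_row F"
  by (simp add: hom_density_def mat_homs_def)

lemma finite_mat_homs [simp, intro]: "finite (mat_homs F G)"
  unfolding mat_homs_def by (rule finite_subset[of _ "{..<dim_row F} \<rightarrow>\<^sub>E {..<dim_row G}"]) (auto intro: finite_PiE)

lemma labeled_product_dim [simp]:
  "dim_row (labeled_product k F G) = dim_row F + dim_row G - k"
  "dim_col (labeled_product k F G) = dim_row F + dim_row G - k"
  by (simp_all add: labeled_product_def Let_def)

lemma labeled_product_index:
  assumes "i < dim_row F + dim_row G - k" "j < dim_row F + dim_row G - k"
  shows "labeled_product k F G $$ (i, j) = (if i < k \<and> j < k then max (F $$ (i, j)) (G $$ (i, j))
     else if i < dim_row F \<and> j < dim_row F then F $$ (i, j)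
     else if (i < k \<or> dim_row F \<le> i) \<and> (j < k \<or> dim_row F \<le> j)
       then G $$ (if i < k then i else i - dim_row F + k, if j < k then j else j - dim_row F + k)
     else 0)"
  using assms by (simp add: labeled_product_def Let_def)

lemma labeled_product_in_multigraphs:
  assumes "F \<in> labeled_multigraphs k" "G \<in> labeled_multigraphs k"
  shows "labeled_product k F G \<in> multigraphs"
proof -
  let ?m = "dim_row F" and ?g = "dim_row G"
  have F: "F \<in> adjacency_mats ?m" "1 \<le> ?m" "k \<le> ?m" and G: "G \<in> adjacency_mats ?g" "1 \<le> ?g" "k \<le> ?g"
    using assms by (auto simp: labeled_multigraphs_def multigraphs_iff)
  have "labeled_product k F G \<in> adjacency_mats (?m + ?g - k)"
  proof (rule adjacency_matsI)
    fix i j assume ij: "i < ?m + ?g - k" "j < ?m + ?g - k"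
    have *: "v - ?m + k < ?g" if "v < ?m + ?g - k" "?m \<le> v" for v using that G F by auto
    let ?s = "\<lambda>v. if v < k then v else v - ?m + k"
    have 1: "F $$ (i, j) = F $$ (j, i)" if "i < ?m" "j < ?m"
      using adjacency_mats_sym[OF F(1) that] .
    have 2: "G $$ (?s i, ?s j) = G $$ (?s j, ?s i)" if "i < k \<or> ?m \<le> i" "j < k \<or> ?m \<le> j"
      using that ij G *[of i] *[of j] by (intro adjacency_mats_sym[OF G(1)]) auto
    show "labeled_product k F G $$ (i, j) = labeled_product k F G $$ (j, i)"
    proof (cases "i < k \<and> j < k")
      case True
      then show ?thesis using 1 2 F ij by (simp add: labeled_product_index)
    next
      case False
      then show ?thesis
        unfolding labeled_product_index[OF ij] labeled_product_index[OF ij(2,1)]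
        using 1 2 by (simp del: if_not_P cong: conj_cong) (metis (no_types, lifting))
    qed
  next
    fix i assume i: "i < ?m + ?g - k"
    have *: "i - ?m + k < ?g" if "?m \<le> i" using that i G F by auto
    have "even (F $$ (i, i))" if "i < ?m" using adjacency_mats_even[OF F(1) that] .
    moreover have "even (G $$ (i, i))" if "i < k" using adjacency_mats_even[OF G(1)] G(3) that by simp
    moreover have "even (G $$ (i - ?m + k, i - ?m + k))" if "?m \<le> i"
      using adjacency_mats_even[OF G(1) *[OF that]] .
    ultimately show "even (labeled_product k F G $$ (i, i))"
      unfolding labeled_product_index[OF i i] using F(3) by (auto simp: max_def)
  qed (auto simp: labeled_product_def Let_def)
  then show ?thesis by (rule adjacency_mats_multigraphs) (use F G in linarith)
qed

lemma labeled_product_0: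
  assumes "F \<in> multigraphs" "G \<in> multigraphs"
  shows "labeled_product 0 F G = disjoint_union F G"
proof -
  have "dim_col F = dim_row F" "dim_col G = dim_row G"
    using assms adjacency_mats_dim(2) by (auto simp: multigraphs_iff)
  then show ?thesis
    unfolding disjoint_union_def by (intro eq_matI) (auto simp: labeled_product_index)
qed

lemma multigraphs_labeled_0: "F \<in> multigraphs \<Longrightarrow> F \<in> labeled_multigraphs 0"
  by (simp add: labeled_multigraphs_def)

lemma disjoint_union_in_multigraphs:
  "F \<in> multigraphs \<Longrightarrow> G \<in> multigraphs \<Longrightarrow> disjoint_union F G \<in> multigraphs"
  by (metis labeled_product_0 labeled_product_in_multigraphs multigraphs_labeled_0)

text \<open>For varying \<open>\<psi>\<close>, the sizes of these sets are the coordinates of the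
  Gram vectors behind the connection matrix.\<close>

definition hom_exts :: "nat \<Rightarrow> nat mat \<Rightarrow> nat mat \<Rightarrow> (nat \<Rightarrow> nat) \<Rightarrow> (nat \<Rightarrow> nat) set" where
  "hom_exts k F B \<psi> = {\<alpha> \<in> mat_homs F B. restrict \<alpha> {..<k} = \<psi>}"

text \<open>Because labeled pairs carry the maximum, a bound on the product is a joint bound on both
  factors, with the unlabeled vertices of \<open>G\<close> shifted behind those of \<open>F\<close>.
  This is what lets extension counts multiply.\<close>

lemma labeled_product_le_iff:
  assumes "F \<in> labeled_multigraphs k" "G \<in> labeled_multigraphs k"
  shows "(\<forall>i < dim_row F + dim_row G - k. \<forall>j < dim_row F + dim_row G - k.
            labeled_product k F G $$ (i, j) \<le> b i j) \<longleftrightarrow>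
     (\<forall>i < dim_row F. \<forall>j < dim_row F. F $$ (i, j) \<le> b i j) \<and>
     (\<forall>i < dim_row G. \<forall>j < dim_row G. G $$ (i, j) \<le>
        b (if i < k then i else i - k + dim_row F) (if j < k then j else j - k + dim_row F))"
    (is "?L \<longleftrightarrow> ?R1 \<and> ?R2")
proof -
  let ?m = "dim_row F" and ?g = "dim_row G"
  have k: "k \<le> ?m" "k \<le> ?g" using assms by (auto simp: labeled_multigraphs_def)
  show ?thesis
  proof (intro iffI conjI allI impI)
    fix i j assume L: ?L and ij: "i < ?m" "j < ?m"
    then have "labeled_product k F G $$ (i, j) \<le> b i j" using k by auto
    then show "F $$ (i, j) \<le> b i j" using ij k by (simp add: labeled_product_index split: if_splits)
  next
    fix i j assume L: ?L and ij: "i < ?g" "j < ?g"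
    let ?i = "if i < k then i else i - k + ?m" and ?j = "if j < k then j else j - k + ?m"
    have lt: "?i < ?m + ?g - k" "?j < ?m + ?g - k" using ij k by auto
    then have "labeled_product k F G $$ (?i, ?j) \<le> b ?i ?j" using L by blast
    moreover have "G $$ (i, j) \<le> labeled_product k F G $$ (?i, ?j)"
      using ij k by (subst labeled_product_index[OF lt]) auto
    ultimately show "G $$ (i, j) \<le> b ?i ?j" by linarith
  next
    fix i j assume R: "?R1 \<and> ?R2" and ij: "i < ?m + ?g - k" "j < ?m + ?g - k"
    let ?s = "\<lambda>v. if v < k then v else v - ?m + k"
    have R1: "F $$ (i, j) \<le> b i j" if "i < ?m" "j < ?m" using R that by blast
    have R2: "G $$ (?s i, ?s j) \<le> b i j" if "i < k \<or> ?m \<le> i" "j < k \<or> ?m \<le> j"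
    proof -
      have "?s i < ?g" "?s j < ?g" using that ij k by auto
      then have "G $$ (?s i, ?s j) \<le> b (if ?s i < k then ?s i else ?s i - k + ?m)
          (if ?s j < k then ?s j else ?s j - k + ?m)"
        using R by blast
      moreover have "(if ?s i < k then ?s i else ?s i - k + ?m) = i" "(if ?s j < k then ?s j else ?s j - k + ?m) = j"
        using that k by auto
      ultimately show ?thesis by simp
    qed
    show "labeled_product k F G $$ (i, j) \<le> b i j"
    proof (cases "i < k \<and> j < k")
      case True
      then show ?thesis unfolding labeled_product_index[OF ij] using R1 R2 k by simp
    next
      case False
      have "F $$ (i, j) \<le> b i j" if "i < ?m \<and> j < ?m" using R1 that by blast
      moreover have "G $$ (?s i, ?s j) \<le> b i j" if "(i < k \<or> ?m \<le> i) \<and> (j < k \<or> ?m \<le> j)"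
        using R2 that by blast
      ultimately show ?thesis unfolding labeled_product_index[OF ij] if_not_P[OF False] by presburger
    qed
  qed
qed

text \<open>A homomorphism out of the product is a pair of homomorphisms that agree on the labels;
  the inverse glues such a pair. The restrictions keep the value \<open>undefined\<close> outside
  the domains, without which the two maps would not be inverse to each other.\<close>

lemma mat_homs_labeled_product_bij:
  assumes F: "F \<in> labeled_multigraphs k" and G: "G \<in> labeled_multigraphs k"
  defines "m \<equiv> dim_row F" and "g \<equiv> dim_row G"
  shows "bij_betw (\<lambda>\<phi>. (restrict \<phi> {..<m}, restrict (\<lambda>i. \<phi> (if i < k then i else i - k + m)) {..<g}))
     (mat_homs (labeled_product k F G) B)
     (SIGMA \<alpha>:mat_homs F B. hom_exts k G B (restrict \<alpha> {..<k}))"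
proof -
  have k: "k \<le> m" "k \<le> g" using F G by (auto simp: labeled_multigraphs_def m_def g_def)
  let ?to = "\<lambda>\<phi>. (restrict \<phi> {..<m}, restrict (\<lambda>i. \<phi> (if i < k then i else i - k + m)) {..<g})"
  let ?from = "\<lambda>(\<alpha>, \<beta>). restrict (\<lambda>v. if v < m then \<alpha> v else \<beta> (v - m + k)) {..<m + g - k} :: nat \<Rightarrow> nat"
  let ?S = "SIGMA \<alpha>:mat_homs F B. hom_exts k G B (restrict \<alpha> {..<k})"
  have H: "\<phi> \<in> mat_homs (labeled_product k F G) B \<longleftrightarrow> \<phi> \<in> {..<m + g - k} \<rightarrow>\<^sub>E {..<dim_row B} \<and>
      (\<forall>i < m. \<forall>j < m. F $$ (i, j) \<le> B $$ (\<phi> i, \<phi> j)) \<and>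
     (\<forall>i < g. \<forall>j < g. G $$ (i, j) \<le>
        B $$ (\<phi> (if i < k then i else i - k + m), \<phi> (if j < k then j else j - k + m)))" for \<phi>
    unfolding mat_homs_def m_def g_def
    using labeled_product_le_iff[OF F G, of "\<lambda>i j. B $$ (\<phi> i, \<phi> j)"] by simp
  show ?thesis
  proof (rule bij_betwI[where g = ?from])
    show "?to \<in> mat_homs (labeled_product k F G) B \<rightarrow> ?S"
    proof
      fix \<phi> assume "\<phi> \<in> mat_homs (labeled_product k F G) B"
      then have *: "\<phi> \<in> {..<m + g - k} \<rightarrow>\<^sub>E {..<dim_row B}"
        "\<forall>i < m. \<forall>j < m. F $$ (i, j) \<le> B $$ (\<phi> i, \<phi> j)"
        "\<forall>i < g. \<forall>j < g. G $$ (i, j) \<le>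
        B $$ (\<phi> (if i < k then i else i - k + m), \<phi> (if j < k then j else j - k + m))"
        using H by auto
      have ran: "\<phi> v < dim_row B" if "v < m + g - k" for v using *(1) that by auto
      have "restrict \<phi> {..<m} \<in> mat_homs F B"
        using *(2) ran k by (auto simp: mat_homs_def m_def[symmetric])
      moreover have "restrict (\<lambda>i. \<phi> (if i < k then i else i - k + m)) {..<g} \<in> mat_homs G B"
        using *(3) ran k by (auto simp: mat_homs_def g_def[symmetric])
      moreover have "restrict (restrict (\<lambda>i. \<phi> (if i < k then i else i - k + m)) {..<g}) {..<k}
          = restrict (restrict \<phi> {..<m}) {..<k}"
        using k by (auto simp: restrict_def)
      ultimately show "?to \<phi> \<in> ?S" by (auto simp: hom_exts_def)
    qed
    show "?from \<in> ?S \<rightarrow> mat_homs (labeled_product k F G) B"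
    proof
      fix z assume "z \<in> ?S"
      then obtain \<alpha> \<beta> where z: "z = (\<alpha>, \<beta>)" "\<alpha> \<in> mat_homs F B" "\<beta> \<in> mat_homs G B"
        "restrict \<beta> {..<k} = restrict \<alpha> {..<k}" by (auto simp: hom_exts_def)
      have eq: "\<beta> v = \<alpha> v" if "v < k" for v using fun_cong[OF z(4), of v] that by simp
      have \<alpha>: "\<And>v. v < m \<Longrightarrow> \<alpha> v < dim_row B" "\<And>i j. i < m \<Longrightarrow> j < m \<Longrightarrow> F $$ (i, j) \<le> B $$ (\<alpha> i, \<alpha> j)"
        and \<beta>: "\<And>v. v < g \<Longrightarrow> \<beta> v < dim_row B" "\<And>i j. i < g \<Longrightarrow> j < g \<Longrightarrow> G $$ (i, j) \<le> B $$ (\<beta> i, \<beta> j)"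
        using z by (auto simp: mat_homs_def m_def[symmetric] g_def[symmetric])
      have val: "?from z v = \<alpha> v" if "v < m" for v using that k by (auto simp: z)
      have val2: "?from z (if i < k then i else i - k + m) = \<beta> i" if "i < g" for i
        using that k by (auto simp: z eq)
      have "?from z \<in> {..<m + g - k} \<rightarrow>\<^sub>E {..<dim_row B}" using k \<alpha>(1) \<beta>(1) by (auto simp: z)
      then show "?from z \<in> mat_homs (labeled_product k F G) B"
        unfolding H by (intro conjI allI impI) (simp_all only: val val2 \<alpha>(2) \<beta>(2))
    qed
    show "?from (?to \<phi>) = \<phi>" if "\<phi> \<in> mat_homs (labeled_product k F G) B" for \<phi>
    proof -
      have "\<phi> \<in> {..<m + g - k} \<rightarrow>\<^sub>E {..<dim_row B}" using that H by auto
      then have out: "\<phi> v = undefined" if "\<not> v < m + g - k" for v using that by (auto simp: PiE_def extensional_def)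
      show ?thesis
      proof
        fix v show "?from (?to \<phi>) v = \<phi> v"
        proof (cases "v < m")
          case True
          then have "v < m + g - k" using k by linarith
          with True show ?thesis by simp
        next
          case False
          moreover from False have "v - m + k - k + m = v" by linarith
          moreover from False have "\<not> v - m + k < k" by linarith
          moreover have "v - m + k < g" if "v < m + g - k" using False that k by linarith
          ultimately show ?thesis using out[of v] by (cases "v < m + g - k") (simp_all del: add_diff_assoc2 Nat.add_diff_assoc2)
        qed
      qed
    qed
    show "?to (?from z) = z" if "z \<in> ?S" for z
    proof -
      obtain \<alpha> \<beta> where z: "z = (\<alpha>, \<beta>)" "\<alpha> \<in> mat_homs F B" "\<beta> \<in> mat_homs G B"
        "restrict \<beta> {..<k} = restrict \<alpha> {..<k}" using \<open>z \<in> ?S\<close> by (auto simp: hom_exts_def)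
      have eq: "\<beta> v = \<alpha> v" if "v < k" for v using fun_cong[OF z(4), of v] that by simp
      have "\<alpha> \<in> extensional {..<m}" "\<beta> \<in> extensional {..<g}"
        using z(2,3) by (auto simp: mat_homs_def m_def g_def PiE_def)
      then have out: "\<And>v. \<not> v < m \<Longrightarrow> \<alpha> v = undefined" "\<And>v. \<not> v < g \<Longrightarrow> \<beta> v = undefined"
        by (auto simp: extensional_def)
      have r1: "restrict (?from z) {..<m} = \<alpha>"
      proof
        fix v show "restrict (?from z) {..<m} v = \<alpha> v"
          using k out(1)[of v] by (cases "v < m"; cases "v < m + g - k") (simp_all add: z(1))
      qed
      have val2: "?from z (if i < k then i else i - k + m) = \<beta> i" if "i < g" for i
        using that k by (auto simp: z(1) eq)
      have "restrict (\<lambda>i. ?from z (if i < k then i else i - k + m)) {..<g} = \<beta>"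
      proof
        fix v show "restrict (\<lambda>i. ?from z (if i < k then i else i - k + m)) {..<g} v = \<beta> v"
          using val2[of v] out(2)[of v] by (cases "v < g") simp_all
      qed
      with r1 show ?thesis by (simp add: z(1))
    qed
  qed
qed

lemma card_mat_homs_labeled_product:
  assumes F: "F \<in> labeled_multigraphs k" and G: "G \<in> labeled_multigraphs k"
  shows "card (mat_homs (labeled_product k F G) B) =
    (\<Sum>\<psi>\<in>{..<k} \<rightarrow>\<^sub>E {..<dim_row B}. card (hom_exts k F B \<psi>) * card (hom_exts k G B \<psi>))"
proof -
  let ?P = "{..<k} \<rightarrow>\<^sub>E {..<dim_row B}"
  have fin: "finite ?P" by (intro finite_PiE) auto
  have k: "k \<le> dim_row F" using F by (auto simp: labeled_multigraphs_def)
  have fe: "finite (hom_exts k F B \<psi>)" for F \<psi> by (rule finite_subset[OF _ finite_mat_homs]) (auto simp: hom_exts_def)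
  have r: "restrict \<alpha> {..<k} \<in> ?P" if "\<alpha> \<in> mat_homs F B" for \<alpha>
    using that k by (auto simp: mat_homs_def)
  have "card (mat_homs (labeled_product k F G) B) = card (SIGMA \<alpha>:mat_homs F B. hom_exts k G B (restrict \<alpha> {..<k}))"
    using mat_homs_labeled_product_bij[OF F G] by (rule bij_betw_same_card)
  also have "\<dots> = (\<Sum>\<alpha>\<in>mat_homs F B. card (hom_exts k G B (restrict \<alpha> {..<k})))"
    by (simp add: fe)
  also have "\<dots> = (\<Sum>\<psi>\<in>?P. \<Sum>\<alpha>\<in>{\<alpha> \<in> mat_homs F B. restrict \<alpha> {..<k} = \<psi>}. card (hom_exts k G B (restrict \<alpha> {..<k})))"
    by (rule sum.group[symmetric]) (use r fin in \<open>blast+\<close>)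
  also have "\<dots> = (\<Sum>\<psi>\<in>?P. card (hom_exts k F B \<psi>) * card (hom_exts k G B \<psi>))"
    by (intro sum.cong) (auto simp: hom_exts_def)
  finally show ?thesis .
qed

lemma hom_density_disjoint_union:
  assumes "F \<in> multigraphs" "G \<in> multigraphs"
  shows "hom_density (disjoint_union F G) B = hom_density F B * hom_density G B"
proof -
  note l = assms[THEN multigraphs_labeled_0]
  have 0: "hom_exts 0 F B (\<lambda>_. undefined) = mat_homs F B" for F
    by (auto simp: hom_exts_def restrict_def)
  have "card (mat_homs (labeled_product 0 F G) B) = card (mat_homs F B) * card (mat_homs G B)"
    by (simp add: card_mat_homs_labeled_product[OF l] 0)
  then show ?thesis
    using labeled_product_dim(1)[of 0 F G]
    by (simp add: hom_density_mat_homs labeled_product_0[OF assms, symmetric] power_add)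
qed

text \<open>Normalising the factors separately divides twice by the number of choices for the
  \<open>k\<close> shared vertices; the factor in front restores one of the two.\<close>

lemma hom_density_labeled_product:
  assumes F: "F \<in> labeled_multigraphs k" and G: "G \<in> labeled_multigraphs k" and B: "1 \<le> dim_row B"
  shows "hom_density (labeled_product k F G) B = real (dim_row B) ^ k *
    (\<Sum>\<psi>\<in>{..<k} \<rightarrow>\<^sub>E {..<dim_row B}. card (hom_exts k F B \<psi>) / real (dim_row B) ^ dim_row F *
       (card (hom_exts k G B \<psi>) / real (dim_row B) ^ dim_row G))"
proof -
  let ?n = "real (dim_row B)"
  have k: "k \<le> dim_row F" using F by (auto simp: labeled_multigraphs_def)
  have pw: "?n ^ dim_row F * ?n ^ dim_row G = ?n ^ k * ?n ^ (dim_row F + dim_row G - k)"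
    using k by (simp flip: power_add)
  have "hom_density (labeled_product k F G) B =
     (\<Sum>\<psi>\<in>{..<k} \<rightarrow>\<^sub>E {..<dim_row B}. real (card (hom_exts k F B \<psi>)) * real (card (hom_exts k G B \<psi>))) / ?n ^ (dim_row F + dim_row G - k)"
    by (simp add: hom_density_mat_homs card_mat_homs_labeled_product[OF F G])
  also have "\<dots> = ?n ^ k * ((\<Sum>\<psi>\<in>{..<k} \<rightarrow>\<^sub>E {..<dim_row B}. real (card (hom_exts k F B \<psi>)) * real (card (hom_exts k G B \<psi>))) / (?n ^ dim_row F * ?n ^ dim_row G))"
    unfolding pw using B by simp
  finally show ?thesis by (simp add: sum_divide_distrib)
qed

lemma hom_density_psd:
  assumes "finite S" "S \<subseteq> labeled_multigraphs k" "1 \<le> dim_row B"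
  shows "psd_on S (\<lambda>F G. hom_density (labeled_product k F G) B)"
  unfolding psd_on_def
proof (intro conjI ballI allI)
  fix F G assume FG: "F \<in> S" "G \<in> S"
  then have "F \<in> labeled_multigraphs k" "G \<in> labeled_multigraphs k" using assms by auto
  then show "hom_density (labeled_product k F G) B = hom_density (labeled_product k G F) B"
    using assms by (simp add: hom_density_labeled_product mult.commute)
next
  fix c :: "nat mat \<Rightarrow> real"
  let ?n = "real (dim_row B)" and ?P = "{..<k} \<rightarrow>\<^sub>E {..<dim_row B}"
  let ?N = "\<lambda>F \<psi>. card (hom_exts k F B \<psi>) / ?n ^ dim_row F"
  have "(\<Sum>F\<in>S. \<Sum>G\<in>S. c F * c G * hom_density (labeled_product k F G) B)
      = (\<Sum>F\<in>S. \<Sum>G\<in>S. \<Sum>\<psi>\<in>?P. ?n ^ k * ((c F * ?N F \<psi>) * (c G * ?N G \<psi>)))"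
    using assms by (intro sum.cong refl) (auto simp: hom_density_labeled_product subset_iff sum_distrib_left intro!: sum.cong)
  also have "\<dots> = (\<Sum>F\<in>S. \<Sum>\<psi>\<in>?P. \<Sum>G\<in>S. ?n ^ k * ((c F * ?N F \<psi>) * (c G * ?N G \<psi>)))"
    by (intro sum.cong refl sum.swap)
  also have "\<dots> = (\<Sum>\<psi>\<in>?P. \<Sum>F\<in>S. \<Sum>G\<in>S. ?n ^ k * ((c F * ?N F \<psi>) * (c G * ?N G \<psi>)))"
    by (rule sum.swap)
  also have "\<dots> = (\<Sum>\<psi>\<in>?P. ?n ^ k * ((\<Sum>F\<in>S. c F * ?N F \<psi>) * (\<Sum>F\<in>S. c F * ?N F \<psi>)))"
    by (intro sum.cong refl) (simp only: sum_product, simp only: sum_distrib_left)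
  also have "0 \<le> \<dots>" by (intro sum_nonneg mult_nonneg_nonneg[OF _ zero_le_square]) simp
  finally show "0 \<le> (\<Sum>F\<in>S. \<Sum>G\<in>S. c F * c G * hom_density (labeled_product k F G) B)" .
qed

lemma psd_on_limit:
  assumes "finite S" "\<And>n::nat. psd_on S (K n)"
    "\<And>x y. x \<in> S \<Longrightarrow> y \<in> S \<Longrightarrow> (\<lambda>n. K n x y) \<longlonglongrightarrow> L x y"
  shows "psd_on S L"
  unfolding psd_on_def
proof (intro conjI ballI allI)
  fix x y assume xy: "x \<in> S" "y \<in> S"
  have "(\<lambda>n. K n x y) = (\<lambda>n. K n y x)" using assms(2) xy unfolding psd_on_def by auto
  then show "L x y = L y x"
    using assms(3)[OF xy] assms(3)[OF xy(2,1)] by (metis LIMSEQ_unique)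
next
  fix c :: "'a \<Rightarrow> real"
  have "(\<lambda>n. \<Sum>x\<in>S. \<Sum>y\<in>S. c x * c y * K n x y) \<longlonglongrightarrow> (\<Sum>x\<in>S. \<Sum>y\<in>S. c x * c y * L x y)"
    by (intro tendsto_sum tendsto_mult tendsto_const assms(3))
  then show "0 \<le> (\<Sum>x\<in>S. \<Sum>y\<in>S. c x * c y * L x y)"
    by (rule LIMSEQ_le_const) (auto intro: psd_on_nonneg[OF assms(2)])
qed

lemma single_vertex_in_multigraphs: "0\<^sub>m 1 1 \<in> multigraphs"
  by (rule adjacency_mats_multigraphs[of _ 1]) (auto intro!: adjacency_matsI)

section \<open>Properties inherited by limits of densities\<close>

lemma density_limit_imp_normalized:
  assumes "is_density_limit f"
  shows "normalized f"
proof -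
  obtain G where G: "\<And>n::nat. G n \<in> multigraphs" "\<And>F. F \<in> multigraphs \<Longrightarrow> (\<lambda>n. hom_density F (G n)) \<longlonglongrightarrow> f F"
    using assms unfolding is_density_limit_def by blast
  have "hom_density (0\<^sub>m 1 1) (G n) = 1" for n
  proof -
    have "1 \<le> dim_row (G n)" using G(1) by (simp add: multigraphs_iff)
    moreover have "mat_homs (0\<^sub>m 1 1) (G n) = {..<1} \<rightarrow>\<^sub>E {..<dim_row (G n)}" by (auto simp: mat_homs_def)
    ultimately show ?thesis by (simp add: hom_density_mat_homs card_PiE)
  qed
  with G(2)[OF single_vertex_in_multigraphs] show ?thesis
    by (simp add: normalized_def LIMSEQ_const_iff)
qed

lemma density_limit_imp_multiplicative:
  assumes "is_density_limit f"
  shows "multiplicative f"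
  unfolding multiplicative_def
proof (intro ballI)
  fix F F' assume F: "F \<in> multigraphs" "F' \<in> multigraphs"
  obtain G where G: "\<And>n::nat. G n \<in> multigraphs" "\<And>F. F \<in> multigraphs \<Longrightarrow> (\<lambda>n. hom_density F (G n)) \<longlonglongrightarrow> f F"
    using assms unfolding is_density_limit_def by blast
  have "(\<lambda>n. hom_density F (G n) * hom_density F' (G n)) \<longlonglongrightarrow> f F * f F'"
    by (intro tendsto_mult G F)
  then have "(\<lambda>n. hom_density (disjoint_union F F') (G n)) \<longlonglongrightarrow> f F * f F'"
    by (simp add: hom_density_disjoint_union F)
  with G(2)[OF disjoint_union_in_multigraphs[OF F]] show "f (disjoint_union F F') = f F * f F'"
    by (rule LIMSEQ_unique)
qed

lemma density_limit_imp_reflection_positive: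
  assumes "is_density_limit f"
  shows "reflection_positive f"
  unfolding reflection_positive_def
proof (intro allI impI)
  fix k S assume S: "finite S" "S \<subseteq> labeled_multigraphs k"
  obtain G where G: "\<And>n::nat. G n \<in> multigraphs" "\<And>F. F \<in> multigraphs \<Longrightarrow> (\<lambda>n. hom_density F (G n)) \<longlonglongrightarrow> f F"
    using assms unfolding is_density_limit_def by blast
  show "psd_on S (\<lambda>F G. f (labeled_product k F G))"
  proof (rule psd_on_limit[OF S(1)])
    show "psd_on S (\<lambda>F F'. hom_density (labeled_product k F F') (G n))" for n
      using G(1)[of n] by (intro hom_density_psd S) (simp add: multigraphs_iff)
    show "(\<lambda>n. hom_density (labeled_product k F F') (G n)) \<longlonglongrightarrow> f (labeled_product k F F')"
      if "F \<in> S" "F' \<in> S" for F F'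
      using that S by (intro G(2) labeled_product_in_multigraphs) auto
  qed
qed

subsection \<open>Sampling from the Moebius transform\<close>

lemma sum_PiE_insert:
  assumes "q \<notin> Q"
  shows "(\<Sum>h\<in>PiE (insert q Q) T. \<Phi> h) = (\<Sum>m\<in>T q. \<Sum>h\<in>PiE Q T. \<Phi> (h(q := m)))"
proof -
  have "(\<Sum>h\<in>PiE (insert q Q) T. \<Phi> h) = (\<Sum>(m, h)\<in>T q \<times> PiE Q T. \<Phi> (h(q := m)))"
    unfolding PiE_insert_eq sum.reindex[OF inj_combinator[OF assms]] o_def by (simp add: case_prod_unfold)
  then show ?thesis by (simp add: sum.cartesian_product)
qed

text \<open>Telescoping in several dimensions: the inner sum is a mixed first difference of
  \<open>g\<close>, and summing it over a box leaves the signed corner values. \<open>b\<close>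
  holds the coordinates outside \<open>Q\<close>, so in the induction the coordinate that is split
  off can be frozen at \<open>m\<close> there.\<close>

lemma sum_alternating_box:
  fixes g :: "('a \<Rightarrow> nat) \<Rightarrow> real"
  assumes "finite Q" "\<And>p. p \<in> Q \<Longrightarrow> a p \<le> N"
  shows "(\<Sum>h\<in>PiE Q (\<lambda>p. {a p..<N}). \<Sum>S\<in>Pow Q. (-1) ^ card S *
            g (\<lambda>p. (if p \<in> Q then h p else b p) + of_bool (p \<in> S)))
       = (\<Sum>S\<in>Pow Q. (-1) ^ card S * g (\<lambda>p. if p \<in> Q then (if p \<in> S then N else a p) else b p))"
  using assms
proof (induction Q arbitrary: g b)
  case (insert q Q)
  have card: "card (insert q S) = Suc (card S)" if "S \<in> Pow Q" for S
    using that insert.hyps by (subst card_insert_disjoint) (auto intro: finite_subset)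
  \<comment> \<open>The first difference in direction \<open>q\<close>; the induction hypothesis
    applied to it leaves a one-dimensional telescoping sum over \<open>m\<close>.\<close>
  define g' where "g' = (\<lambda>b. g b - g (b(q := Suc (b q))))"
  have 1: "(\<Sum>S\<in>Pow (insert q Q). (-1) ^ card S *
            g (\<lambda>p. (if p \<in> insert q Q then (h(q := m)) p else b p) + of_bool (p \<in> S)))
      = (\<Sum>S\<in>Pow Q. (-1) ^ card S * g' (\<lambda>p. (if p \<in> Q then h p else (b(q := m)) p) + of_bool (p \<in> S)))" for h m
  proof -
    have a1: "(\<lambda>p. (if p \<in> insert q Q then (h(q := m)) p else b p) + of_bool (p \<in> S))
        = (\<lambda>p. (if p \<in> Q then h p else (b(q := m)) p) + of_bool (p \<in> S))" for S
      using insert.hyps by (auto simp: fun_eq_iff)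
    have a2: "(\<lambda>p. (if p \<in> Q then h p else (b(q := m)) p) + of_bool (p \<in> insert q S))
        = (\<lambda>p. (if p \<in> Q then h p else (b(q := m)) p) + of_bool (p \<in> S))
           (q := Suc ((if q \<in> Q then h q else (b(q := m)) q) + of_bool (q \<in> S)))" if "S \<in> Pow Q" for S
      using insert.hyps that by (auto simp: fun_eq_iff)
    show ?thesis
      unfolding sum_Pow_insert[OF insert.hyps] a1 g'_def
      by (intro sum.cong refl) (simp only: a2 card, simp add: algebra_simps)
  qed
  have 2: "g' (\<lambda>p. if p \<in> Q then (if p \<in> S then N else a p) else (b(q := m)) p)
      = g (\<lambda>p. if p \<in> Q then (if p \<in> S then N else a p) else (b(q := m)) p)
      - g (\<lambda>p. if p \<in> Q then (if p \<in> S then N else a p) else (b(q := Suc m)) p)" for S m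
    unfolding g'_def using insert.hyps by (auto intro!: arg_cong[where f=g] simp: fun_eq_iff)
  have 3: "(\<lambda>p. if p \<in> Q then (if p \<in> S then N else a p) else (b(q := a q)) p)
      = (\<lambda>p. if p \<in> insert q Q then (if p \<in> S then N else a p) else b p)"
    "(\<lambda>p. if p \<in> Q then (if p \<in> S then N else a p) else (b(q := N)) p)
      = (\<lambda>p. if p \<in> insert q Q then (if p \<in> insert q S then N else a p) else b p)" if "S \<in> Pow Q" for S
    using insert.hyps that by (auto simp: fun_eq_iff)
  have tel: "(\<Sum>m\<in>{a q..<N}. u m - u (Suc m)) = u (a q) - u N" for u :: "nat \<Rightarrow> real"
    using sum_Suc_diff'[of "a q" N "\<lambda>m. - u m"] insert.prems by simp
  have "(\<Sum>h\<in>PiE (insert q Q) (\<lambda>p. {a p..<N}). \<Sum>S\<in>Pow (insert q Q). (-1) ^ card S *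
            g (\<lambda>p. (if p \<in> insert q Q then h p else b p) + of_bool (p \<in> S)))
      = (\<Sum>m\<in>{a q..<N}. \<Sum>h\<in>PiE Q (\<lambda>p. {a p..<N}). \<Sum>S\<in>Pow Q. (-1) ^ card S *
           g' (\<lambda>p. (if p \<in> Q then h p else (b(q := m)) p) + of_bool (p \<in> S)))"
    unfolding sum_PiE_insert[OF insert.hyps(2)] 1 ..
  also have "\<dots> = (\<Sum>m\<in>{a q..<N}. \<Sum>S\<in>Pow Q. (-1) ^ card S *
           g' (\<lambda>p. if p \<in> Q then (if p \<in> S then N else a p) else (b(q := m)) p))"
    by (intro sum.cong refl insert.IH) (use insert.prems in auto)
  also have "\<dots> = (\<Sum>S\<in>Pow Q. (-1) ^ card S * (\<Sum>m\<in>{a q..<N}.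
           g' (\<lambda>p. if p \<in> Q then (if p \<in> S then N else a p) else (b(q := m)) p)))"
    unfolding sum_distrib_left by (rule sum.swap)
  also have "\<dots> = (\<Sum>S\<in>Pow Q. (-1) ^ card S *
      (g (\<lambda>p. if p \<in> insert q Q then (if p \<in> S then N else a p) else b p)
       - g (\<lambda>p. if p \<in> insert q Q then (if p \<in> insert q S then N else a p) else b p)))"
    unfolding 2
    by (intro sum.cong refl) (simp only: tel[where u = "\<lambda>m. g (\<lambda>p. if p \<in> Q then _ p else (b(q := m)) p)"] 3)
  also have "\<dots> = (\<Sum>S\<in>Pow (insert q Q). (-1) ^ card S *
      g (\<lambda>p. if p \<in> insert q Q then (if p \<in> S then N else a p) else b p))"
    unfolding sum_Pow_insert[OF insert.hyps] by (intro sum.cong refl) (simp only: card, simp add: algebra_simps)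
  finally show ?case .
qed auto

text \<open>The Moebius transform plays the role of the law of a random multigraph on \<open>n\<close> vertices,
  here truncated to edge multiplicities below \<open>N\<close>.\<close>

definition moebius_sum :: "(nat mat \<Rightarrow> real) \<Rightarrow> nat \<Rightarrow> nat \<Rightarrow> (nat mat \<Rightarrow> real) \<Rightarrow> real" where
  "moebius_sum f n N \<phi> = (\<Sum>h\<in>vertex_pairs n \<rightarrow>\<^sub>E {..<N}. moebius_transform f (edge_mat n h) * \<phi> (edge_mat n h))"

text \<open>After telescoping, the corner \<open>S = {}\<close> is \<open>f A\<close>. At every
  other corner some edge count equals \<open>N\<close>, so non-defectiveness sends its value to
  0.\<close>

lemma moebius_sum_tail:
  assumes nd: "non_defective f" and n: "1 \<le> n" and A: "A \<in> adjacency_mats n"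
  shows "(\<lambda>N. moebius_sum f n N (\<lambda>B. of_bool (\<forall>i<n. \<forall>j<n. A $$ (i, j) \<le> B $$ (i, j)))) \<longlonglongrightarrow> f A"
proof -
  let ?P = "vertex_pairs n"
  define a where "a = edge_count A"
  have A_eq: "A = edge_mat n a" using A by (simp add: a_def edge_mat_edge_count)
  let ?g = "\<lambda>N S. f (edge_mat n (\<lambda>p. if p \<in> S then N else a p))"
  have fin: "eventually (\<lambda>N. \<forall>p\<in>?P. a p \<le> N) sequentially"
    by (intro eventually_ball_finite finite_vertex_pairs ballI eventually_ge_at_top)
  have eq: "moebius_sum f n N (\<lambda>B. of_bool (\<forall>i<n. \<forall>j<n. A $$ (i, j) \<le> B $$ (i, j)))
      = (\<Sum>S\<in>Pow ?P. (-1) ^ card S * ?g N S)" if N: "\<forall>p\<in>?P. a p \<le> N" for N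
  proof -
    have "moebius_sum f n N (\<lambda>B. of_bool (\<forall>i<n. \<forall>j<n. A $$ (i, j) \<le> B $$ (i, j)))
        = (\<Sum>h\<in>?P \<rightarrow>\<^sub>E {..<N}. moebius_transform f (edge_mat n h) * of_bool (\<forall>p\<in>?P. a p \<le> h p))"
      unfolding moebius_sum_def A_eq edge_mat_le_iff ..
    also have "\<dots> = (\<Sum>h\<in>(\<Pi>\<^sub>E p\<in>?P. {a p..<N}). moebius_transform f (edge_mat n h))"
      by (intro sum.mono_neutral_cong_right) (auto intro!: finite_PiE simp: PiE_iff)
    also have "\<dots> = (\<Sum>h\<in>(\<Pi>\<^sub>E p\<in>?P. {a p..<N}). \<Sum>S\<in>Pow ?P. (-1) ^ card S *
         f (edge_mat n (\<lambda>p. (if p \<in> ?P then h p else 0) + of_bool (p \<in> S))))"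
      unfolding moebius_transform_edge_mat
      by (intro sum.cong refl arg_cong2[where f = "(*)"] arg_cong[where f = f] edge_mat_cong) auto
    also have "\<dots> = (\<Sum>S\<in>Pow ?P. (-1) ^ card S *
         f (edge_mat n (\<lambda>p. if p \<in> ?P then (if p \<in> S then N else a p) else 0)))"
      by (rule sum_alternating_box[where g = "\<lambda>h. f (edge_mat n h)" and b = "\<lambda>_. 0"]) (use N in auto)
    also have "\<dots> = (\<Sum>S\<in>Pow ?P. (-1) ^ card S * ?g N S)"
      by (intro sum.cong refl arg_cong2[where f = "(*)"] arg_cong[where f = f] edge_mat_cong) auto
    finally show ?thesis .
  qed
  have "(\<lambda>N. ?g N S) \<longlonglongrightarrow> (if S = {} then f A else 0)" if S: "S \<in> Pow ?P" for S
  proof (cases "S = {}")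
    case False
    then obtain q where q: "q \<in> S" by auto
    have "filterlim (\<lambda>N. num_edges (edge_mat n (\<lambda>p. if p \<in> S then N else a p))) at_top sequentially"
      unfolding num_edges_edge_mat
    proof (rule filterlim_at_top_mono[OF filterlim_ident], rule eventuallyI)
      fix N
      have "N = (\<Sum>p\<in>{q}. if p \<in> S then N else a p)" using q by simp
      also have "\<dots> \<le> (\<Sum>p\<in>?P. if p \<in> S then N else a p)" using q S by (intro sum_mono2) auto
      finally show "N \<le> (\<Sum>p\<in>?P. if p \<in> S then N else a p)" .
    qed
    then show ?thesis using nd n edge_mat_in False unfolding non_defective_def by auto
  qed (simp add: A_eq)
  then have "(\<lambda>N. \<Sum>S\<in>Pow ?P. (-1) ^ card S * ?g N S) \<longlonglongrightarrow> (\<Sum>S\<in>Pow ?P. (-1) ^ card S * (if S = {} then f A else 0))"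
    by (intro tendsto_sum tendsto_mult tendsto_const) auto
  also have "(\<Sum>S\<in>Pow ?P. (-1) ^ card S * (if S = {} then f A else 0)) = f A"
    by (subst sum.mono_neutral_right[of _ "{{}}"]) auto
  finally have "(\<lambda>N. \<Sum>S\<in>Pow ?P. (-1) ^ card S * ?g N S) \<longlonglongrightarrow> f A" .
  then show ?thesis
    by (rule Lim_transform_eventually) (use fin in eventually_elim, simp add: eq)
qed

lemma zero_mat_in_multigraphs: "1 \<le> m \<Longrightarrow> 0\<^sub>m m m \<in> multigraphs"
  by (auto intro!: adjacency_mats_multigraphs[of _ m] adjacency_matsI)

text \<open>Gives the truncated laws total mass 1 in the limit, and allows padding by isolated
  vertices.\<close>

lemma parameter_zero_mat:
  assumes "normalized f" "multiplicative f" "1 \<le> m"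
  shows "f (0\<^sub>m m m) = 1"
  using assms(3)
proof (induction m rule: dec_induct)
  case base
  then show ?case using assms(1) by (simp add: normalized_def)
next
  case (step m)
  have "0\<^sub>m (Suc m) (Suc m) = disjoint_union (0\<^sub>m 1 1) (0\<^sub>m m m)"
    by (intro eq_matI) (auto simp: disjoint_union_def)
  then have "f (0\<^sub>m (Suc m) (Suc m)) = f (0\<^sub>m 1 1) * f (0\<^sub>m m m)"
    using assms(2) zero_mat_in_multigraphs[of 1] zero_mat_in_multigraphs[OF step.hyps(1)]
    by (simp add: multiplicative_def)
  then show ?case using step.IH assms(1) by (simp add: normalized_def)
qed

section \<open>Expected densities of the sampled multigraph\<close>

lemma inj_extends_to_permutation:
  assumes "inj_on \<phi> {..<k}" "\<phi> ` {..<k} \<subseteq> {..<n::nat}"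
  obtains \<sigma> where "\<sigma> permutes {..<n}" "\<And>i. i < k \<Longrightarrow> \<sigma> i = \<phi> i"
proof -
  have "card (\<phi> ` {..<k}) = k" using assms(1) by (simp add: card_image)
  then have k: "k \<le> n" using card_mono[OF _ assms(2)] by simp
  have "card {k..<n} = card ({..<n} - \<phi> ` {..<k})"
    using assms k by (simp add: card_Diff_subset card_image)
  then obtain g where g: "bij_betw g {k..<n} ({..<n} - \<phi> ` {..<k})"
    using finite_same_card_bij[of "{k..<n}" "{..<n} - \<phi> ` {..<k}"] by auto
  define \<sigma> where "\<sigma> = (\<lambda>i. if i < k then \<phi> i else if i < n then g i else i)"
  have "bij_betw \<sigma> {..<k} (\<phi> ` {..<k})"
    using assms(1) by (auto simp: bij_betw_def \<sigma>_def inj_on_def)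
  moreover have "bij_betw \<sigma> {k..<n} ({..<n} - \<phi> ` {..<k})"
    by (rule bij_betw_cong[THEN iffD1, OF _ g]) (auto simp: \<sigma>_def)
  ultimately have "bij_betw \<sigma> ({..<k} \<union> {k..<n}) (\<phi> ` {..<k} \<union> ({..<n} - \<phi> ` {..<k}))"
    by (rule bij_betw_combine) auto
  moreover have "{..<k} \<union> {k..<n} = {..<n}" "\<phi> ` {..<k} \<union> ({..<n} - \<phi> ` {..<k}) = {..<n}"
    using k assms(2) by auto
  ultimately have "\<sigma> permutes {..<n}"
    by (intro bij_imp_permutes) (use k in \<open>auto simp: \<sigma>_def\<close>)
  then show ?thesis by (rule that) (simp add: \<sigma>_def)
qed

text \<open>Placing \<open>F\<close> on the image of \<open>\<phi>\<close> turns the event that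
  \<open>\<phi>\<close> is a homomorphism into domination of one matrix \<open>A\<close>. Isolated
  vertices and renumbering preserve \<open>f\<close>; \<open>k < n\<close> provides at least one
  isolated vertex, as the padding has to be a multigraph itself.\<close>

lemma pushforward_injective:
  assumes f: "multigraph_parameter f" "normalized f" "multiplicative f"
    and F: "F \<in> multigraphs" "dim_row F = k" "k < n"
    and \<phi>: "inj_on \<phi> {..<k}" "\<phi> ` {..<k} \<subseteq> {..<n}"
  obtains A where "A \<in> adjacency_mats n" "f A = f F"
    "\<And>b. (\<forall>i<n. \<forall>j<n. A $$ (i, j) \<le> (b i j :: nat)) \<longleftrightarrow> (\<forall>i<k. \<forall>j<k. F $$ (i, j) \<le> b (\<phi> i) (\<phi> j))"
proof -
  obtain \<sigma> where \<sigma>: "\<sigma> permutes {..<n}" "\<And>i. i < k \<Longrightarrow> \<sigma> i = \<phi> i"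
    using inj_extends_to_permutation[OF \<phi>] by metis
  define \<pi> where "\<pi> = inv_into UNIV \<sigma>"
  have \<pi>: "\<pi> permutes {..<n}" unfolding \<pi>_def using \<sigma>(1) by (rule permutes_inv)
  have Fa: "F \<in> adjacency_mats k" using F by (simp add: multigraphs_iff)
  define F' where "F' = disjoint_union F (0\<^sub>m (n - k) (n - k))"
  have F': "F' \<in> multigraphs" unfolding F'_def using F by (intro disjoint_union_in_multigraphs zero_mat_in_multigraphs) auto
  have dF': "dim_row F' = n" using F by (simp add: F'_def disjoint_union_def)
  have F'a: "F' \<in> adjacency_mats n" using F' dF' by (simp add: multigraphs_iff)
  have F'_index: "F' $$ (i, j) = (if i < k \<and> j < k then F $$ (i, j) else 0)" if "i < n" "j < n" for i j
    using that F adjacency_mats_dim[OF Fa] by (auto simp: F'_def disjoint_union_def)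
  have fF': "f F' = f F"
    using f(3) F parameter_zero_mat[OF f(2,3), of "n - k"] zero_mat_in_multigraphs[of "n - k"]
    by (simp add: multiplicative_def F'_def)
  define A where "A = Matrix.mat n n (\<lambda>(i, j). F' $$ (\<pi> i, \<pi> j))"
  have \<pi>lt: "\<pi> i < n \<longleftrightarrow> i < n" for i using permutes_in_image[OF \<pi>, of i] by simp
  have \<sigma>lt: "\<sigma> i < n \<longleftrightarrow> i < n" for i using permutes_in_image[OF \<sigma>(1), of i] by simp
  have A: "A \<in> adjacency_mats n"
    using adjacency_mats_sym[OF F'a] adjacency_mats_even[OF F'a] \<pi>lt by (intro adjacency_matsI) (auto simp: A_def)
  have "labeled_iso 0 F' A"
    unfolding labeled_iso_def using \<pi> dF' by (auto simp: A_def)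
  then have "f F' = f A"
    using f(1) F' A F(3) adjacency_mats_multigraphs[OF A] unfolding multigraph_parameter_def by auto
  moreover have "(\<forall>i<n. \<forall>j<n. A $$ (i, j) \<le> b i j) \<longleftrightarrow> (\<forall>i<k. \<forall>j<k. F $$ (i, j) \<le> b (\<phi> i) (\<phi> j))" for b
  proof (intro iffI allI impI)
    fix i j assume L: "\<forall>i<n. \<forall>j<n. A $$ (i, j) \<le> b i j" and ij: "i < k" "j < k"
    then have lt: "i < n" "j < n" using F by auto
    have "A $$ (\<sigma> i, \<sigma> j) \<le> b (\<sigma> i) (\<sigma> j)" using L lt \<sigma>lt by auto
    moreover have "A $$ (\<sigma> i, \<sigma> j) = F $$ (i, j)"
      using lt \<sigma>lt ij permutes_inverses(2)[OF \<sigma>(1)] by (simp add: A_def \<pi>_def F'_index)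
    ultimately show "F $$ (i, j) \<le> b (\<phi> i) (\<phi> j)" using \<sigma>(2) ij by simp
  next
    fix i j assume R: "\<forall>i<k. \<forall>j<k. F $$ (i, j) \<le> b (\<phi> i) (\<phi> j)" and ij: "i < n" "j < n"
    have A_ij: "A $$ (i, j) = (if \<pi> i < k \<and> \<pi> j < k then F $$ (\<pi> i, \<pi> j) else 0)"
      using ij \<pi>lt by (simp add: A_def F'_index)
    show "A $$ (i, j) \<le> b i j"
    proof (cases "\<pi> i < k \<and> \<pi> j < k")
      case True
      then have "\<phi> (\<pi> i) = i" "\<phi> (\<pi> j) = j"
        using \<sigma>(2) permutes_inverses(1)[OF \<sigma>(1)] by (metis \<pi>_def)+
      with True R A_ij show ?thesis by force
    next
      case False
      then show ?thesis unfolding A_ij if_not_P[OF False] by simp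
    qed
  qed
  ultimately show ?thesis using A fF' by (intro that[of A]) auto
qed

lemma hom_density_sum:
  assumes "dim_row B = n"
  shows "hom_density F B = (\<Sum>\<phi>\<in>{..<dim_row F} \<rightarrow>\<^sub>E {..<n}.
     of_bool (\<forall>i<dim_row F. \<forall>j<dim_row F. F $$ (i, j) \<le> B $$ (\<phi> i, \<phi> j))) / real n ^ dim_row F"
proof -
  have fin: "finite ({..<dim_row F} \<rightarrow>\<^sub>E {..<n})" by (intro finite_PiE) auto
  have "mat_homs F B = ({..<dim_row F} \<rightarrow>\<^sub>E {..<n}) \<inter>
     {\<phi>. \<forall>i<dim_row F. \<forall>j<dim_row F. F $$ (i, j) \<le> B $$ (\<phi> i, \<phi> j)}"
    using assms by (auto simp: mat_homs_def)
  then show ?thesis using fin assms by (simp add: hom_density_mat_homs)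
qed

lemma inj_proportion:
  "(\<lambda>n. real (card {\<phi> \<in> {..<k} \<rightarrow>\<^sub>E {..<n}. inj_on \<phi> {..<k}}) / real n ^ k) \<longlonglongrightarrow> 1"
proof -
  have c: "real (card {\<phi> \<in> {..<k} \<rightarrow>\<^sub>E {..<n}. inj_on \<phi> {..<k}}) / real n ^ k = (\<Prod>i<k. real (n - i) / real n)" for n
    by (subst card_inj_on_subset_funcset) (auto simp: prod_dividef atLeast0LessThan)
  have "(\<lambda>n. \<Prod>i<k. real (n - i) / real n) \<longlonglongrightarrow> (\<Prod>i<k. 1)"
  proof (rule tendsto_prod)
    fix i
    have "(\<lambda>n. 1 - real i / real n) \<longlonglongrightarrow> 1 - 0"
      by (intro tendsto_diff tendsto_const lim_const_over_n)
    then have "(\<lambda>n. 1 - real i / real n) \<longlonglongrightarrow> 1" by simp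
    then show "(\<lambda>n. real (n - i) / real n) \<longlonglongrightarrow> 1"
    proof (rule Lim_transform_eventually)
      show "eventually (\<lambda>n. 1 - real i / real n = real (n - i) / real n) sequentially"
        using eventually_ge_at_top[of "Suc i"] by eventually_elim (auto simp: field_simps)
    qed
  qed
  then show ?thesis unfolding c by simp
qed

lemma moebius_sum_scale: "moebius_sum f n N (\<lambda>B. \<phi> B * c) = moebius_sum f n N \<phi> * c"
  by (simp add: moebius_sum_def sum_distrib_right mult.assoc)

lemma moebius_sum_sum: "moebius_sum f n N (\<lambda>B. \<Sum>i\<in>I. \<phi> i B) = (\<Sum>i\<in>I. moebius_sum f n N (\<phi> i))"
  unfolding moebius_sum_def sum_distrib_left by (rule sum.swap)

lemma moebius_sum_mono:
  assumes "\<forall>A\<in>adjacency_mats n. 0 \<le> moebius_transform f A" "\<And>B. B \<in> adjacency_mats n \<Longrightarrow> \<phi> B \<le> \<psi> B"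
  shows "moebius_sum f n N \<phi> \<le> moebius_sum f n N \<psi>"
  unfolding moebius_sum_def using assms edge_mat_in by (intro sum_mono mult_left_mono) auto

text \<open>Each injective map contributes exactly \<open>f F\<close> in the limit \<open>N\<close>
  to infinity, whereas the maps that are not injective form a vanishing proportion. The required
  \<open>N\<close> depends on \<open>n\<close>, hence the nested limits.\<close>

lemma moebius_sum_hom_density:
  assumes f: "multigraph_parameter f" "normalized f" "multiplicative f" "non_defective f"
    and pos: "\<And>k A. 1 \<le> k \<Longrightarrow> A \<in> adjacency_mats k \<Longrightarrow> 0 \<le> moebius_transform f A"
    and F: "F \<in> multigraphs" and e: "0 < (e::real)"
  shows "eventually (\<lambda>n. eventually (\<lambda>N. \<bar>moebius_sum f n N (hom_density F) - f F\<bar> < e) sequentially) sequentially"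
proof -
  define k where "k = dim_row F"
  define I where "I = (\<lambda>n. {\<phi> \<in> {..<k} \<rightarrow>\<^sub>E {..<n::nat}. inj_on \<phi> {..<k}})"
  define \<rho> where "\<rho> = (\<lambda>n. real (card (I n)) / real n ^ k)"
  have "(\<lambda>n. (1 - \<rho> n) * (1 + \<bar>f F\<bar>)) \<longlonglongrightarrow> (1 - 1) * (1 + \<bar>f F\<bar>)"
    unfolding \<rho>_def I_def by (intro tendsto_intros inj_proportion)
  then have "eventually (\<lambda>n. (1 - \<rho> n) * (1 + \<bar>f F\<bar>) < e) sequentially"
    using e by (intro order_tendstoD) auto
  then show ?thesis
    using eventually_gt_at_top[of k]
  proof eventually_elim
    case (elim n)
    then have n: "1 \<le> n" "k < n" by auto
    let ?P = "{..<k} \<rightarrow>\<^sub>E {..<n}"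
    have finP: "finite ?P" by (intro finite_PiE) auto
    have cardP: "real (card ?P) = real n ^ k" by (simp add: card_PiE)
    let ?E = "moebius_sum f n"
    let ?b = "\<lambda>\<phi> B. of_bool (\<forall>i<k. \<forall>j<k. F $$ (i, j) \<le> B $$ (\<phi> i, \<phi> j)) :: real"
    have posn: "\<forall>A\<in>adjacency_mats n. 0 \<le> moebius_transform f A" using pos n by blast
    have IP: "I n \<subseteq> ?P" by (auto simp: I_def)
    have E1: "(\<lambda>N. ?E N (\<lambda>_. 1)) \<longlonglongrightarrow> 1"
    proof -
      have "0\<^sub>m n n \<in> adjacency_mats n" by (auto intro!: adjacency_matsI)
      from moebius_sum_tail[OF f(4) n(1) this] show ?thesis using parameter_zero_mat[OF f(2,3) n(1)] by simp
    qed
    have lim: "(\<lambda>N. ?E N (?b \<phi>)) \<longlonglongrightarrow> f F" if "\<phi> \<in> I n" for \<phi>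
    proof -
      obtain A where A: "A \<in> adjacency_mats n" "f A = f F"
        "\<And>b. (\<forall>i<n. \<forall>j<n. A $$ (i, j) \<le> (b i j :: nat)) \<longleftrightarrow> (\<forall>i<k. \<forall>j<k. F $$ (i, j) \<le> b (\<phi> i) (\<phi> j))"
        by (rule pushforward_injective[OF f(1-3) F k_def[symmetric] n(2), of \<phi>])
          (use \<open>\<phi> \<in> I n\<close> in \<open>auto simp: I_def\<close>)
      from moebius_sum_tail[OF f(4) n(1) A(1)] show ?thesis
        unfolding A(2) A(3)[of "\<lambda>i j. _ $$ (i, j)"] .
    qed
    \<comment> \<open>Bounds the deviation at truncation \<open>N\<close>: injective maps enter with
      their own errors, the others with the trivial bound. Its limit in \<open>N\<close> is below
      \<open>e\<close> by the choice of \<open>n\<close>.\<close>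
    define H where "H = (\<lambda>N. (\<Sum>\<phi>\<in>I n. \<bar>?E N (?b \<phi>) - f F\<bar>) / real n ^ k + (1 - \<rho> n) * (?E N (\<lambda>_. 1) + \<bar>f F\<bar>))"
    have "H \<longlonglongrightarrow> (\<Sum>\<phi>\<in>I n. \<bar>f F - f F\<bar>) / real n ^ k + (1 - \<rho> n) * (1 + \<bar>f F\<bar>)"
      unfolding H_def using n by (intro tendsto_intros lim E1) auto
    then have "eventually (\<lambda>N. H N < e) sequentially" using elim(1) by (intro order_tendstoD) auto
    then show ?case
    proof eventually_elim
      case (elim N)
      have dens: "?E N (hom_density F) = (\<Sum>\<phi>\<in>?P. ?E N (?b \<phi>)) / real n ^ k"
      proof -
        have "?E N (hom_density F) = ?E N (\<lambda>B. (\<Sum>\<phi>\<in>?P. ?b \<phi> B) * (1 / real n ^ k))"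
          unfolding moebius_sum_def by (intro sum.cong refl arg_cong2[where f="(*)"]) (simp add: hom_density_sum[of _ n] k_def)
        then show ?thesis unfolding moebius_sum_scale moebius_sum_sum by simp
      qed
      have "?E N (hom_density F) - f F = (\<Sum>\<phi>\<in>?P. ?E N (?b \<phi>) - f F) / real n ^ k"
        using n by (simp add: dens sum_subtractf cardP diff_divide_distrib)
      also have "(\<Sum>\<phi>\<in>?P. ?E N (?b \<phi>) - f F) = (\<Sum>\<phi>\<in>I n. ?E N (?b \<phi>) - f F) + (\<Sum>\<phi>\<in>?P - I n. ?E N (?b \<phi>) - f F)"
        using finP IP by (simp add: sum.subset_diff add.commute)
      finally have "\<bar>?E N (hom_density F) - f F\<bar> = \<bar>(\<Sum>\<phi>\<in>I n. ?E N (?b \<phi>) - f F) + (\<Sum>\<phi>\<in>?P - I n. ?E N (?b \<phi>) - f F)\<bar> / real n ^ k"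
        by simp
      also have "\<dots> \<le> ((\<Sum>\<phi>\<in>I n. \<bar>?E N (?b \<phi>) - f F\<bar>) + (\<Sum>\<phi>\<in>?P - I n. ?E N (\<lambda>_. 1) + \<bar>f F\<bar>)) / real n ^ k"
      proof (intro divide_right_mono order_trans[OF abs_triangle_ineq] add_mono order_trans[OF sum_abs] sum_mono)
        fix \<phi>
        have "0 \<le> ?E N (?b \<phi>)" unfolding moebius_sum_def using posn edge_mat_in by (intro sum_nonneg mult_nonneg_nonneg) auto
        moreover have "?E N (?b \<phi>) \<le> ?E N (\<lambda>_. 1)" by (intro moebius_sum_mono posn) auto
        ultimately show "\<bar>?E N (?b \<phi>) - f F\<bar> \<le> ?E N (\<lambda>_. 1) + \<bar>f F\<bar>" by linarith
      qed auto
      also have "\<dots> = H N"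
      proof -
        have "real (card (?P - I n)) = real n ^ k - real (card (I n))"
          using finP IP card_mono[OF finP IP] cardP by (simp add: card_Diff_subset finite_subset of_nat_diff)
        then have "real (card (?P - I n)) / real n ^ k = 1 - \<rho> n" using n by (simp add: \<rho>_def diff_divide_distrib)
        from this[symmetric] show ?thesis by (simp add: H_def add_divide_distrib)
      qed
      finally show ?case using elim by simp
    qed
  qed
qed

text \<open>The total squared deviation has expectation below \<open>d / 2\<close> while the total
  mass is at least 1/2, so some multigraph has deviation below \<open>d\<close>.\<close>

lemma moebius_nonneg_approximation:
  assumes f: "multigraph_parameter f" "normalized f" "multiplicative f" "non_defective f"
    and pos: "\<And>k A. 1 \<le> k \<Longrightarrow> A \<in> adjacency_mats k \<Longrightarrow> 0 \<le> moebius_transform f A"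
    and S: "finite S" "S \<subseteq> multigraphs" and d: "0 < (d::real)"
  shows "\<exists>B\<in>multigraphs. \<forall>F\<in>S. (hom_density F B - f F)\<^sup>2 < d"
proof -
  \<comment> \<open>Expanding the square gives moments of \<open>disjoint_union F F\<close>,
    \<open>F\<close> and 1, each known up to \<open>e\<close>; \<open>C\<close> collects the
    coefficients of \<open>e\<close>.\<close>
  define C where "C = (\<Sum>F\<in>S. 1 + 2 * \<bar>f F\<bar> + (f F)\<^sup>2)"
  have C: "0 \<le> C" unfolding C_def by (intro sum_nonneg) auto
  \<comment> \<open>The bound 1/2 keeps the mass away from 0; \<open>C + 1\<close> in place of
    \<open>C\<close> covers \<open>C = 0\<close> and makes \<open>e * C < d / 2\<close>
    strict.\<close>
  define e where "e = min (1/2) (d / (2 * (C + 1)))"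
  have e: "0 < e" "e \<le> 1/2" "e * C < d / 2"
  proof -
    show "0 < e" using d C by (simp add: e_def)
    show "e \<le> 1/2" unfolding e_def by (rule min.cobounded1)
    have "e * C \<le> d / (2 * (C + 1)) * C" using C by (intro mult_right_mono) (auto simp: e_def)
    also have "\<dots> < d / 2" using d C by (simp add: field_simps)
    finally show "e * C < d / 2" .
  qed
  \<comment> \<open>\<open>disjoint_union F F\<close> supplies second moments. The single vertex has
    density 1 in every multigraph, so its expectation measures the total mass.\<close>
  define T where "T = insert (0\<^sub>m 1 1) (S \<union> (\<lambda>F. disjoint_union F F) ` S)"
  have T: "finite T" "T \<subseteq> multigraphs"
    using S single_vertex_in_multigraphs disjoint_union_in_multigraphs by (auto simp: T_def)
  have "eventually (\<lambda>n. \<forall>F\<in>T. eventually (\<lambda>N. \<bar>moebius_sum f n N (hom_density F) - f F\<bar> < e) sequentially) sequentially"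
    using T e by (intro eventually_ball_finite) (auto intro!: moebius_sum_hom_density f pos)
  then have "eventually (\<lambda>n. 1 \<le> n \<and> (\<forall>F\<in>T. eventually (\<lambda>N. \<bar>moebius_sum f n N (hom_density F) - f F\<bar> < e) sequentially)) sequentially"
    using eventually_ge_at_top[of 1] by eventually_elim auto
  then obtain n where n: "1 \<le> n" "\<forall>F\<in>T. eventually (\<lambda>N. \<bar>moebius_sum f n N (hom_density F) - f F\<bar> < e) sequentially"
    by (auto dest: eventually_happens)
  then have "eventually (\<lambda>N. \<forall>F\<in>T. \<bar>moebius_sum f n N (hom_density F) - f F\<bar> < e) sequentially"
    using T by (intro eventually_ball_finite) auto
  from eventually_happens[OF this] obtain N
    where N: "\<And>F. F \<in> T \<Longrightarrow> \<bar>moebius_sum f n N (hom_density F) - f F\<bar> < e"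
    by auto
  have posn: "\<forall>A\<in>adjacency_mats n. 0 \<le> moebius_transform f A" using pos n by blast
  let ?E = "moebius_sum f n N"
  let ?dev = "\<lambda>B. \<Sum>F\<in>S. (hom_density F B - f F)\<^sup>2"
  have one: "?E (hom_density (0\<^sub>m 1 1)) = ?E (\<lambda>_. 1)"
  proof -
    have "hom_density (0\<^sub>m 1 1) (edge_mat n h) = 1" for h
      using n(1) by (simp add: hom_density_sum[of _ n] card_PiE)
    then show ?thesis by (simp add: moebius_sum_def)
  qed
  have E1: "\<bar>?E (\<lambda>_. 1) - 1\<bar> < e"
    using N[of "0\<^sub>m 1 1"] f(2) unfolding one normalized_def by (simp add: T_def)
  have dev: "?E (\<lambda>B. (hom_density F B - f F)\<^sup>2) \<le> e * (1 + 2 * \<bar>f F\<bar> + (f F)\<^sup>2)" if F: "F \<in> S" for F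
  proof -
    let ?FF = "disjoint_union F F"
    have Fm: "F \<in> multigraphs" using F S by auto
    have "(hom_density F B - f F)\<^sup>2 = hom_density ?FF B + hom_density F B * (- 2 * f F) + 1 * (f F)\<^sup>2" for B
      by (simp add: hom_density_disjoint_union[OF Fm Fm] power2_eq_square algebra_simps)
    then have "?E (\<lambda>B. (hom_density F B - f F)\<^sup>2)
        = ?E (hom_density ?FF) + ?E (hom_density F) * (- 2 * f F) + ?E (\<lambda>_. 1) * (f F)\<^sup>2"
      unfolding moebius_sum_scale[symmetric]
      by (simp add: moebius_sum_def sum.distrib[symmetric] distrib_left right_diff_distrib)
    also have "\<dots> = (?E (hom_density ?FF) - f ?FF) + (?E (hom_density F) - f F) * (- 2 * f F) + (?E (\<lambda>_. 1) - 1) * (f F)\<^sup>2"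
    proof -
      have "f ?FF = f F * f F" using f(3) Fm by (simp add: multiplicative_def)
      then show ?thesis by (simp add: power2_eq_square algebra_simps)
    qed
    also have "\<dots> \<le> e + e * (2 * \<bar>f F\<bar>) + e * (f F)\<^sup>2"
    proof (intro add_mono)
      show "?E (hom_density ?FF) - f ?FF \<le> e" using N[of ?FF] F by (simp add: T_def)
      have "(?E (hom_density F) - f F) * (- 2 * f F) \<le> \<bar>?E (hom_density F) - f F\<bar> * \<bar>- 2 * f F\<bar>"
        unfolding abs_mult[symmetric] by simp
      also have "\<dots> \<le> e * (2 * \<bar>f F\<bar>)" using N[of F] F by (intro mult_mono) (auto simp: T_def abs_mult)
      finally show "(?E (hom_density F) - f F) * (- 2 * f F) \<le> e * (2 * \<bar>f F\<bar>)" .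
      show "(?E (\<lambda>_. 1) - 1) * (f F)\<^sup>2 \<le> e * (f F)\<^sup>2" using E1 by (intro mult_right_mono) auto
    qed
    finally show ?thesis by (simp add: algebra_simps)
  qed
  have "?E ?dev \<le> e * C"
    unfolding moebius_sum_sum C_def sum_distrib_left by (intro sum_mono dev)
  then have less: "?E ?dev < d / 2" using e by linarith
  have "\<exists>B\<in>adjacency_mats n. ?dev B < d"
  proof (rule ccontr)
    assume "\<not> ?thesis"
    then have "?E (\<lambda>_. 1 * d) \<le> ?E ?dev" by (intro moebius_sum_mono posn) auto
    then have "?E (\<lambda>_. 1) * d < d / 2" using less unfolding moebius_sum_scale by linarith
    moreover have "1/2 * d \<le> ?E (\<lambda>_. 1) * d" using E1 e d by (intro mult_right_mono) auto
    ultimately show False by simp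
  qed
  then obtain B where B: "B \<in> adjacency_mats n" "?dev B < d" by auto
  have "(hom_density F B - f F)\<^sup>2 < d" if "F \<in> S" for F
    using member_le_sum[OF that, of "\<lambda>F. (hom_density F B - f F)\<^sup>2"] S(1) B(2) by simp
  then show ?thesis using B n adjacency_mats_multigraphs by blast
qed

lemma countable_multigraphs: "countable multigraphs"
proof (rule countable_subset)
  show "multigraphs \<subseteq> range (\<lambda>(k, l::nat list list). Matrix.mat k k (\<lambda>(i, j). l ! i ! j))"
  proof
    fix A assume "A \<in> multigraphs"
    then have "A = Matrix.mat (dim_row A) (dim_row A) (\<lambda>(i, j).
        map (\<lambda>i. map (\<lambda>j. A $$ (i, j)) [0..<dim_row A]) [0..<dim_row A] ! i ! j)"
      using adjacency_mats_dim(2)[of A "dim_row A"] by (intro eq_matI) (auto simp: multigraphs_iff)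
    then show "A \<in> range (\<lambda>(k, l::nat list list). Matrix.mat k k (\<lambda>(i, j). l ! i ! j))"
      by (intro image_eqI[where x = "(dim_row A, map (\<lambda>i. map (\<lambda>j. A $$ (i, j)) [0..<dim_row A]) [0..<dim_row A])"]) auto
  qed
qed auto

lemma moebius_nonneg_imp_density_limit:
  assumes f: "multigraph_parameter f" "normalized f" "multiplicative f" "non_defective f"
    and pos: "\<And>k A. 1 \<le> k \<Longrightarrow> A \<in> adjacency_mats k \<Longrightarrow> 0 \<le> moebius_transform f A"
  shows "is_density_limit f"
proof -
  let ?e = "from_nat_into multigraphs"
  have ne: "multigraphs \<noteq> {}" using single_vertex_in_multigraphs by auto
  \<comment> \<open>There are countably many conditions; stage \<open>n\<close> meets those for the
    first \<open>n + 1\<close> multigraphs of an enumeration.\<close>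
  have "\<exists>B\<in>multigraphs. \<forall>F\<in>?e ` {..n}. (hom_density F B - f F)\<^sup>2 < inverse (real (Suc n))" for n
    using from_nat_into[OF ne] by (intro moebius_nonneg_approximation f pos) auto
  then obtain G where G: "\<And>n. G n \<in> multigraphs"
    "\<And>n F. F \<in> ?e ` {..n} \<Longrightarrow> (hom_density F (G n) - f F)\<^sup>2 < inverse (real (Suc n))"
    by metis
  have "(\<lambda>n. hom_density F (G n)) \<longlonglongrightarrow> f F" if F: "F \<in> multigraphs" for F
  proof -
    obtain i where i: "F = ?e i" using from_nat_into_surj[OF countable_multigraphs F] by metis
    have "(\<lambda>n. (hom_density F (G n) - f F)\<^sup>2) \<longlonglongrightarrow> 0"
    proof (rule tendsto_sandwich[OF _ _ tendsto_const LIMSEQ_inverse_real_of_nat])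
      show "eventually (\<lambda>n. (hom_density F (G n) - f F)\<^sup>2 \<le> inverse (real (Suc n))) sequentially"
        using eventually_ge_at_top[of i] by eventually_elim (use G(2) i in \<open>force intro: less_imp_le\<close>)
    qed auto
    then have "(\<lambda>n. hom_density F (G n) - f F) \<longlonglongrightarrow> 0"
      using tendsto_real_sqrt[of "\<lambda>n. (hom_density F (G n) - f F)\<^sup>2" 0] by (simp add: tendsto_rabs_zero_iff)
    then show ?thesis by (simp add: LIM_zero_iff)
  qed
  with G(1) show ?thesis unfolding is_density_limit_def by blast
qed

subsection \<open>Averages over the classes of a finite partition\<close>

text \<open>The value \<open>1\<close> on empty classes keeps averages of tail indicators in \<open>[0, 1]\<close>, antitone in
  the threshold, and equal to \<open>1\<close> at threshold \<open>0\<close>.\<close>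

definition class_avg :: "'a set \<Rightarrow> ('a \<Rightarrow> 'k) \<Rightarrow> ('a \<Rightarrow> real) \<Rightarrow> 'k \<Rightarrow> real" where
  "class_avg X \<kappa> \<phi> c = (if {x \<in> X. \<kappa> x = c} = {} then 1
     else (\<Sum>x\<in>{x \<in> X. \<kappa> x = c}. \<phi> x) / card {x \<in> X. \<kappa> x = c})"

lemma class_avg_mono:
  assumes "\<And>x. x \<in> X \<Longrightarrow> \<phi> x \<le> \<psi> x"
  shows "class_avg X \<kappa> \<phi> c \<le> class_avg X \<kappa> \<psi> c"
  unfolding class_avg_def using assms by (auto intro!: divide_right_mono sum_mono)

lemma class_avg_one:
  assumes "finite X" "\<And>x. x \<in> X \<Longrightarrow> \<phi> x = 1"
  shows "class_avg X \<kappa> \<phi> c = 1"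
  using assms unfolding class_avg_def by (auto simp: card_eq_0_iff)

lemma class_avg_le_1:
  assumes "finite X" "\<And>x. x \<in> X \<Longrightarrow> \<phi> x \<le> 1"
  shows "class_avg X \<kappa> \<phi> c \<le> 1"
  using class_avg_mono[of X \<phi> "\<lambda>_. 1" \<kappa> c] class_avg_one[of X "\<lambda>_. 1" \<kappa> c] assms by auto

lemma class_avg_nonneg:
  assumes "\<And>x. x \<in> X \<Longrightarrow> 0 \<le> \<phi> x"
  shows "0 \<le> class_avg X \<kappa> \<phi> c"
  unfolding class_avg_def using assms by (auto intro!: divide_nonneg_nonneg sum_nonneg)

lemma sum_class:
  assumes "finite X"
  shows "(\<Sum>x\<in>{x \<in> X. \<kappa> x = c}. \<phi> x) = card {x \<in> X. \<kappa> x = c} * class_avg X \<kappa> \<phi> c"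
proof (cases "{x \<in> X. \<kappa> x = c} = {}")
  case True
  show ?thesis unfolding True by simp
next
  case False
  then have "card {x \<in> X. \<kappa> x = c} \<noteq> 0" using assms by (simp only: card_eq_0_iff) simp
  then show ?thesis unfolding class_avg_def if_not_P[OF False] by simp
qed

text \<open>\<open>class_avg\<close> is the conditional expectation given \<open>\<kappa>\<close>
  under counting measure; this is its characteristic property, tested against functions of
  \<open>\<kappa>\<close>.\<close>

lemma sum_class_avg:
  assumes "finite X"
  shows "(\<Sum>x\<in>X. \<phi> x * \<psi> (\<kappa> x)) = (\<Sum>x\<in>X. class_avg X \<kappa> \<phi> (\<kappa> x) * \<psi> (\<kappa> x))"
proof -
  have grp: "(\<Sum>x\<in>X. h x * \<psi> (\<kappa> x)) = (\<Sum>c\<in>\<kappa> ` X. (\<Sum>x\<in>{x \<in> X. \<kappa> x = c}. h x) * \<psi> c)" for h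
    unfolding sum_distrib_right
    by (subst sum.group[symmetric, of X "\<kappa> ` X" \<kappa>]) (use assms in \<open>auto intro!: sum.cong\<close>)
  show ?thesis
    unfolding grp
  proof (rule sum.cong[OF refl])
    fix c
    have "(\<Sum>x\<in>{x \<in> X. \<kappa> x = c}. class_avg X \<kappa> \<phi> (\<kappa> x)) = (\<Sum>x\<in>{x \<in> X. \<kappa> x = c}. class_avg X \<kappa> \<phi> c)"
      by (intro sum.cong) auto
    then show "(\<Sum>x\<in>{x \<in> X. \<kappa> x = c}. \<phi> x) * \<psi> c = (\<Sum>x\<in>{x \<in> X. \<kappa> x = c}. class_avg X \<kappa> \<phi> (\<kappa> x)) * \<psi> c"
      by (simp add: sum_class[OF assms, where \<phi> = \<phi>])
  qed
qed

text \<open>Pythagoras for nested conditional expectations: the coarse average is a function of the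
  finer classes, hence orthogonal to the difference of the two averages.\<close>

lemma class_avg_refine:
  assumes "finite X" "\<And>x. x \<in> X \<Longrightarrow> \<kappa> x = g (\<kappa>' x)"
  shows "(\<Sum>x\<in>X. (class_avg X \<kappa>' \<phi> (\<kappa>' x) - class_avg X \<kappa> \<phi> (\<kappa> x))\<^sup>2)
       = (\<Sum>x\<in>X. (class_avg X \<kappa>' \<phi> (\<kappa>' x))\<^sup>2) - (\<Sum>x\<in>X. (class_avg X \<kappa> \<phi> (\<kappa> x))\<^sup>2)"
proof -
  let ?a = "class_avg X \<kappa>' \<phi>" and ?b = "class_avg X \<kappa> \<phi>"
  have "(\<Sum>x\<in>X. ?a (\<kappa>' x) * ?b (\<kappa> x)) = (\<Sum>x\<in>X. ?a (\<kappa>' x) * ?b (g (\<kappa>' x)))"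
    using assms by (intro sum.cong) auto
  also have "\<dots> = (\<Sum>x\<in>X. \<phi> x * ?b (g (\<kappa>' x)))"
    by (rule sum_class_avg[symmetric, where \<psi> = "\<lambda>c. ?b (g c)", OF assms(1)])
  also have "\<dots> = (\<Sum>x\<in>X. \<phi> x * ?b (\<kappa> x))" using assms by (intro sum.cong) auto
  also have "\<dots> = (\<Sum>x\<in>X. ?b (\<kappa> x) * ?b (\<kappa> x))" by (rule sum_class_avg[OF assms(1)])
  finally have "(\<Sum>x\<in>X. ?a (\<kappa>' x) * ?b (\<kappa> x)) = (\<Sum>x\<in>X. (?b (\<kappa> x))\<^sup>2)" by (simp add: power2_eq_square)
  then show ?thesis
    by (simp add: power2_diff sum.distrib sum_subtractf sum_distrib_left[symmetric] mult.assoc)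
qed

text \<open>Only the partition counts, not the names of its classes; this permits coding classes by
  numbers.\<close>

lemma class_avg_recode:
  assumes "\<And>y. y \<in> X \<Longrightarrow> \<kappa> x = \<kappa> y \<longleftrightarrow> \<kappa>' x = \<kappa>' y"
  shows "class_avg X \<kappa> \<phi> (\<kappa> x) = class_avg X \<kappa>' \<phi> (\<kappa>' x)"
proof -
  have "{y \<in> X. \<kappa> y = \<kappa> x} = {y \<in> X. \<kappa>' y = \<kappa>' x}" using assms by metis
  then show ?thesis by (simp only: class_avg_def)
qed

section \<open>Edge averages and energy of a partition\<close>

definition pair_avg :: "'v set \<Rightarrow> ('v \<Rightarrow> 'v \<Rightarrow> nat) \<Rightarrow> ('v \<Rightarrow> 'k) \<Rightarrow> nat \<Rightarrow> 'k \<Rightarrow> 'k \<Rightarrow> real" where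
  "pair_avg V B c a z z' =
     class_avg (V \<times> V) (\<lambda>(x, y). (c x, c y)) (\<lambda>(x, y). of_bool (a \<le> B x y)) (z, z')"

definition loop_avg :: "'v set \<Rightarrow> ('v \<Rightarrow> 'v \<Rightarrow> nat) \<Rightarrow> ('v \<Rightarrow> 'k) \<Rightarrow> nat \<Rightarrow> 'k \<Rightarrow> real" where
  "loop_avg V B c a z = class_avg V c (\<lambda>x. of_bool (a \<le> B x x)) z"

text \<open>The index of regularity lemmas, unnormalised: it lies between 0 and the square of
  \<open>card V\<close>.\<close>

definition pair_energy :: "'v set \<Rightarrow> ('v \<Rightarrow> 'v \<Rightarrow> nat) \<Rightarrow> ('v \<Rightarrow> 'k) \<Rightarrow> nat \<Rightarrow> real" where
  "pair_energy V B c a = (\<Sum>(x, y)\<in>V \<times> V. (pair_avg V B c a (c x) (c y))\<^sup>2)"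

text \<open>The profile of a vertex with respect to \<open>L\<close> reference vertices \<open>w\<close>; truncation at \<open>L\<close> keeps the
  number of profiles bounded independently of the graph.\<close>

definition profile :: "nat \<Rightarrow> ('v \<Rightarrow> 'v \<Rightarrow> nat) \<Rightarrow> (nat \<Rightarrow> 'v) \<Rightarrow> 'v \<Rightarrow> nat \<Rightarrow> nat" where
  "profile L B w x = restrict (\<lambda>i. min (B x (w i)) L) {..<L}"

text \<open>Regularity is phrased as a failed energy increment instead of through a cut norm. By
  Pythagoras it bounds the L2 distance between refined and coarse averages, which is what the
  replacement of an edge indicator requires.\<close>

definition regular_code :: "'v set \<Rightarrow> ('v \<Rightarrow> 'v \<Rightarrow> nat) \<Rightarrow> nat \<Rightarrow> real \<Rightarrow> ('v \<Rightarrow> 'k) \<Rightarrow> bool" where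
  "regular_code V B L e c \<longleftrightarrow> (\<forall>w. (\<forall>i<L. w i \<in> V) \<longrightarrow> (\<forall>a\<le>L.
     pair_energy V B (\<lambda>x. (c x, profile L B w x)) a - pair_energy V B c a \<le> e * (real (card V))\<^sup>2))"

lemma pair_avg_nonneg: "0 \<le> pair_avg V B c a z z'"
  unfolding pair_avg_def by (rule class_avg_nonneg) auto

lemma pair_avg_le_1: "finite V \<Longrightarrow> pair_avg V B c a z z' \<le> 1"
  unfolding pair_avg_def by (rule class_avg_le_1) auto

lemma pair_avg_0: "finite V \<Longrightarrow> pair_avg V B c 0 z z' = 1"
  unfolding pair_avg_def by (rule class_avg_one) auto

lemma pair_avg_antimono: "a \<le> b \<Longrightarrow> pair_avg V B c b z z' \<le> pair_avg V B c a z z'"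
  unfolding pair_avg_def by (rule class_avg_mono) auto

lemma loop_avg_nonneg: "0 \<le> loop_avg V B c a z"
  unfolding loop_avg_def by (rule class_avg_nonneg) auto

lemma loop_avg_le_1: "finite V \<Longrightarrow> loop_avg V B c a z \<le> 1"
  unfolding loop_avg_def by (rule class_avg_le_1) auto

lemma loop_avg_0: "finite V \<Longrightarrow> loop_avg V B c 0 z = 1"
  unfolding loop_avg_def by (rule class_avg_one) auto

lemma loop_avg_antimono: "a \<le> b \<Longrightarrow> loop_avg V B c b z \<le> loop_avg V B c a z"
  unfolding loop_avg_def by (rule class_avg_mono) auto

lemma pair_avg_sym:
  assumes "\<And>x y. x \<in> V \<Longrightarrow> y \<in> V \<Longrightarrow> B x y = B y x"
  shows "pair_avg V B c a z z' = pair_avg V B c a z' z"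
proof -
  let ?S = "\<lambda>z z'. {p \<in> V \<times> V. (case p of (x, y) \<Rightarrow> (c x, c y)) = (z, z')}"
  have b: "bij_betw prod.swap (?S z z') (?S z' z)"
    by (rule bij_betwI[where g = prod.swap]) auto
  define \<phi> :: "'a \<times> 'a \<Rightarrow> real" where "\<phi> = (\<lambda>(x, y). of_bool (a \<le> B x y))"
  have "sum \<phi> (?S z' z) = sum \<phi> (?S z z')"
    unfolding sum.reindex_bij_betw[OF b, symmetric] using assms by (intro sum.cong) (auto simp: \<phi>_def)
  moreover have "card (?S z z') = card (?S z' z)" by (rule bij_betw_same_card[OF b])
  moreover have "?S z z' = {} \<longleftrightarrow> ?S z' z = {}" by auto
  ultimately show ?thesis unfolding pair_avg_def class_avg_def \<phi>_def[symmetric] by presburger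
qed

lemma pair_energy_recode:
  assumes "\<And>x y. x \<in> V \<Longrightarrow> y \<in> V \<Longrightarrow> c x = c y \<longleftrightarrow> c' x = c' y"
  shows "pair_energy V B c a = pair_energy V B c' a"
  unfolding pair_energy_def
proof (intro sum.cong refl)
  fix p assume "p \<in> V \<times> V"
  then obtain x y where p: "p = (x, y)" "x \<in> V" "y \<in> V" by auto
  have "class_avg (V \<times> V) (\<lambda>(x, y). (c x, c y)) \<phi> ((\<lambda>(x, y). (c x, c y)) p)
      = class_avg (V \<times> V) (\<lambda>(x, y). (c' x, c' y)) \<phi> ((\<lambda>(x, y). (c' x, c' y)) p)" for \<phi>
    by (rule class_avg_recode) (use p assms in auto)
  then show "(case p of (x, y) \<Rightarrow> (pair_avg V B c a (c x) (c y))\<^sup>2)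
      = (case p of (x, y) \<Rightarrow> (pair_avg V B c' a (c' x) (c' y))\<^sup>2)"
    by (simp add: pair_avg_def p)
qed

lemma regular_code_recode:
  assumes "\<And>x y. x \<in> V \<Longrightarrow> y \<in> V \<Longrightarrow> c x = c y \<longleftrightarrow> c' x = c' y" "regular_code V B L e c"
  shows "regular_code V B L e c'"
proof -
  have "pair_energy V B (\<lambda>x. (c x, profile L B w x)) a = pair_energy V B (\<lambda>x. (c' x, profile L B w x)) a" for w a
    by (rule pair_energy_recode) (use assms(1) in auto)
  moreover have "pair_energy V B c a = pair_energy V B c' a" for a
    by (rule pair_energy_recode[OF assms(1)])
  ultimately show ?thesis using assms(2) unfolding regular_code_def by metis
qed

lemma pair_energy_refine:
  assumes "finite V"
  shows "(\<Sum>(x, y)\<in>V \<times> V. (pair_avg V B (\<lambda>x. (c x, d x)) a (c x, d x) (c y, d y) - pair_avg V B c a (c x) (c y))\<^sup>2)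
       = pair_energy V B (\<lambda>x. (c x, d x)) a - pair_energy V B c a"
proof -
  have "(\<Sum>p\<in>V \<times> V. (class_avg (V \<times> V) (\<lambda>(x, y). ((c x, d x), (c y, d y))) \<phi> ((\<lambda>(x, y). ((c x, d x), (c y, d y))) p)
        - class_avg (V \<times> V) (\<lambda>(x, y). (c x, c y)) \<phi> ((\<lambda>(x, y). (c x, c y)) p))\<^sup>2)
     = (\<Sum>p\<in>V \<times> V. (class_avg (V \<times> V) (\<lambda>(x, y). ((c x, d x), (c y, d y))) \<phi> ((\<lambda>(x, y). ((c x, d x), (c y, d y))) p))\<^sup>2)
      - (\<Sum>p\<in>V \<times> V. (class_avg (V \<times> V) (\<lambda>(x, y). (c x, c y)) \<phi> ((\<lambda>(x, y). (c x, c y)) p))\<^sup>2)" for \<phi>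
    by (rule class_avg_refine[where g = "\<lambda>(p, q). (fst p, fst q)"]) (use assms in auto)
  then show ?thesis
    by (simp add: pair_energy_def pair_avg_def case_prod_unfold)
qed

lemma pair_energy_le: 
  assumes "finite V"
  shows "pair_energy V B c a \<le> (real (card V))\<^sup>2"
proof -
  have "pair_energy V B c a \<le> (\<Sum>p\<in>V \<times> V. 1)"
    unfolding pair_energy_def
    by (intro sum_mono) (use assms in \<open>auto intro!: power_le_one pair_avg_nonneg pair_avg_le_1\<close>)
  then show ?thesis by (simp add: card_cartesian_product power2_eq_square)
qed

text \<open>Energy increment. \<open>q\<close> counts the refinements still available, and the
  premise records the energy gained by the other \<open>Q - q\<close>, summed over the thresholds
  \<open>a \<le> L\<close>. That sum is at most \<open>L + 1\<close> times the square of
  \<open>card V\<close>, so \<open>Q\<close> gains are impossible. A refinement adds one digit in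
  base \<open>D\<close>, the number of profiles; thus \<open>r\<close> has \<open>q\<close> digits
  and its range does not depend on the graph.\<close>

lemma exists_regular_refinement_aux:
  fixes B :: "'v \<Rightarrow> 'v \<Rightarrow> nat" and c :: "'v \<Rightarrow> nat"
  assumes V: "finite V" "V \<noteq> {}" and e: "0 < (e::real)" and Q: "real L + 1 < real Q * e"
    and D: "D = card ({..<L} \<rightarrow>\<^sub>E {..L})"
  shows "(real Q - real q) * e * (real (card V))\<^sup>2 \<le> (\<Sum>a\<le>L. pair_energy V B c a) \<Longrightarrow>
    \<exists>r. (\<forall>x\<in>V. r x < D ^ q) \<and> regular_code V B L e (\<lambda>x. c x * D ^ q + r x)"
proof (induction q arbitrary: c)
  case 0
  have n: "0 < (real (card V))\<^sup>2" using V by (simp add: card_gt_0_iff)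
  have "(\<Sum>a\<le>L. pair_energy V B c a) \<le> (\<Sum>a\<le>L. (real (card V))\<^sup>2)"
    by (intro sum_mono pair_energy_le V)
  then have "real Q * e * (real (card V))\<^sup>2 \<le> (real L + 1) * (real (card V))\<^sup>2" using 0 by (simp add: add.commute)
  then have False using Q n by simp
  then show ?case ..
next
  case (Suc q)
  let ?P = "{..<L} \<rightarrow>\<^sub>E {..L}"
  have P: "finite ?P" by (intro finite_PiE) auto
  have Pne: "restrict (\<lambda>_. 0) {..<L} \<in> ?P" by auto
  have D0: "0 < D" unfolding D using P Pne by (metis card_gt_0_iff empty_iff)
  show ?case
  proof (cases "regular_code V B L e c")
    case True
    \<comment> \<open>If regularity is reached early, the remaining digits are set to 0, so the
      number of digits stays fixed.\<close>
    then have "regular_code V B L e (\<lambda>x. c x * D ^ Suc q + 0)"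
      by (rule regular_code_recode[rotated]) (use D0 in auto)
    then show ?thesis using D0 by (intro exI[of _ "\<lambda>_. 0"]) auto
  next
    case False
    then obtain w b where w: "\<forall>i<L. w i \<in> V" "b \<le> L"
      "e * (real (card V))\<^sup>2 < pair_energy V B (\<lambda>x. (c x, profile L B w x)) b - pair_energy V B c b"
      unfolding regular_code_def by (auto simp: not_le)
    define d where "d = (\<lambda>x. to_nat_on ?P (profile L B w x))"
    have prof: "profile L B w x \<in> ?P" for x by (auto simp: profile_def)
    have bij: "bij_betw (to_nat_on ?P) ?P {..<D}" unfolding D by (rule to_nat_on_finite[OF P])
    have dD: "d x < D" for x using bij prof[of x] unfolding d_def bij_betw_def by blast
    have dinj: "d x = d y \<longleftrightarrow> profile L B w x = profile L B w y" for x y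
      using bij prof unfolding d_def bij_betw_def by (metis inj_onD)
    \<comment> \<open>The profile becomes the next digit of the code, so the old class is recovered
      by division by \<open>D\<close>.\<close>
    let ?c' = "\<lambda>x. c x * D + d x"
    have kern: "(c x, profile L B w x) = (c y, profile L B w y) \<longleftrightarrow> ?c' x = ?c' y" for x y
    proof -
      have "?c' x div D = c x" "?c' x mod D = d x" for x using dD[of x] D0 by auto
      then have "?c' x = ?c' y \<longleftrightarrow> c x = c y \<and> d x = d y" by metis
      then show ?thesis by (simp add: dinj)
    qed
    have en: "pair_energy V B ?c' a = pair_energy V B (\<lambda>x. (c x, profile L B w x)) a" for a
      by (rule pair_energy_recode[symmetric]) (rule kern)
    have mono: "pair_energy V B c a \<le> pair_energy V B ?c' a" for a
    proof -
      have "0 \<le> pair_energy V B (\<lambda>x. (c x, profile L B w x)) a - pair_energy V B c a"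
        unfolding pair_energy_refine[OF V(1), symmetric] by (intro sum_nonneg) auto
      then show ?thesis by (simp add: en)
    qed
    \<comment> \<open>Only the threshold \<open>b\<close> is known to gain, and it may change from
      one refinement to the next; as no threshold loses energy, the sum over all of them serves as
      potential.\<close>
    have "(\<Sum>a\<le>L. pair_energy V B c a) + e * (real (card V))\<^sup>2 \<le> (\<Sum>a\<le>L. pair_energy V B ?c' a)"
    proof -
      have "e * (real (card V))\<^sup>2 \<le> (\<Sum>a\<in>{b}. pair_energy V B ?c' a - pair_energy V B c a)" using w by (simp add: en)
      also have "\<dots> \<le> (\<Sum>a\<le>L. pair_energy V B ?c' a - pair_energy V B c a)"
        using w mono by (intro sum_mono2) auto
      finally show ?thesis by (simp add: sum_subtractf)
    qed
    moreover have "(real Q - real q) * e * (real (card V))\<^sup>2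
        = (real Q - real (Suc q)) * e * (real (card V))\<^sup>2 + e * (real (card V))\<^sup>2" by (simp add: algebra_simps)
    ultimately have "(real Q - real q) * e * (real (card V))\<^sup>2 \<le> (\<Sum>a\<le>L. pair_energy V B ?c' a)"
      using Suc.prems by linarith
    from Suc.IH[OF this] obtain r where r: "\<forall>x\<in>V. r x < D ^ q" "regular_code V B L e (\<lambda>x. ?c' x * D ^ q + r x)"
      by blast
    have "d x * D ^ q + r x < D ^ Suc q" if "x \<in> V" for x
    proof -
      have "d x * D ^ q + r x < (d x + 1) * D ^ q" using r(1) that by simp
      also have "\<dots> \<le> D * D ^ q" using dD[of x] by (intro mult_right_mono) auto
      finally show ?thesis by simp
    qed
    moreover have "(\<lambda>x. ?c' x * D ^ q + r x) = (\<lambda>x. c x * D ^ Suc q + (d x * D ^ q + r x))"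
      by (simp add: algebra_simps)
    ultimately show ?thesis using r(2) by (intro exI[of _ "\<lambda>x. d x * D ^ q + r x"]) auto
  qed
qed

text \<open>\<open>M\<close> is chosen before \<open>V\<close>, \<open>B\<close> and
  \<open>c\<close>; this uniformity gives the codes of all multigraphs one shape.\<close>

lemma exists_regular_refinement:
  assumes "0 < (e::real)"
  shows "\<exists>M\<ge>1. \<forall>(V::'v set) B (c :: 'v \<Rightarrow> nat). finite V \<longrightarrow> V \<noteq> {} \<longrightarrow>
    (\<exists>r. (\<forall>x\<in>V. r x < M) \<and> regular_code V B L e (\<lambda>x. c x * M + r x) \<and>
      (\<forall>x\<in>V. \<forall>y\<in>V. c x * M + r x = c y * M + r y \<longrightarrow> min (B x x) L = min (B y y) L))"
proof -
  obtain Q :: nat where Q: "real L + 1 < real Q * e" using reals_Archimedean3[OF assms] by blast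
  define D where "D = card ({..<L} \<rightarrow>\<^sub>E {..L})"
  define E where "E = D ^ Q"
  have "finite ({..<L} \<rightarrow>\<^sub>E {..L})" by (intro finite_PiE) auto
  moreover have "restrict (\<lambda>_. 0) {..<L} \<in> {..<L} \<rightarrow>\<^sub>E {..L}" by auto
  ultimately have "0 < D" unfolding D_def by (metis card_gt_0_iff empty_iff)
  then have E: "0 < E" by (simp add: E_def)
  show ?thesis
  \<comment> \<open>One digit with \<open>L + 1\<close> values for the truncated loop multiplicity,
    followed by the digits of the energy increment.\<close>
  proof (intro exI[of _ "(L + 1) * E"] conjI allI impI)
    show "1 \<le> (L + 1) * E" using E by simp
    fix V :: "'v set" and B and c :: "'v \<Rightarrow> nat" assume V: "finite V" "V \<noteq> {}"
    define c' where "c' = (\<lambda>x. c x * (L + 1) + min (B x x) L)"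
    have "(real Q - real Q) * e * (real (card V))\<^sup>2 \<le> (\<Sum>a\<le>L. pair_energy V B c' a)"
      by (auto intro!: sum_nonneg simp: pair_energy_def)
    from exists_regular_refinement_aux[OF V assms Q D_def this] obtain r where
      r: "\<forall>x\<in>V. r x < E" "regular_code V B L e (\<lambda>x. c' x * E + r x)" by (auto simp: E_def)
    let ?r = "\<lambda>x. min (B x x) L * E + r x"
    have code: "c' x * E + r x = c x * ((L + 1) * E) + ?r x" for x
      by (simp add: c'_def algebra_simps)
    show "\<exists>r. (\<forall>x\<in>V. r x < (L + 1) * E) \<and> regular_code V B L e (\<lambda>x. c x * ((L + 1) * E) + r x) \<and>
      (\<forall>x\<in>V. \<forall>y\<in>V. c x * ((L + 1) * E) + r x = c y * ((L + 1) * E) + r y \<longrightarrow> min (B x x) L = min (B y y) L)"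
    proof (intro exI[of _ ?r] conjI ballI impI)
      fix x assume x: "x \<in> V"
      have "?r x < (min (B x x) L + 1) * E" using r(1) x by simp
      also have "\<dots> \<le> (L + 1) * E" by (intro mult_right_mono) auto
      finally show "?r x < (L + 1) * E" .
    next
      show "regular_code V B L e (\<lambda>x. c x * ((L + 1) * E) + ?r x)" using r(2) unfolding code .
    next
      fix x y assume xy: "x \<in> V" "y \<in> V" "c x * ((L + 1) * E) + ?r x = c y * ((L + 1) * E) + ?r y"
      from xy(3) have "c' x * E + r x = c' y * E + r y" unfolding code .
      \<comment> \<open>Division by \<open>E\<close> strips the digits of the energy increment; the
        remainder modulo \<open>L + 1\<close> is then the loop digit.\<close>
      then have "(c' x * E + r x) div E = (c' y * E + r y) div E" by simp
      then have "c' x = c' y" using r(1) xy E by simp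
      moreover have "c' z mod (L + 1) = min (B z z) L" for z
        unfolding c'_def by (subst mod_mult_self3) auto
      ultimately show "min (B x x) L = min (B y y) L" by metis
    qed
  qed
qed

subsection \<open>The counting lemma\<close>

text \<open>Resampling coordinate \<open>i\<close> uniformly preserves the uniform distribution on
  tuples.\<close>

lemma sum_resample:
  assumes "i \<in> I"
  shows "real (card V) * (\<Sum>x\<in>I \<rightarrow>\<^sub>E V. \<Phi> x) = (\<Sum>x\<in>I \<rightarrow>\<^sub>E V. \<Sum>u\<in>V. \<Phi> (x(i := u)) :: real)"
proof -
  have I: "I = insert i (I - {i})" "i \<notin> I - {i}" using assms by auto
  show ?thesis by (subst (1 2) I(1)) (simp only: sum_PiE_insert[OF I(2)] fun_upd_upd sum_constant, rule arg_cong[where f = "(*) _"], rule sum.swap)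
qed

lemma sum_resample2:
  assumes "i \<in> I" "j \<in> I"
  shows "(real (card V))\<^sup>2 * (\<Sum>x\<in>I \<rightarrow>\<^sub>E V. \<Phi> x)
       = (\<Sum>x\<in>I \<rightarrow>\<^sub>E V. \<Sum>u\<in>V. \<Sum>v\<in>V. \<Phi> (x(i := u, j := v)) :: real)"
  unfolding power2_eq_square mult.assoc
  by (subst sum_resample[OF assms(2)], subst sum_resample[OF assms(1)]) simp

text \<open>The vertices at \<open>i\<close> and \<open>j\<close> are resampled, the others fixed.
  By \<open>meas\<close>, \<open>\<eta>\<close> is a function of the classes and profiles of the new
  pair, so replacing the indicator by its average over the refined classes is exact. Passing from
  there to the coarse average has relative cost at most \<open>sqrt e\<close>, by Cauchy-Schwarz and
  regularity.\<close>

lemma replace_pair: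
  fixes B :: "'v \<Rightarrow> 'v \<Rightarrow> nat"
  assumes V: "finite V" and reg: "regular_code V B L e c" and e: "0 \<le> e"
    and k: "k \<le> L" "i < k" "j < k" and a: "a \<le> L" and ij: "i \<noteq> j"
    and bound: "\<And>x. x \<in> {..<k} \<rightarrow>\<^sub>E V \<Longrightarrow> \<bar>\<eta> x\<bar> \<le> 1"
    and meas: "\<And>x u u' v v'. x \<in> {..<k} \<rightarrow>\<^sub>E V \<Longrightarrow> u \<in> V \<Longrightarrow> u' \<in> V \<Longrightarrow> v \<in> V \<Longrightarrow> v' \<in> V \<Longrightarrow>
       c u = c u' \<Longrightarrow> c v = c v' \<Longrightarrow> (\<And>m. m < k \<Longrightarrow> min (B u (x m)) L = min (B u' (x m)) L) \<Longrightarrow>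
       (\<And>m. m < k \<Longrightarrow> min (B v (x m)) L = min (B v' (x m)) L) \<Longrightarrow>
       \<eta> (x(i := u, j := v)) = \<eta> (x(i := u', j := v'))"
  shows "\<bar>\<Sum>x\<in>{..<k} \<rightarrow>\<^sub>E V. (of_bool (a \<le> B (x i) (x j)) - pair_avg V B c a (c (x i)) (c (x j))) * \<eta> x\<bar>
     \<le> real (card V) ^ k * sqrt e"
proof (cases "V = {}")
  case True
  have "{..<k} \<rightarrow>\<^sub>E V = {}" using k True by (auto simp: PiE_eq_empty_iff)
  then show ?thesis using e by simp
next
  case ne: False
  let ?n = "real (card V)"
  have n0: "0 < ?n" using V ne by (simp add: card_gt_0_iff)
  let ?\<Delta> = "\<lambda>x y. of_bool (a \<le> B x y) - pair_avg V B c a (c x) (c y)"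
  have main: "\<bar>\<Sum>u\<in>V. \<Sum>v\<in>V. ?\<Delta> u v * \<eta> (x(i := u, j := v))\<bar> \<le> ?n\<^sup>2 * sqrt e" if x: "x \<in> {..<k} \<rightarrow>\<^sub>E V" for x
  proof -
    \<comment> \<open>Regularity speaks of exactly \<open>L\<close> reference vertices; positions
      from \<open>k\<close> on are filled with an arbitrary vertex.\<close>
    define w where "w = (\<lambda>m. if m < k then x m else x i)"
    have w: "\<forall>m<L. w m \<in> V" using x k by (auto simp: w_def)
    define \<kappa> where "\<kappa> = (\<lambda>u. (c u, profile L B w u))"
    \<comment> \<open>\<open>\<eta>\<close> as a function of the two refined classes, evaluated at
      chosen representatives.\<close>
    define \<psi> where "\<psi> = (\<lambda>(p, q). \<eta> (x(i := inv_into V \<kappa> p, j := inv_into V \<kappa> q)))"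
    have \<psi>: "\<eta> (x(i := u, j := v)) = \<psi> (\<kappa> u, \<kappa> v)" if uv: "u \<in> V" "v \<in> V" for u v
    proof -
      let ?u = "inv_into V \<kappa> (\<kappa> u)" and ?v = "inv_into V \<kappa> (\<kappa> v)"
      have m: "?u \<in> V" "?v \<in> V" "\<kappa> ?u = \<kappa> u" "\<kappa> ?v = \<kappa> v" using uv by (auto simp: inv_into_into f_inv_into_f)
      have pr: "min (B s (x m)) L = min (B t (x m)) L" if "\<kappa> s = \<kappa> t" "m < k" for s t m
      proof -
        have "profile L B w s m = profile L B w t m" using that by (simp add: \<kappa>_def)
        then show ?thesis using that k by (simp add: profile_def w_def)
      qed
      show ?thesis unfolding \<psi>_def prod.case
        by (rule meas) (use x uv m pr[OF m(3)] pr[OF m(4)] in \<open>auto simp: \<kappa>_def\<close>)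
    qed
    let ?p = "\<lambda>(u, v). pair_avg V B \<kappa> a (\<kappa> u) (\<kappa> v)" and ?q = "\<lambda>(u, v). pair_avg V B c a (c u) (c v)"
    let ?K = "\<lambda>(u, v). (\<kappa> u, \<kappa> v)"
    have orth: "(\<Sum>p\<in>V \<times> V. (case p of (u, v) \<Rightarrow> of_bool (a \<le> B u v)) * \<psi> (?K p)) = (\<Sum>p\<in>V \<times> V. ?p p * \<psi> (?K p))"
      by (subst sum_class_avg) (use V in \<open>auto simp: pair_avg_def intro!: sum.cong\<close>)
    have "(\<Sum>u\<in>V. \<Sum>v\<in>V. ?\<Delta> u v * \<eta> (x(i := u, j := v))) = (\<Sum>u\<in>V. \<Sum>v\<in>V. ?\<Delta> u v * \<psi> (\<kappa> u, \<kappa> v))"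
      by (intro sum.cong refl) (simp add: \<psi>)
    also have "\<dots> = (\<Sum>p\<in>V \<times> V. (case p of (u, v) \<Rightarrow> of_bool (a \<le> B u v)) * \<psi> (?K p)) - (\<Sum>p\<in>V \<times> V. ?q p * \<psi> (?K p))"
      by (simp add: sum.cartesian_product case_prod_unfold left_diff_distrib sum_subtractf)
    also have "\<dots> = (\<Sum>p\<in>V \<times> V. (?p p - ?q p) * \<psi> (?K p))"
      unfolding orth by (simp add: case_prod_unfold left_diff_distrib sum_subtractf)
    finally have eq: "(\<Sum>u\<in>V. \<Sum>v\<in>V. ?\<Delta> u v * \<eta> (x(i := u, j := v))) = (\<Sum>p\<in>V \<times> V. (?p p - ?q p) * \<psi> (?K p))" .
    have "(\<Sum>p\<in>V \<times> V. (?p p - ?q p) * \<psi> (?K p))\<^sup>2 \<le> (\<Sum>p\<in>V \<times> V. (?p p - ?q p)\<^sup>2) * (\<Sum>p\<in>V \<times> V. (\<psi> (?K p))\<^sup>2)"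
      by (rule Cauchy_Schwarz_ineq_sum)
    also have "\<dots> \<le> (e * ?n\<^sup>2) * ?n\<^sup>2"
    proof (rule mult_mono)
      have "(\<Sum>p\<in>V \<times> V. (?p p - ?q p)\<^sup>2) = pair_energy V B \<kappa> a - pair_energy V B c a"
        unfolding \<kappa>_def pair_energy_refine[OF V, symmetric] by (simp add: case_prod_unfold)
      also have "\<dots> \<le> e * ?n\<^sup>2" using reg w a unfolding regular_code_def \<kappa>_def by blast
      finally show "(\<Sum>p\<in>V \<times> V. (?p p - ?q p)\<^sup>2) \<le> e * ?n\<^sup>2" .
      have "(\<Sum>p\<in>V \<times> V. (\<psi> (?K p))\<^sup>2) \<le> (\<Sum>p\<in>V \<times> V. 1)"
      proof (rule sum_mono)
        fix p assume "p \<in> V \<times> V"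
        then obtain u v where p: "p = (u, v)" "u \<in> V" "v \<in> V" by auto
        have "x(i := u, j := v) \<in> {..<k} \<rightarrow>\<^sub>E V" using x p k by (auto simp: PiE_iff extensional_def)
        from bound[OF this] show "(\<psi> (?K p))\<^sup>2 \<le> 1" using p by (simp add: \<psi>[symmetric] abs_square_le_1)
      qed
      then show "(\<Sum>p\<in>V \<times> V. (\<psi> (?K p))\<^sup>2) \<le> ?n\<^sup>2" by (simp add: card_cartesian_product power2_eq_square)
    qed (use e in \<open>auto intro!: sum_nonneg\<close>)
    also have "\<dots> = (?n\<^sup>2 * sqrt e)\<^sup>2" 
      by (simp only: power_mult_distrib real_sqrt_pow2[OF e] power2_eq_square[of "?n\<^sup>2"] mult_ac)
    finally show ?thesis unfolding eq abs_le_square_iff[symmetric] using e by (simp add: abs_mult)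
  qed
  have "?n\<^sup>2 * \<bar>\<Sum>x\<in>{..<k} \<rightarrow>\<^sub>E V. ?\<Delta> (x i) (x j) * \<eta> x\<bar>
      = \<bar>?n\<^sup>2 * (\<Sum>x\<in>{..<k} \<rightarrow>\<^sub>E V. ?\<Delta> (x i) (x j) * \<eta> x)\<bar>" by (simp add: abs_mult)
  also have "?n\<^sup>2 * (\<Sum>x\<in>{..<k} \<rightarrow>\<^sub>E V. ?\<Delta> (x i) (x j) * \<eta> x)
      = (\<Sum>x\<in>{..<k} \<rightarrow>\<^sub>E V. \<Sum>u\<in>V. \<Sum>v\<in>V. ?\<Delta> u v * \<eta> (x(i := u, j := v)))"
    using k ij by (subst sum_resample2[of i _ j]) auto
  also have "\<bar>\<dots>\<bar> \<le> (\<Sum>x\<in>{..<k} \<rightarrow>\<^sub>E V. ?n\<^sup>2 * sqrt e)"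
    by (intro order_trans[OF sum_abs] sum_mono main)
  also have "\<dots> = ?n\<^sup>2 * (?n ^ k * sqrt e)" by (simp add: card_PiE)
  finally show ?thesis using n0 by simp
qed

definition strict_pairs :: "nat \<Rightarrow> (nat \<times> nat) set" where
  "strict_pairs k = {(i, j). i < j \<and> j < k}"

lemma finite_strict_pairs [simp, intro]: "finite (strict_pairs k)"
  by (rule finite_subset[of _ "{..<k} \<times> {..<k}"]) (auto simp: strict_pairs_def)

lemma card_strict_pairs_le: "card (strict_pairs k) \<le> k\<^sup>2"
proof -
  have "card (strict_pairs k) \<le> card ({..<k} \<times> {..<k})"
    by (intro card_mono) (auto simp: strict_pairs_def)
  then show ?thesis by (simp add: power2_eq_square)
qed

definition code_sum :: "'v set \<Rightarrow> ('v \<Rightarrow> 'v \<Rightarrow> nat) \<Rightarrow> ('v \<Rightarrow> 'k) \<Rightarrow> nat \<Rightarrow> (nat \<Rightarrow> nat \<Rightarrow> nat) \<Rightarrow> real" where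
  "code_sum V B c k F = (\<Sum>x\<in>{..<k} \<rightarrow>\<^sub>E V.
     (\<Prod>(i, j)\<in>strict_pairs k. pair_avg V B c (F i j) (c (x i)) (c (x j))) *
     (\<Prod>i<k. loop_avg V B c (F i i) (c (x i))))"

text \<open>Hybrids between the homomorphism count (\<open>Q = {}\<close>) and
  \<open>code_sum\<close> (all pairs). Loop factors are averaged from the start: once a class
  determines its truncated loop multiplicity, the average is the indicator itself.\<close>

definition mixed_sum :: "'v set \<Rightarrow> ('v \<Rightarrow> 'v \<Rightarrow> nat) \<Rightarrow> ('v \<Rightarrow> 'k) \<Rightarrow> nat \<Rightarrow> (nat \<Rightarrow> nat \<Rightarrow> nat) \<Rightarrow> (nat \<times> nat) set \<Rightarrow> real" where
  "mixed_sum V B c k F Q = (\<Sum>x\<in>{..<k} \<rightarrow>\<^sub>E V.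
     (\<Prod>(i, j)\<in>strict_pairs k. if (i, j) \<in> Q then pair_avg V B c (F i j) (c (x i)) (c (x j))
        else of_bool (F i j \<le> B (x i) (x j))) *
     (\<Prod>i<k. loop_avg V B c (F i i) (c (x i))))"

lemma mixed_sum_all: "mixed_sum V B c k F (strict_pairs k) = code_sum V B c k F"
proof -
  have "(\<Prod>(i, j)\<in>S. if (i, j) \<in> S then p i j else q i j) = (\<Prod>(i, j)\<in>S. p i j)"
    for S :: "(nat \<times> nat) set" and p q :: "nat \<Rightarrow> nat \<Rightarrow> real"
    by (rule prod.cong) auto
  then show ?thesis unfolding mixed_sum_def code_sum_def by simp
qed

text \<open>Pairs are replaced one at a time, each at the cost given by \<open>replace_pair\<close>;
  the other factors, indicators as well as averages, form \<open>\<eta>\<close>.\<close>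

lemma replace_all_pairs:
  fixes B :: "'v \<Rightarrow> 'v \<Rightarrow> nat"
  assumes V: "finite V" and sym: "\<And>x y. x \<in> V \<Longrightarrow> y \<in> V \<Longrightarrow> B x y = B y x"
    and reg: "regular_code V B L e c" and e: "0 \<le> e"
    and k: "k \<le> L" and F: "\<And>i j. i < k \<Longrightarrow> j < k \<Longrightarrow> F i j \<le> L"
  shows "Q \<subseteq> strict_pairs k \<Longrightarrow>
    \<bar>mixed_sum V B c k F Q - mixed_sum V B c k F {}\<bar>
    \<le> card Q * (real (card V) ^ k * sqrt e)"
proof (induction Q rule: infinite_finite_induct)
  case (infinite A)
  then show ?case using finite_subset by blast
next
  case empty
  then show ?case by simp
next
  case (insert p Q)
  obtain i j where p: "p = (i, j)" by fastforce
  have ij: "i < j" "i < k" "j < k" using insert.prems by (auto simp: p strict_pairs_def)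
  define fac where "fac = (\<lambda>Q x (s, t). if (s, t) \<in> Q then pair_avg V B c (F s t) (c (x s)) (c (x t)) else of_bool (F s t \<le> B (x s) (x t)))"
  define lp where "lp = (\<lambda>x. \<Prod>i<k. loop_avg V B c (F i i) (c (x i)))"
  define M where "M = (\<lambda>Q. \<Sum>x\<in>{..<k} \<rightarrow>\<^sub>E V. (\<Prod>q\<in>strict_pairs k. fac Q x q) * lp x)"
  have M_mixed: "mixed_sum V B c k F = M"
    by (simp add: fun_eq_iff mixed_sum_def M_def fac_def lp_def)
  define \<eta> where "\<eta> = (\<lambda>x. (\<Prod>q\<in>strict_pairs k - {p}. fac Q x q) * lp x)"
  have fac01: "0 \<le> fac Q x q" "fac Q x q \<le> 1" for x Q q
    using V by (cases q, auto simp: fac_def pair_avg_nonneg pair_avg_le_1)+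
  have lp01: "0 \<le> lp x" "lp x \<le> 1" for x
    using V unfolding lp_def by (auto intro!: prod_nonneg prod_le_1 simp: loop_avg_nonneg loop_avg_le_1)
  have "\<bar>\<Sum>x\<in>{..<k} \<rightarrow>\<^sub>E V. (of_bool (F i j \<le> B (x i) (x j)) - pair_avg V B c (F i j) (c (x i)) (c (x j))) * \<eta> x\<bar>
     \<le> real (card V) ^ k * sqrt e"
  proof (rule replace_pair[OF V reg e k ij(2,3) F[OF ij(2,3)]])
    show "i \<noteq> j" using ij by simp
    fix x
    have "0 \<le> (\<Prod>q\<in>strict_pairs k - {p}. fac Q x q)" "(\<Prod>q\<in>strict_pairs k - {p}. fac Q x q) \<le> 1"
      using fac01 by (auto intro!: prod_nonneg prod_le_1)
    then show "\<bar>\<eta> x\<bar> \<le> 1"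
      unfolding \<eta>_def abs_mult using lp01[of x] by (intro mult_le_one) auto
  next
    fix x u u' v v' assume x: "x \<in> {..<k} \<rightarrow>\<^sub>E V" and uv: "u \<in> V" "u' \<in> V" "v \<in> V" "v' \<in> V"
      and cu: "c u = c u'" "c v = c v'"
      and pu: "\<And>m. m < k \<Longrightarrow> min (B u (x m)) L = min (B u' (x m)) L"
      and pv: "\<And>m. m < k \<Longrightarrow> min (B v (x m)) L = min (B v' (x m)) L"
    let ?y = "x(i := u, j := v)" and ?y' = "x(i := u', j := v')"
    have c_eq: "c (?y s) = c (?y' s)" for s using cu by auto
    have y: "?y s \<in> V" "?y' s \<in> V" if "s < k" for s using x uv that by auto
    have B1: "min (B (?y s) (?y t)) L = min (B (?y' s) (?y' t)) L" if "t \<notin> {i, j}" "t < k" for s t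
      using that pu[of t] pv[of t] by auto
    \<comment> \<open>A pair other than \<open>p\<close> has an endpoint outside
      \<open>{i, j}\<close>. That endpoint is not resampled and so serves as a reference vertex;
      symmetry of \<open>B\<close> covers the case that it comes first.\<close>
    have B_eq: "min (B (?y s) (?y t)) L = min (B (?y' s) (?y' t)) L" if st: "(s, t) \<in> strict_pairs k - {p}" for s t
    proof -
      have lt: "s < k" "t < k" using st by (auto simp: strict_pairs_def)
      consider "t \<notin> {i, j}" | "s \<notin> {i, j}" using st ij by (fastforce simp: p strict_pairs_def)
      then show ?thesis
      proof cases
        case 1 then show ?thesis using B1 lt by blast
      next
        case 2
        have "B (?y s) (?y t) = B (?y t) (?y s)" "B (?y' s) (?y' t) = B (?y' t) (?y' s)"
          using sym y lt by blast+
        then show ?thesis using B1[OF 2 lt(1), of t] by simp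
      qed
    qed
    have "fac Q ?y q = fac Q ?y' q" if q: "q \<in> strict_pairs k - {p}" for q
    proof -
      obtain s t where st: "q = (s, t)" by fastforce
      then have "F s t \<le> L" using q F by (auto simp: strict_pairs_def)
      moreover have "min (B (?y s) (?y t)) L = min (B (?y' s) (?y' t)) L" using B_eq q st by blast
      \<comment> \<open>Thresholds up to \<open>L\<close> cannot separate values that agree after
        truncation at \<open>L\<close>.\<close>
      ultimately have "F s t \<le> B (?y s) (?y t) \<longleftrightarrow> F s t \<le> B (?y' s) (?y' t)" by linarith
      then show ?thesis unfolding fac_def st prod.case c_eq by presburger
    qed
    moreover have "lp ?y = lp ?y'" unfolding lp_def c_eq ..
    ultimately show "\<eta> ?y = \<eta> ?y'" unfolding \<eta>_def by (metis (no_types, lifting) prod.cong)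
  qed
  also have "(\<Sum>x\<in>{..<k} \<rightarrow>\<^sub>E V. (of_bool (F i j \<le> B (x i) (x j)) - pair_avg V B c (F i j) (c (x i)) (c (x j))) * \<eta> x)
      = M Q - M (insert p Q)"
    unfolding M_def sum_subtractf[symmetric]
  proof (intro sum.cong refl)
    fix x
    have pS: "p \<in> strict_pairs k" using insert.prems by auto
    have "(\<Prod>q\<in>strict_pairs k. fac Q x q) = fac Q x p * (\<Prod>q\<in>strict_pairs k - {p}. fac Q x q)"
      by (rule prod.remove[OF finite_strict_pairs pS])
    moreover have "(\<Prod>q\<in>strict_pairs k. fac (insert p Q) x q) = fac (insert p Q) x p * (\<Prod>q\<in>strict_pairs k - {p}. fac (insert p Q) x q)"
      by (rule prod.remove[OF finite_strict_pairs pS])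
    moreover have "(\<Prod>q\<in>strict_pairs k - {p}. fac (insert p Q) x q) = (\<Prod>q\<in>strict_pairs k - {p}. fac Q x q)"
      by (intro prod.cong) (auto simp: fac_def)
    moreover have "fac Q x p = of_bool (F i j \<le> B (x i) (x j))"
      "fac (insert p Q) x p = pair_avg V B c (F i j) (c (x i)) (c (x j))"
      using insert.hyps by (auto simp: fac_def p)
    ultimately show "(of_bool (F i j \<le> B (x i) (x j)) - pair_avg V B c (F i j) (c (x i)) (c (x j))) * \<eta> x
        = (\<Prod>q\<in>strict_pairs k. fac Q x q) * lp x - (\<Prod>q\<in>strict_pairs k. fac (insert p Q) x q) * lp x"
      by (simp add: \<eta>_def algebra_simps)
  qed
  finally have step: "\<bar>M Q - M (insert p Q)\<bar> \<le> real (card V) ^ k * sqrt e" .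
  have "\<bar>M Q - M {}\<bar> \<le> card Q * (real (card V) ^ k * sqrt e)"
    using insert.IH insert.prems by (simp add: M_mixed)
  with step have "\<bar>M (insert p Q) - M {}\<bar> \<le> (1 + card Q) * (real (card V) ^ k * sqrt e)"
    by (simp add: distrib_right)
  then show ?case
    using insert.hyps by (simp add: M_mixed)
qed

lemma counting_lemma:
  fixes B :: "'v \<Rightarrow> 'v \<Rightarrow> nat"
  assumes V: "finite V" and sym: "\<And>x y. x \<in> V \<Longrightarrow> y \<in> V \<Longrightarrow> B x y = B y x"
    and reg: "regular_code V B L e c" and e: "0 \<le> e"
    and loops: "\<And>x y. x \<in> V \<Longrightarrow> y \<in> V \<Longrightarrow> c x = c y \<Longrightarrow> min (B x x) L = min (B y y) L"
    and k: "k \<le> L" and F: "\<And>i j. i < k \<Longrightarrow> j < k \<Longrightarrow> F i j \<le> L" "\<And>i j. i < k \<Longrightarrow> j < k \<Longrightarrow> F i j = F j i"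
  shows "\<bar>code_sum V B c k F - card {x \<in> {..<k} \<rightarrow>\<^sub>E V. \<forall>i<k. \<forall>j<k. F i j \<le> B (x i) (x j)}\<bar>
     \<le> real k ^ 2 * (real (card V) ^ k * sqrt e)"
proof -
  \<comment> \<open>Loops cause no error: all vertices of a class agree in their truncated loop
    multiplicity.\<close>
  have lp: "loop_avg V B c a (c x) = of_bool (a \<le> B x x)" if a: "a \<le> L" and x: "x \<in> V" for a x
  proof -
    have ne: "{y \<in> V. c y = c x} \<noteq> {}" using x by auto
    have "(\<Sum>y\<in>{y \<in> V. c y = c x}. of_bool (a \<le> B y y) :: real) = (\<Sum>y\<in>{y \<in> V. c y = c x}. of_bool (a \<le> B x x))"
    proof (intro sum.cong refl)
      fix y assume "y \<in> {y \<in> V. c y = c x}"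
      then have "min (B y y) L = min (B x x) L" using loops x by blast
      then have "a \<le> B y y \<longleftrightarrow> a \<le> B x x" using a by linarith
      then show "(of_bool (a \<le> B y y) :: real) = of_bool (a \<le> B x x)" by simp
    qed
    moreover have "card {y \<in> V. c y = c x} \<noteq> 0" using ne V by (simp only: card_eq_0_iff) simp
    ultimately show ?thesis unfolding loop_avg_def class_avg_def if_not_P[OF ne] by simp
  qed
  have hom: "(\<Prod>(i, j)\<in>strict_pairs k. of_bool (F i j \<le> B (x i) (x j))) * (\<Prod>i<k. loop_avg V B c (F i i) (c (x i)))
      = (of_bool (\<forall>i<k. \<forall>j<k. F i j \<le> B (x i) (x j)) :: real)" if x: "x \<in> {..<k} \<rightarrow>\<^sub>E V" for x
  proof -
    have "(\<Prod>i<k. loop_avg V B c (F i i) (c (x i))) = (\<Prod>i<k. of_bool (F i i \<le> B (x i) (x i)))"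
      using x F by (intro prod.cong refl lp) auto
    moreover have pb: "(\<Prod>q\<in>S. of_bool (P q) :: real) = of_bool (\<forall>q\<in>S. P q)" if "finite S" for S :: "'q set" and P
      using that by induction auto
    ultimately have "(\<Prod>(i, j)\<in>strict_pairs k. of_bool (F i j \<le> B (x i) (x j))) * (\<Prod>i<k. loop_avg V B c (F i i) (c (x i)))
       = (of_bool ((\<forall>(i, j)\<in>strict_pairs k. F i j \<le> B (x i) (x j)) \<and> (\<forall>i<k. F i i \<le> B (x i) (x i))) :: real)"
      unfolding case_prod_unfold by (simp add: pb of_bool_conj Ball_def)
    also have "((\<forall>(i, j)\<in>strict_pairs k. F i j \<le> B (x i) (x j)) \<and> (\<forall>i<k. F i i \<le> B (x i) (x i)))
        \<longleftrightarrow> (\<forall>i<k. \<forall>j<k. F i j \<le> B (x i) (x j))"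
    proof (intro iffI allI impI)
      fix i j assume H: "(\<forall>(i, j)\<in>strict_pairs k. F i j \<le> B (x i) (x j)) \<and> (\<forall>i<k. F i i \<le> B (x i) (x i))" and ij: "i < k" "j < k"
      have "B (x i) (x j) = B (x j) (x i)" using x ij by (intro sym) auto
      moreover have "F s t \<le> B (x s) (x t)" if "s < t" "t < k" for s t
        using H that by (auto simp: strict_pairs_def)
      moreover have "F i i \<le> B (x i) (x i)" using H ij by blast
      moreover note F(2)[OF ij] ij
      ultimately show "F i j \<le> B (x i) (x j)" by (metis linorder_neqE_nat)
    qed (auto simp: strict_pairs_def)
    finally show ?thesis .
  qed
  have fin: "finite ({..<k} \<rightarrow>\<^sub>E V)" using V by (intro finite_PiE) auto
  have "mixed_sum V B c k F {} = (\<Sum>x\<in>{..<k} \<rightarrow>\<^sub>E V. of_bool (\<forall>i<k. \<forall>j<k. F i j \<le> B (x i) (x j)))"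
    unfolding mixed_sum_def by (rule sum.cong[OF refl]) (simp only: empty_iff if_False hom)
  also have "\<dots> = real (card {x \<in> {..<k} \<rightarrow>\<^sub>E V. \<forall>i<k. \<forall>j<k. F i j \<le> B (x i) (x j)})"
  proof -
    have "{x \<in> {..<k} \<rightarrow>\<^sub>E V. \<forall>i<k. \<forall>j<k. F i j \<le> B (x i) (x j)}
        = ({..<k} \<rightarrow>\<^sub>E V) \<inter> {x. \<forall>i<k. \<forall>j<k. F i j \<le> B (x i) (x j)}" by blast
    then show ?thesis using fin by simp
  qed
  finally have cnt: "mixed_sum V B c k F {} = \<dots>" .
  have "\<bar>code_sum V B c k F - card {x \<in> {..<k} \<rightarrow>\<^sub>E V. \<forall>i<k. \<forall>j<k. F i j \<le> B (x i) (x j)}\<bar>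
      \<le> card (strict_pairs k) * (real (card V) ^ k * sqrt e)"
    unfolding mixed_sum_all[symmetric] cnt[symmetric]
    by (rule replace_all_pairs[OF V sym reg e k F(1) order_refl])
  also have "\<dots> \<le> real k ^ 2 * (real (card V) ^ k * sqrt e)"
    using card_strict_pairs_le[of k] e by (intro mult_right_mono) (auto simp flip: of_nat_power)
  finally show ?thesis .
qed

text \<open>Grouping the maps by the classes of their values turns a sum over vertices into a sum
  over class tuples, whose range is bounded independently of the graph. After normalisation this is
  \<open>tree_density\<close>.\<close>

lemma code_sum_codes:
  fixes c :: "'v \<Rightarrow> nat"
  assumes V: "finite V" and K: "\<And>x. x \<in> V \<Longrightarrow> c x < K"
  shows "code_sum V B c k F = (\<Sum>z\<in>{..<k} \<rightarrow>\<^sub>E {..<K}. (\<Prod>i<k. real (card {x \<in> V. c x = z i})) *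
     ((\<Prod>(i, j)\<in>strict_pairs k. pair_avg V B c (F i j) (z i) (z j)) * (\<Prod>i<k. loop_avg V B c (F i i) (z i))))"
proof -
  let ?X = "{..<k} \<rightarrow>\<^sub>E V" and ?Z = "{..<k} \<rightarrow>\<^sub>E {..<K}"
  define \<Psi> where "\<Psi> = (\<lambda>z. (\<Prod>(i, j)\<in>strict_pairs k. pair_avg V B c (F i j) (z i) (z j)) * (\<Prod>i<k. loop_avg V B c (F i i) (z i)))"
  let ?\<kappa> = "\<lambda>x. restrict (\<lambda>i. c (x i)) {..<k}"
  have fin: "finite ?X" "finite ?Z" using V by (auto intro: finite_PiE)
  have "code_sum V B c k F = (\<Sum>x\<in>?X. \<Psi> (?\<kappa> x))"
    unfolding code_sum_def \<Psi>_def
    by (rule sum.cong[OF refl], rule arg_cong2[where f = "(*)", OF prod.cong[OF refl] prod.cong[OF refl]])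
      (simp_all add: case_prod_unfold strict_pairs_def)
  also have "\<dots> = (\<Sum>z\<in>?Z. \<Sum>x\<in>{x \<in> ?X. ?\<kappa> x = z}. \<Psi> (?\<kappa> x))"
  proof (rule sum.group[symmetric, OF fin])
    show "?\<kappa> ` ?X \<subseteq> ?Z"
    proof (rule image_subsetI)
      fix x assume x: "x \<in> ?X"
      have "c (x i) < K" if "i < k" for i by (rule K) (use PiE_mem[OF x] that in simp)
      then show "?\<kappa> x \<in> ?Z" by simp
    qed
  qed
  also have "\<dots> = (\<Sum>z\<in>?Z. (\<Prod>i<k. real (card {x \<in> V. c x = z i})) * \<Psi> z)"
  proof (intro sum.cong refl)
    fix z assume z: "z \<in> ?Z"
    have "{x \<in> ?X. ?\<kappa> x = z} = (\<Pi>\<^sub>E i\<in>{..<k}. {x \<in> V. c x = z i})"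
    proof (rule subset_antisym; rule subsetI)
      fix x assume "x \<in> {x \<in> ?X. ?\<kappa> x = z}"
      then have x: "x \<in> ?X" "?\<kappa> x = z" by simp_all
      have "c (x i) = z i" if "i < k" for i using fun_cong[OF x(2), of i] that by simp
      with x(1) show "x \<in> (\<Pi>\<^sub>E i\<in>{..<k}. {x \<in> V. c x = z i})" by (simp add: PiE_iff)
    next
      fix x assume x: "x \<in> (\<Pi>\<^sub>E i\<in>{..<k}. {x \<in> V. c x = z i})"
      have "?\<kappa> x = z"
      proof
        fix i show "?\<kappa> x i = z i"
          using PiE_mem[OF x, of i] PiE_arb[OF z, of i] by (cases "i < k") simp_all
      qed
      with x show "x \<in> {x \<in> ?X. ?\<kappa> x = z}" by (simp add: PiE_iff)
    qed
    then have "real (card {x \<in> ?X. ?\<kappa> x = z}) = (\<Prod>i<k. real (card {x \<in> V. c x = z i}))"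
      by (simp add: card_PiE)
    moreover have "(\<Sum>x\<in>{x \<in> ?X. ?\<kappa> x = z}. \<Psi> (?\<kappa> x)) = (\<Sum>x\<in>{x \<in> ?X. ?\<kappa> x = z}. \<Psi> z)"
      by (intro sum.cong) auto
    ultimately show "(\<Sum>x\<in>{x \<in> ?X. ?\<kappa> x = z}. \<Psi> (?\<kappa> x)) = (\<Prod>i<k. real (card {x \<in> V. c x = z i})) * \<Psi> z"
      by simp
  qed
  finally show ?thesis unfolding \<Psi>_def .
qed

subsection \<open>Trees of codes\<close>

text \<open>The limit object before it is realised on the unit interval: level \<open>j\<close> splits each class \<open>z\<close> into
  the classes \<open>z * M j + r\<close> with \<open>r < M j\<close>, \<open>\<mu>\<close> are the class weights, and \<open>U\<close>, \<open>P\<close> the average tail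
  probabilities of edges and loops. All conditions are closed under pointwise limits.\<close>

locale code_tree =
  fixes M K :: "nat \<Rightarrow> nat" and \<mu> :: "nat \<Rightarrow> nat \<Rightarrow> real"
    and U :: "nat \<Rightarrow> nat \<Rightarrow> nat \<Rightarrow> nat \<Rightarrow> real" and P :: "nat \<Rightarrow> nat \<Rightarrow> nat \<Rightarrow> real"
  assumes M_pos: "1 \<le> M j"
    and K_0: "K 0 = 1" and K_Suc: "K (Suc j) = K j * M j"
    and \<mu>_nonneg: "0 \<le> \<mu> j z"
    and \<mu>_total: "(\<Sum>z<K j. \<mu> j z) = 1"
    and \<mu>_split: "\<mu> j z = (\<Sum>r<M j. \<mu> (Suc j) (z * M j + r))"
    and U_split: "\<mu> j z * \<mu> j z' * U j a z z' = (\<Sum>r<M j. \<Sum>r'<M j.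
      \<mu> (Suc j) (z * M j + r) * \<mu> (Suc j) (z' * M j + r') * U (Suc j) a (z * M j + r) (z' * M j + r'))"
    and P_split: "\<mu> j z * P j a z = (\<Sum>r<M j. \<mu> (Suc j) (z * M j + r) * P (Suc j) a (z * M j + r))"
    and U_nonneg: "0 \<le> U j a z z'" and U_le_1: "U j a z z' \<le> 1" and U_sym: "U j a z z' = U j a z' z"
    and U_0: "U j 0 z z' = 1" and U_Suc_le: "U j (Suc a) z z' \<le> U j a z z'"
    and P_nonneg: "0 \<le> P j a z" and P_le_1: "P j a z \<le> 1"
    and P_0: "P j 0 z = 1" and P_Suc_le: "P j (Suc a) z \<le> P j a z"
    and P_odd: "P j (Suc (2 * a)) z = P j (2 * a + 2) z"

text \<open>The expected product when the classes of the vertices of \<open>F\<close> are drawn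
  independently with weights \<open>\<mu> j\<close>. It is a finite expression in the arrays, hence
  continuous under entrywise limits.\<close>

definition tree_density :: "(nat \<Rightarrow> nat) \<Rightarrow> (nat \<Rightarrow> nat \<Rightarrow> real) \<Rightarrow> (nat \<Rightarrow> nat \<Rightarrow> nat \<Rightarrow> nat \<Rightarrow> real) \<Rightarrow>
    (nat \<Rightarrow> nat \<Rightarrow> nat \<Rightarrow> real) \<Rightarrow> nat \<Rightarrow> nat mat \<Rightarrow> real" where
  "tree_density K \<mu> U P j F = (\<Sum>z\<in>{..<dim_row F} \<rightarrow>\<^sub>E {..<K j}. (\<Prod>i<dim_row F. \<mu> j (z i)) *
     ((\<Prod>(i, i')\<in>strict_pairs (dim_row F). U j (F $$ (i, i')) (z i) (z i')) *
      (\<Prod>i<dim_row F. P j (F $$ (i, i)) (z i))))"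

lemma code_tree_limit:
  assumes T: "\<And>n. code_tree M K (\<mu> n) (U n) (P n)"
    and \<mu>: "\<And>j z. (\<lambda>n. \<mu> n j z) \<longlonglongrightarrow> \<mu>' j z"
    and U: "\<And>j a z z'. (\<lambda>n. U n j a z z') \<longlonglongrightarrow> U' j a z z'"
    and P: "\<And>j a z. (\<lambda>n. P n j a z) \<longlonglongrightarrow> P' j a z"
  shows "code_tree M K \<mu>' U' P'"
proof
  fix j a z z' :: nat
  show "1 \<le> M j" "K 0 = 1" "K (Suc j) = K j * M j"
    using code_tree.M_pos[OF T] code_tree.K_0[OF T] code_tree.K_Suc[OF T] by auto
  show "0 \<le> \<mu>' j z" by (rule LIMSEQ_le_const[OF \<mu>]) (use code_tree.\<mu>_nonneg[OF T] in blast)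
  show "(\<Sum>z<K j. \<mu>' j z) = 1"
    by (rule LIMSEQ_unique[OF tendsto_sum[OF \<mu>]]) (simp add: code_tree.\<mu>_total[OF T])
  have "(\<lambda>n. \<mu> n j z) \<longlonglongrightarrow> (\<Sum>r<M j. \<mu>' (Suc j) (z * M j + r))"
    unfolding code_tree.\<mu>_split[OF T, of _ j z] by (intro tendsto_intros \<mu>)
  then show "\<mu>' j z = (\<Sum>r<M j. \<mu>' (Suc j) (z * M j + r))" using LIMSEQ_unique[OF \<mu>] by blast
  have "(\<lambda>n. \<Sum>r<M j. \<Sum>r'<M j. \<mu> n (Suc j) (z * M j + r) * \<mu> n (Suc j) (z' * M j + r') * U n (Suc j) a (z * M j + r) (z' * M j + r'))
     \<longlonglongrightarrow> (\<Sum>r<M j. \<Sum>r'<M j. \<mu>' (Suc j) (z * M j + r) * \<mu>' (Suc j) (z' * M j + r') * U' (Suc j) a (z * M j + r) (z' * M j + r'))"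
    by (intro tendsto_intros \<mu> U)
  moreover have "(\<lambda>n. \<mu> n j z * \<mu> n j z' * U n j a z z') \<longlonglongrightarrow> \<mu>' j z * \<mu>' j z' * U' j a z z'"
    by (intro tendsto_intros \<mu> U)
  ultimately show "\<mu>' j z * \<mu>' j z' * U' j a z z' = (\<Sum>r<M j. \<Sum>r'<M j. \<mu>' (Suc j) (z * M j + r) * \<mu>' (Suc j) (z' * M j + r') * U' (Suc j) a (z * M j + r) (z' * M j + r'))"
    unfolding code_tree.U_split[OF T, of _ j z z' a] by (rule LIMSEQ_unique[rotated])
  have "(\<lambda>n. \<Sum>r<M j. \<mu> n (Suc j) (z * M j + r) * P n (Suc j) a (z * M j + r))
     \<longlonglongrightarrow> (\<Sum>r<M j. \<mu>' (Suc j) (z * M j + r) * P' (Suc j) a (z * M j + r))"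
    by (intro tendsto_intros \<mu> P)
  moreover have "(\<lambda>n. \<mu> n j z * P n j a z) \<longlonglongrightarrow> \<mu>' j z * P' j a z"
    by (intro tendsto_intros \<mu> P)
  ultimately show "\<mu>' j z * P' j a z = (\<Sum>r<M j. \<mu>' (Suc j) (z * M j + r) * P' (Suc j) a (z * M j + r))"
    unfolding code_tree.P_split[OF T, of _ j z a] by (rule LIMSEQ_unique[rotated])
  show "0 \<le> U' j a z z'" by (rule LIMSEQ_le_const[OF U]) (use code_tree.U_nonneg[OF T] in blast)
  show "U' j a z z' \<le> 1" by (rule LIMSEQ_le_const2[OF U]) (use code_tree.U_le_1[OF T] in blast)
  show "U' j a z z' = U' j a z' z" using U[of j a z z'] U[of j a z' z]
    unfolding code_tree.U_sym[OF T, of _ j a z z'] by (rule LIMSEQ_unique)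
  show "U' j 0 z z' = 1" using U[of j 0 z z'] code_tree.U_0[OF T] by (simp add: LIMSEQ_const_iff)
  show "U' j (Suc a) z z' \<le> U' j a z z'" by (rule LIMSEQ_le[OF U U]) (use code_tree.U_Suc_le[OF T] in blast)
  show "0 \<le> P' j a z" by (rule LIMSEQ_le_const[OF P]) (use code_tree.P_nonneg[OF T] in blast)
  show "P' j a z \<le> 1" by (rule LIMSEQ_le_const2[OF P]) (use code_tree.P_le_1[OF T] in blast)
  show "P' j 0 z = 1" using P[of j 0 z] code_tree.P_0[OF T] by (simp add: LIMSEQ_const_iff)
  show "P' j (Suc a) z \<le> P' j a z" by (rule LIMSEQ_le[OF P P]) (use code_tree.P_Suc_le[OF T] in blast)
  have "(\<lambda>n. P n j (Suc (2 * a)) z) = (\<lambda>n. P n j (2 * a + 2) z)" using code_tree.P_odd[OF T] by blast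
  then show "P' j (Suc (2 * a)) z = P' j (2 * a + 2) z" using P by (metis LIMSEQ_unique)
qed

text \<open>Sequential compactness of a countable power of the unit interval, by the diagonal
  method.\<close>

lemma bounded_family_subseq:
  fixes X :: "nat \<Rightarrow> 'i::countable \<Rightarrow> real"
  assumes "\<And>n i. X n i \<in> {0..1}"
  obtains r l where "strict_mono (r :: nat \<Rightarrow> nat)" "\<And>i. (\<lambda>n. X (r n) i) \<longlonglongrightarrow> l i"
proof -
  define Q where "Q = (\<lambda>m s. convergent (\<lambda>n. X (s n) (from_nat m)))"
  interpret subseqs Q
  proof
    fix m and s :: "nat \<Rightarrow> nat"
    have "compact {0..1::real}" by simp
    then obtain l r' where "strict_mono r'" "((\<lambda>n. X (s n) (from_nat m)) \<circ> r') \<longlonglongrightarrow> l"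
      using assms unfolding compact_def by metis
    then show "\<exists>r'. strict_mono r' \<and> Q m (s \<circ> r')"
      unfolding Q_def convergent_def o_def by blast
  qed
  have "convergent (\<lambda>n. X (diagseq n) i)" for i
  proof -
    \<comment> \<open>The diagonal sequence refines the stage belonging to \<open>i\<close> only
      after an initial segment, hence the shift.\<close>
    have "Q (to_nat i) (diagseq \<circ> (+) (Suc (to_nat i)))"
    proof (rule diagseq_holds)
      fix r s :: "nat \<Rightarrow> nat" and n assume "strict_mono r" "Q n s"
      then show "Q n (s \<circ> r)" unfolding Q_def convergent_def o_def
        using LIMSEQ_subseq_LIMSEQ[of "\<lambda>m. X (s m) (from_nat n)"] by (fastforce simp: o_def)
    qed
    then have "convergent (\<lambda>n. X (diagseq (n + Suc (to_nat i))) i)" by (simp add: Q_def o_def add.commute)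
    then show ?thesis using LIMSEQ_offset[of "\<lambda>n. X (diagseq n) i" "Suc (to_nat i)"] unfolding convergent_def by blast
  qed
  then have "\<exists>l. \<forall>i. (\<lambda>n. X (diagseq n) i) \<longlonglongrightarrow> l i" unfolding convergent_def by metis
  then show ?thesis using that subseq_diagseq by blast
qed

lemma code_tree_subseq:
  assumes T: "\<And>n. code_tree M K (\<mu> n) (U n) (P n)" and \<mu>1: "\<And>n j z. \<mu> n j z \<le> 1"
  shows "\<exists>(r :: nat \<Rightarrow> nat) \<mu>' U' P'. strict_mono r \<and> code_tree M K \<mu>' U' P' \<and>
    (\<forall>j F. (\<lambda>n. tree_density K (\<mu> (r n)) (U (r n)) (P (r n)) j F) \<longlonglongrightarrow> tree_density K \<mu>' U' P' j F)"
proof -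
  \<comment> \<open>A sum type packs the three arrays into one countable family, so that a single
    subsequence serves all of them.\<close>
  define X :: "nat \<Rightarrow> (nat \<times> nat) + (nat \<times> nat \<times> nat \<times> nat) + (nat \<times> nat \<times> nat) \<Rightarrow> real"
    where "X = (\<lambda>n. case_sum (\<lambda>(j, z). \<mu> n j z) (case_sum (\<lambda>(j, a, z, z'). U n j a z z') (\<lambda>(j, a, z). P n j a z)))"
  have X01: "X n i \<in> {0..1}" for n i
    using code_tree.\<mu>_nonneg[OF T] \<mu>1 code_tree.U_nonneg[OF T] code_tree.U_le_1[OF T]
      code_tree.P_nonneg[OF T] code_tree.P_le_1[OF T]
    by (auto simp: X_def split: sum.split)
  obtain r l where r: "strict_mono (r :: nat \<Rightarrow> nat)" "\<And>i. (\<lambda>n. X (r n) i) \<longlonglongrightarrow> l i"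
    using bounded_family_subseq[of X, OF X01] by blast
  define \<mu>' where "\<mu>' = (\<lambda>j z. l (Inl (j, z)))"
  define U' where "U' = (\<lambda>j a z z'. l (Inr (Inl (j, a, z, z'))))"
  define P' where "P' = (\<lambda>j a z. l (Inr (Inr (j, a, z))))"
  have \<mu>: "(\<lambda>n. \<mu> (r n) j z) \<longlonglongrightarrow> \<mu>' j z" for j z
    using r(2)[of "Inl (j, z)"] by (simp add: X_def \<mu>'_def)
  have U: "(\<lambda>n. U (r n) j a z z') \<longlonglongrightarrow> U' j a z z'" for j a z z'
    using r(2)[of "Inr (Inl (j, a, z, z'))"] by (simp add: X_def U'_def)
  have P: "(\<lambda>n. P (r n) j a z) \<longlonglongrightarrow> P' j a z" for j a z
    using r(2)[of "Inr (Inr (j, a, z))"] by (simp add: X_def P'_def)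
  show ?thesis
  proof (intro exI conjI allI)
    show "strict_mono r" by (rule r(1))
    show "code_tree M K \<mu>' U' P'" by (rule code_tree_limit[OF T \<mu> U P])
    show "(\<lambda>n. tree_density K (\<mu> (r n)) (U (r n)) (P (r n)) j F) \<longlonglongrightarrow> tree_density K \<mu>' U' P' j F" for j F
      unfolding tree_density_def case_prod_unfold by (intro tendsto_intros \<mu> U P)
  qed
qed

lemma sum_class_split:
  assumes V: "finite V" and M: "1 \<le> (M::nat)" and c: "\<And>x. x \<in> V \<Longrightarrow> c' x div M = c x"
  shows "(\<Sum>x\<in>{x \<in> V. c x = z}. g x) = (\<Sum>r<M. \<Sum>x\<in>{x \<in> V. c' x = z * M + r}. g x)"
proof -
  have "(\<Sum>x\<in>{x \<in> V. c x = z}. g x) = (\<Sum>r<M. \<Sum>x\<in>{x \<in> {x \<in> V. c x = z}. c' x mod M = r}. g x)"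
    by (rule sum.group[symmetric]) (use V M in auto)
  also have "\<dots> = (\<Sum>r<M. \<Sum>x\<in>{x \<in> V. c' x = z * M + r}. g x)"
  proof (intro sum.cong refl)
    fix r assume r: "r \<in> {..<M}"
    have "c x = z \<and> c' x mod M = r \<longleftrightarrow> c' x = z * M + r" if "x \<in> V" for x
    proof
      assume "c x = z \<and> c' x mod M = r"
      then show "c' x = z * M + r" using c[OF that] div_mult_mod_eq[of "c' x" M] by simp
    next
      assume "c' x = z * M + r"
      then show "c x = z \<and> c' x mod M = r" using c[OF that] r M by simp
    qed
    then show "{x \<in> {x \<in> V. c x = z}. c' x mod M = r} = {x \<in> V. c' x = z * M + r}" by auto
  qed
  finally show ?thesis .
qed

text \<open>Multiplied by the weights, the averages become normalised edge and loop counts, which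
  are additive when classes are split. In this product form empty classes need no separate
  case.\<close>

lemma code_tree_of_graph:
  fixes V :: "nat set" and B :: "nat \<Rightarrow> nat \<Rightarrow> nat"
  assumes V: "finite V" "V \<noteq> {}" and sym: "\<And>x y. x \<in> V \<Longrightarrow> y \<in> V \<Longrightarrow> B x y = B y x"
    and ev: "\<And>x. x \<in> V \<Longrightarrow> even (B x x)"
    and M: "\<And>j. 1 \<le> M j" and K: "K 0 = 1" "\<And>j. K (Suc j) = K j * M j"
    and c0: "\<And>x. x \<in> V \<Longrightarrow> c 0 x = 0" and c: "\<And>j x. x \<in> V \<Longrightarrow> c (Suc j) x div M j = c j x"
  defines "\<mu> \<equiv> \<lambda>j z. real (card {x \<in> V. c j x = z}) / card V"
  shows "code_tree M K \<mu> (\<lambda>j. pair_avg V B (c j)) (\<lambda>j. loop_avg V B (c j))" (is ?A)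
    and "\<And>j x. x \<in> V \<Longrightarrow> c j x < K j" (is "PROP ?B")
proof -
  let ?n = "real (card V)"
  have n0: "0 < ?n" using V by (simp add: card_gt_0_iff)
  show cK: "c j x < K j" if "x \<in> V" for j x
  proof (induction j)
    case (Suc j)
    have "c (Suc j) x < (c j x + 1) * M j"
      using dividend_less_div_times[of "M j" "c (Suc j) x"] c[OF that, of j] M[of j] by simp
    also have "\<dots> \<le> K j * M j" using Suc by (intro mult_right_mono) auto
    finally show ?case by (simp add: K)
  qed (use c0 that K in simp)
  have split: "(\<Sum>x\<in>{x \<in> V. c j x = z}. g x) = (\<Sum>r<M j. \<Sum>x\<in>{x \<in> V. c (Suc j) x = z * M j + r}. g x)"
    for j z and g :: "nat \<Rightarrow> real"
    by (rule sum_class_split[OF V(1) M c])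
  have U_mult: "\<mu> j z * \<mu> j z' * pair_avg V B (c j) a z z'
      = (\<Sum>x\<in>{x \<in> V. c j x = z}. \<Sum>y\<in>{x \<in> V. c j x = z'}. of_bool (a \<le> B x y)) / ?n\<^sup>2" for j z z' a
  proof -
    have eq: "{p \<in> V \<times> V. (case p of (x, y) \<Rightarrow> (c j x, c j y)) = (z, z')} = {x \<in> V. c j x = z} \<times> {x \<in> V. c j x = z'}" by auto
    have "(\<Sum>p\<in>{x \<in> V. c j x = z} \<times> {x \<in> V. c j x = z'}. (case p of (x, y) \<Rightarrow> of_bool (a \<le> B x y)) :: real)
       = card ({x \<in> V. c j x = z} \<times> {x \<in> V. c j x = z'}) * pair_avg V B (c j) a z z'"
      using sum_class[of "V \<times> V", where \<kappa> = "\<lambda>(x, y). (c j x, c j y)"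
        and \<phi> = "\<lambda>(x, y). of_bool (a \<le> B x y)" and c = "(z, z')"] V
      unfolding eq pair_avg_def by simp
    then show ?thesis
      by (simp add: \<mu>_def sum.cartesian_product card_cartesian_product power2_eq_square)
  qed
  have P_mult: "\<mu> j z * loop_avg V B (c j) a z = (\<Sum>x\<in>{x \<in> V. c j x = z}. of_bool (a \<le> B x x)) / ?n" for j z a
    unfolding \<mu>_def loop_avg_def sum_class[OF V(1)] by simp
  show ?A
  proof
    fix j a z z' :: nat
    show "1 \<le> M j" by (rule M)
    show "K 0 = 1" by (rule K)
    show "K (Suc j) = K j * M j" by (rule K)
    show "0 \<le> \<mu> j z" by (simp add: \<mu>_def)
    show "(\<Sum>z<K j. \<mu> j z) = 1"
    proof -
      have "(\<Sum>z<K j. \<Sum>x\<in>{x \<in> V. c j x = z}. 1) = (\<Sum>x\<in>V. 1::real)"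
        by (rule sum.group) (use V cK in auto)
      then show ?thesis using n0 by (simp add: \<mu>_def sum_divide_distrib[symmetric])
    qed
    show "\<mu> j z = (\<Sum>r<M j. \<mu> (Suc j) (z * M j + r))"
      using split[where j = j and z = z and g = "\<lambda>_. 1"] by (simp add: \<mu>_def sum_divide_distrib[symmetric])
    show "\<mu> j z * \<mu> j z' * pair_avg V B (c j) a z z' = (\<Sum>r<M j. \<Sum>r'<M j. \<mu> (Suc j) (z * M j + r) *
        \<mu> (Suc j) (z' * M j + r') * pair_avg V B (c (Suc j)) a (z * M j + r) (z' * M j + r'))"
      unfolding U_mult sum_divide_distrib[symmetric]
      by (subst split, subst split) (rule arg_cong2[where f = "(/)", OF sum.cong[OF refl sum.swap] refl])
    show "\<mu> j z * loop_avg V B (c j) a z = (\<Sum>r<M j. \<mu> (Suc j) (z * M j + r) * loop_avg V B (c (Suc j)) a (z * M j + r))"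
      unfolding P_mult sum_divide_distrib[symmetric] by (subst split) simp
    show "0 \<le> pair_avg V B (c j) a z z'" by (rule pair_avg_nonneg)
    show "pair_avg V B (c j) a z z' \<le> 1" by (rule pair_avg_le_1[OF V(1)])
    show "pair_avg V B (c j) a z z' = pair_avg V B (c j) a z' z" by (rule pair_avg_sym[OF sym])
    show "pair_avg V B (c j) 0 z z' = 1" by (rule pair_avg_0[OF V(1)])
    show "pair_avg V B (c j) (Suc a) z z' \<le> pair_avg V B (c j) a z z'" by (rule pair_avg_antimono) simp
    show "0 \<le> loop_avg V B (c j) a z" by (rule loop_avg_nonneg)
    show "loop_avg V B (c j) a z \<le> 1" by (rule loop_avg_le_1[OF V(1)])
    show "loop_avg V B (c j) 0 z = 1" by (rule loop_avg_0[OF V(1)])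
    show "loop_avg V B (c j) (Suc a) z \<le> loop_avg V B (c j) a z" by (rule loop_avg_antimono) simp
    \<comment> \<open>Diagonal entries are even, so an odd threshold can be raised to the next even
      number.\<close>
    have "Suc (2 * a) \<le> B x x \<longleftrightarrow> 2 * a + 2 \<le> B x x" if "x \<in> V" for x
      using ev[OF that] by presburger
    then have "of_bool (Suc (2 * a) \<le> B x x) = (of_bool (2 * a + 2 \<le> B x x) :: real)" if "x \<in> V" for x
      using that by simp
    then show "loop_avg V B (c j) (Suc (2 * a)) z = loop_avg V B (c j) (2 * a + 2) z"
      unfolding loop_avg_def by (intro antisym class_avg_mono) simp_all
  qed
qed

text \<open>All levels come from one recursive refinement, which makes the classes nested. Step
  \<open>j\<close> regularises with parameters \<open>j\<close> and \<open>e j\<close> and produces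
  level \<open>Suc j\<close>; hence the shift in the estimate.\<close>

lemma exists_code_tree_of_graph:
  fixes V :: "nat set" and B :: "nat \<Rightarrow> nat \<Rightarrow> nat"
  assumes refine: "\<And>j (V::nat set) B (c :: nat \<Rightarrow> nat). finite V \<Longrightarrow> V \<noteq> {} \<Longrightarrow>
    \<exists>r. (\<forall>x\<in>V. r x < M j) \<and> regular_code V B j (e j) (\<lambda>x. c x * M j + r x) \<and>
      (\<forall>x\<in>V. \<forall>y\<in>V. c x * M j + r x = c y * M j + r y \<longrightarrow> min (B x x) j = min (B y y) j)"
    and M: "\<And>j. 1 \<le> M j" and e: "\<And>j. 0 < (e j :: real)"
    and K: "K 0 = 1" "\<And>j. K (Suc j) = K j * M j"
    and G: "G \<in> multigraphs"
  shows "\<exists>\<mu> U P. code_tree M K \<mu> U P \<and> (\<forall>j z. \<mu> j z \<le> 1) \<and>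
    (\<forall>j F. F \<in> multigraphs \<longrightarrow> dim_row F \<le> j \<longrightarrow> (\<forall>i<dim_row F. \<forall>i'<dim_row F. F $$ (i, i') \<le> j) \<longrightarrow>
      \<bar>tree_density K \<mu> U P (Suc j) F - hom_density F G\<bar> \<le> real j ^ 2 * sqrt (e j))"
proof -
  define n where "n = dim_row G"
  define V where "V = {..<n}"
  define B where "B = (\<lambda>x y. G $$ (x, y))"
  have n: "1 \<le> n" and Ga: "G \<in> adjacency_mats n" using G by (auto simp: multigraphs_iff n_def)
  have V: "finite V" "V \<noteq> {}" using n by (auto simp: V_def lessThan_empty_iff)
  have cardV: "card V = n" by (simp add: V_def)
  have sym: "B x y = B y x" if "x \<in> V" "y \<in> V" for x y
    using adjacency_mats_sym[OF Ga] that by (simp add: B_def V_def)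
  have ev: "even (B x x)" if "x \<in> V" for x
    using adjacency_mats_even[OF Ga] that by (simp add: B_def V_def)
  define R where "R = (\<lambda>j c r. (\<forall>x\<in>V. r x < M j) \<and> regular_code V B j (e j) (\<lambda>x. c x * M j + r x) \<and>
      (\<forall>x\<in>V. \<forall>y\<in>V. c x * M j + r x = c y * M j + r y \<longrightarrow> min (B x x) j = min (B y y) j))"
  have "\<exists>r. R j c r" for j c unfolding R_def by (rule refine[OF V])
  then obtain \<rho> where \<rho>: "\<And>j c. R j c (\<rho> j c)" by metis
  define c where "c = rec_nat (\<lambda>_. 0) (\<lambda>j c x. c x * M j + \<rho> j c x)"
  have c_Suc: "c (Suc j) = (\<lambda>x. c j x * M j + \<rho> j (c j) x)" for j by (simp add: c_def)
  have c0: "c 0 x = 0" for x by (simp add: c_def)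
  have cdiv: "c (Suc j) x div M j = c j x" if "x \<in> V" for j x
    using \<rho>[of j "c j"] that M[of j] by (simp add: R_def c_Suc)
  have reg: "regular_code V B j (e j) (c (Suc j))"
    and lp: "\<And>x y. x \<in> V \<Longrightarrow> y \<in> V \<Longrightarrow> c (Suc j) x = c (Suc j) y \<Longrightarrow> min (B x x) j = min (B y y) j" for j
    using \<rho>[of j "c j"] unfolding R_def c_Suc by blast+
  define \<mu> where "\<mu> = (\<lambda>j z. real (card {x \<in> V. c j x = z}) / card V)"
  note tree = code_tree_of_graph[of V B M K c, OF V sym ev M K c0 cdiv, folded \<mu>_def]
  have "\<mu> j z \<le> 1" for j z
    using card_mono[OF V(1), of "{x \<in> V. c j x = z}"] V by (auto simp: \<mu>_def divide_le_eq)
  moreover have "\<bar>tree_density K \<mu> (\<lambda>j. pair_avg V B (c j)) (\<lambda>j. loop_avg V B (c j)) (Suc j) F - hom_density F G\<bar> \<le> real j ^ 2 * sqrt (e j)"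
    if F: "F \<in> multigraphs" "dim_row F \<le> j" "\<And>i i'. i < dim_row F \<Longrightarrow> i' < dim_row F \<Longrightarrow> F $$ (i, i') \<le> j" for j F
  proof -
    define k where "k = dim_row F"
    let ?F = "\<lambda>i i'. F $$ (i, i')"
    have Fa: "F \<in> adjacency_mats k" using F by (simp add: multigraphs_iff k_def)
    let ?H = "{x \<in> {..<k} \<rightarrow>\<^sub>E V. \<forall>i<k. \<forall>i'<k. ?F i i' \<le> B (x i) (x i')}"
    have H: "hom_density F G = card ?H / real n ^ k"
      by (simp add: hom_density_def k_def n_def V_def B_def)
    have tree: "tree_density K \<mu> (\<lambda>j. pair_avg V B (c j)) (\<lambda>j. loop_avg V B (c j)) (Suc j) F
        = code_sum V B (c (Suc j)) k ?F / real n ^ k"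
    proof -
      have "(\<Prod>i<k. \<mu> (Suc j) (z i)) = (\<Prod>i<k. real (card {x \<in> V. c (Suc j) x = z i})) / real n ^ k" for z
        by (simp add: \<mu>_def prod_dividef cardV)
      note prod_eq = this
      have cs: "code_sum V B (c (Suc j)) k ?F = (\<Sum>z\<in>{..<k} \<rightarrow>\<^sub>E {..<K (Suc j)}.
          (\<Prod>i<k. real (card {x \<in> V. c (Suc j) x = z i})) *
          ((\<Prod>(i, i')\<in>strict_pairs k. pair_avg V B (c (Suc j)) (?F i i') (z i) (z i')) *
           (\<Prod>i<k. loop_avg V B (c (Suc j)) (?F i i) (z i))))"
        by (rule code_sum_codes[OF V(1)]) (rule tree(2))
      show ?thesis
        unfolding tree_density_def k_def[symmetric] cs sum_divide_distrib
        by (rule sum.cong[OF refl]) (simp only: prod_eq times_divide_eq_left)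
    qed
    have "\<bar>code_sum V B (c (Suc j)) k ?F - card ?H\<bar> \<le> real k ^ 2 * (real (card V) ^ k * sqrt (e j))"
      by (rule counting_lemma[OF V(1) sym reg less_imp_le[OF e] lp])
        (use F adjacency_mats_sym[OF Fa] in \<open>auto simp: k_def\<close>)
    then have "\<bar>code_sum V B (c (Suc j)) k ?F - card ?H\<bar> / real n ^ k \<le> real k ^ 2 * sqrt (e j)"
      using n by (simp add: cardV divide_le_eq mult_ac)
    also have "\<dots> \<le> real j ^ 2 * sqrt (e j)"
      using F(2) e[of j] by (intro mult_right_mono power_mono) (auto simp: k_def less_imp_le)
    finally show ?thesis unfolding tree H by (simp add: diff_divide_distrib[symmetric] abs_divide)
  qed
  ultimately show ?thesis using tree(1) by blast
qed

lemma density_limit_imp_code_tree: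
  assumes "is_density_limit f"
  obtains M K \<mu> U P where "code_tree M K \<mu> U P"
    "\<And>F. F \<in> multigraphs \<Longrightarrow> (\<lambda>j. tree_density K \<mu> U P j F) \<longlonglongrightarrow> f F"
proof -
  obtain G where G: "\<And>n::nat. G n \<in> multigraphs" "\<And>F. F \<in> multigraphs \<Longrightarrow> (\<lambda>n. hom_density F (G n)) \<longlonglongrightarrow> f F"
    using assms unfolding is_density_limit_def by blast
  \<comment> \<open>\<open>sqrt (e j)\<close> is the cube of \<open>1 / (j + 1)\<close>; against the
    factor \<open>j^2\<close> of the counting error this leaves at most
    \<open>1 / (j + 1)\<close>.\<close>
  define e where "e = (\<lambda>j. (1 / real (Suc j) ^ 3)\<^sup>2)"
  have e: "0 < e j" "sqrt (e j) = 1 / real (Suc j) ^ 3" for j by (simp_all add: e_def)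
  define R where "R = (\<lambda>j M. \<forall>(V::nat set) B (c :: nat \<Rightarrow> nat). finite V \<longrightarrow> V \<noteq> {} \<longrightarrow>
    (\<exists>r. (\<forall>x\<in>V. r x < M) \<and> regular_code V B j (e j) (\<lambda>x. c x * M + r x) \<and>
      (\<forall>x\<in>V. \<forall>y\<in>V. c x * M + r x = c y * M + r y \<longrightarrow> min (B x x) j = min (B y y) j)))"
  have "\<exists>M\<ge>1. R j M" for j unfolding R_def by (rule exists_regular_refinement[OF e(1)])
  \<comment> \<open>\<open>M\<close>, and with it \<open>K\<close>, does not depend on the
    multigraph, so the trees of all \<open>G n\<close> are arrays over the same index sets.\<close>
  then obtain M where M: "\<And>j. 1 \<le> M j" and R: "\<And>j. R j (M j)" by metis
  define K where "K = rec_nat 1 (\<lambda>j k. k * M j)"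
  have K: "K 0 = 1" "K (Suc j) = K j * M j" for j by (simp_all add: K_def)
  define Q where "Q = (\<lambda>n \<mu> U P. code_tree M K \<mu> U P \<and> (\<forall>j z. \<mu> j z \<le> 1) \<and>
    (\<forall>j F. F \<in> multigraphs \<longrightarrow> dim_row F \<le> j \<longrightarrow> (\<forall>i<dim_row F. \<forall>i'<dim_row F. F $$ (i, i') \<le> j) \<longrightarrow>
      \<bar>tree_density K \<mu> U P (Suc j) F - hom_density F (G n)\<bar> \<le> real j ^ 2 * sqrt (e j)))"
  have "\<exists>\<mu> U P. Q n \<mu> U P" for n
    unfolding Q_def
    by (rule exists_code_tree_of_graph[OF _ M e(1) K G(1)], use R in \<open>unfold R_def, blast\<close>)
  then obtain \<mu> U P where Q: "\<And>n. Q n (\<mu> n) (U n) (P n)" by metis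
  have T: "code_tree M K (\<mu> n) (U n) (P n)" "\<mu> n j z \<le> 1"
    "F \<in> multigraphs \<Longrightarrow> dim_row F \<le> j \<Longrightarrow> (\<forall>i<dim_row F. \<forall>i'<dim_row F. F $$ (i, i') \<le> j) \<Longrightarrow>
      \<bar>tree_density K (\<mu> n) (U n) (P n) (Suc j) F - hom_density F (G n)\<bar> \<le> real j ^ 2 * sqrt (e j)" for n j z F
    using Q[of n] unfolding Q_def by blast+
  obtain r \<mu>' U' P' where r_all: "strict_mono (r :: nat \<Rightarrow> nat) \<and> code_tree M K \<mu>' U' P' \<and>
    (\<forall>j F. (\<lambda>n. tree_density K (\<mu> (r n)) (U (r n)) (P (r n)) j F) \<longlonglongrightarrow> tree_density K \<mu>' U' P' j F)"
    using code_tree_subseq[of M K \<mu> U P, OF T(1) T(2)] by (elim exE)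
  note r = r_all[THEN conjunct1] r_all[THEN conjunct2, THEN conjunct1]
    r_all[THEN conjunct2, THEN conjunct2, rule_format]
  have "(\<lambda>j. tree_density K \<mu>' U' P' j F) \<longlonglongrightarrow> f F" if F: "F \<in> multigraphs" for F
  proof -
    \<comment> \<open>From level \<open>J\<close> on, neither the number of vertices of
      \<open>F\<close> nor any of its entries exceeds the truncation.\<close>
    define J where "J = dim_row F + (\<Sum>i<dim_row F. \<Sum>i'<dim_row F. F $$ (i, i'))"
    have J: "F $$ (i, i') \<le> J" if ii: "i < dim_row F" "i' < dim_row F" for i i'
    proof -
      have "F $$ (i, i') \<le> (\<Sum>i'<dim_row F. F $$ (i, i'))" using ii by (intro member_le_sum) auto
      also have "\<dots> \<le> (\<Sum>i<dim_row F. \<Sum>i'<dim_row F. F $$ (i, i'))"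
        using ii by (intro member_le_sum[where f = "\<lambda>i. \<Sum>i'<dim_row F. F $$ (i, i')"]) auto
      finally show ?thesis by (simp add: J_def)
    qed
    \<comment> \<open>The multigraphs pass to the limit at a fixed level first; the error bound at
      that level is the same for all of them.\<close>
    have bound: "\<bar>tree_density K \<mu>' U' P' (Suc j) F - f F\<bar> \<le> 1 / real (Suc j)" if j: "J \<le> j" for j
    proof -
      have lim: "(\<lambda>n. \<bar>tree_density K (\<mu> (r n)) (U (r n)) (P (r n)) (Suc j) F - hom_density F (G (r n))\<bar>)
          \<longlonglongrightarrow> \<bar>tree_density K \<mu>' U' P' (Suc j) F - f F\<bar>"
        using LIMSEQ_subseq_LIMSEQ[OF G(2)[OF F] r(1)] by (intro tendsto_intros r(3)) (simp add: o_def)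
      have "\<bar>tree_density K (\<mu> (r n)) (U (r n)) (P (r n)) (Suc j) F - hom_density F (G (r n))\<bar> \<le> real j ^ 2 * sqrt (e j)" for n
        using j J by (intro T(3) F) (auto simp: J_def intro: order_trans)
      then have "\<bar>tree_density K \<mu>' U' P' (Suc j) F - f F\<bar> \<le> real j ^ 2 * sqrt (e j)"
        by (intro LIMSEQ_le_const2[OF lim]) blast
      also have "\<dots> \<le> real (Suc j) ^ 2 * (1 / real (Suc j) ^ 3)"
        unfolding e(2) by (intro mult_right_mono power_mono) auto
      also have "\<dots> = 1 / real (Suc j)" by (simp add: power2_eq_square power3_eq_cube)
      finally show ?thesis .
    qed
    have "(\<lambda>j. tree_density K \<mu>' U' P' (Suc j) F - f F) \<longlonglongrightarrow> 0"
    proof (rule Lim_null_comparison)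
      show "eventually (\<lambda>j. norm (tree_density K \<mu>' U' P' (Suc j) F - f F) \<le> 1 / real (Suc j)) sequentially"
        using eventually_ge_at_top[of J] by eventually_elim (use bound in simp)
      show "(\<lambda>j. 1 / real (Suc j)) \<longlonglongrightarrow> 0" using LIMSEQ_inverse_real_of_nat by (simp add: inverse_eq_divide)
    qed
    then show ?thesis by (simp add: LIM_zero_iff filterlim_sequentially_Suc[of "\<lambda>j. tree_density K \<mu>' U' P' j F"])
  qed
  with r(2) show ?thesis by (rule that)
qed

subsection \<open>Convergence of square-integrable martingales along a subsequence\<close>

text \<open>One subsequence has to serve every \<open>a\<close>, so step \<open>m\<close> controls
  only the indices \<open>a \<le> m\<close>, which still bounds all late increments for each
  \<open>a\<close>. The rate \<open>(1/4) ^ m\<close> is the square of the summable rate needed for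
  L1 increments.\<close>

lemma fast_subsequence:
  fixes E :: "nat \<Rightarrow> nat \<Rightarrow> real"
  assumes "\<And>a. convergent (E a)"
  obtains r where "strict_mono (r :: nat \<Rightarrow> nat)" "\<And>a m. a \<le> m \<Longrightarrow> \<bar>E a (r (Suc m)) - E a (r m)\<bar> \<le> (1/4) ^ m"
proof -
  have "\<exists>N. \<forall>a\<le>m. \<forall>i\<ge>N. \<forall>j\<ge>N. \<bar>E a i - E a j\<bar> \<le> (1/4) ^ m" for m :: nat
  proof -
    have "\<exists>N. \<forall>i\<ge>N. \<forall>j\<ge>N. \<bar>E a i - E a j\<bar> \<le> (1/4) ^ m" for a
    proof -
      have "Cauchy (E a)" using assms by (rule convergent_Cauchy)
      from metric_CauchyD[OF this, of "(1/4) ^ m"] obtain N where "\<forall>i\<ge>N. \<forall>j\<ge>N. dist (E a i) (E a j) < (1/4) ^ m" by auto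
      then show ?thesis unfolding dist_real_def by (meson less_imp_le)
    qed
    then obtain N where N: "\<And>a i j. N a \<le> i \<Longrightarrow> N a \<le> j \<Longrightarrow> \<bar>E a i - E a j\<bar> \<le> (1/4) ^ m" by metis
    have "N a \<le> Max (N ` {..m})" if "a \<le> m" for a using that by (intro Max_ge) auto
    then show ?thesis using N by (meson order_trans)
  qed
  then obtain N where N: "\<And>m a i j. a \<le> m \<Longrightarrow> N m \<le> i \<Longrightarrow> N m \<le> j \<Longrightarrow> \<bar>E a i - E a j\<bar> \<le> (1/4) ^ m" by metis
  define r where "r = rec_nat (N 0) (\<lambda>m k. max (Suc k) (N (Suc m)))"
  have Suc: "r (Suc m) = max (Suc (r m)) (N (Suc m))" for m by (simp add: r_def)
  have r: "strict_mono r" by (rule strict_monoI_Suc) (simp add: Suc)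
  have "N m \<le> r m" for m by (cases m) (simp_all add: r_def)
  moreover have "r m \<le> r (Suc m)" for m by (simp add: Suc)
  ultimately have "\<bar>E a (r (Suc m)) - E a (r m)\<bar> \<le> (1/4) ^ m" if "a \<le> m" for a m
    using that by (intro N) (auto intro: order_trans)
  with r show ?thesis by (rule that)
qed

text \<open>The L1 norms of the increments are summable, so the series of absolute increments has
  finite expectation and converges almost everywhere.\<close>

lemma (in prob_space) AE_convergent_of_L2_increments:
  fixes v :: "nat \<Rightarrow> 'a \<Rightarrow> real"
  assumes v [measurable]: "\<And>m. v m \<in> borel_measurable M" and b: "\<And>m x. \<bar>v m x\<bar> \<le> 1"
    and inc: "\<And>m. m0 \<le> m \<Longrightarrow> (\<integral>x. (v (Suc m) x - v m x)\<^sup>2 \<partial>M) \<le> (1/4) ^ m"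
  shows "AE x in M. convergent (\<lambda>m. v m x)"
proof -
  let ?d = "\<lambda>m x. \<bar>v (Suc (m + m0)) x - v (m + m0) x\<bar>"
  have d2: "?d m x \<le> 2" for m x using b[of "Suc (m + m0)" x] b[of "m + m0" x] by linarith
  have d2': "(?d m x)\<^sup>2 \<le> 4" for m x using power_mono[OF d2[of m x] abs_ge_zero, of 2] by simp
  have int: "integrable M (?d m)" "integrable M (\<lambda>x. (?d m x)\<^sup>2)" for m
    by (rule integrable_const_bound[of _ 2], use d2 in auto)
       (rule integrable_const_bound[of _ 4], use d2' in auto)
  have d1: "(\<integral>x. ?d m x \<partial>M) \<le> (1/2) ^ m" for m
  proof -
    \<comment> \<open>The arithmetic-geometric mean inequality bounds the L1 norm by the L2 norm;
      \<open>c\<close> is the square root of the bound on the second moment, which balances its two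
      terms.\<close>
    define c :: real where "c = (1/2) ^ (m + m0)"
    have c: "0 < c" "c\<^sup>2 = (1/4) ^ (m + m0)" by (simp_all add: c_def power2_eq_square flip: power_mult_distrib)
    have "?d m x \<le> ((?d m x)\<^sup>2 / c + c) / 2" for x
    proof -
      have "0 \<le> (?d m x - c)\<^sup>2 / c" using c by simp
      also have "\<dots> = (?d m x)\<^sup>2 / c + c - 2 * ?d m x" using c by (simp add: power2_eq_square field_simps)
      finally show ?thesis by simp
    qed
    then have "(\<integral>x. ?d m x \<partial>M) \<le> (\<integral>x. ((?d m x)\<^sup>2 / c + c) / 2 \<partial>M)"
      using int by (intro integral_mono) auto
    also have "\<dots> = ((\<integral>x. (?d m x)\<^sup>2 \<partial>M) / c + c) / 2" using int by (simp add: prob_space)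
    also have "\<dots> \<le> (c\<^sup>2 / c + c) / 2"
      using inc[of "m + m0"] c by (intro divide_right_mono add_mono) auto
    also have "\<dots> = c" using c(1) by (simp add: power2_eq_square)
    also have "\<dots> \<le> (1/2) ^ m" unfolding c_def by (intro power_decreasing) auto
    finally show ?thesis .
  qed
  have "(\<integral>\<^sup>+x. (\<Sum>m. ennreal (?d m x)) \<partial>M) = (\<Sum>m. \<integral>\<^sup>+x. ennreal (?d m x) \<partial>M)"
    by (intro nn_integral_suminf) measurable
  also have "\<dots> \<le> (\<Sum>m. ennreal ((1/2) ^ m))"
    using d1 int by (intro suminf_le) (auto simp: nn_integral_eq_integral intro!: ennreal_leI)
  also have "\<dots> < \<infinity>"
  proof -
    have "(\<Sum>m. ennreal ((1/2) ^ m)) = ennreal (\<Sum>m. (1/2) ^ m)"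
      by (rule suminf_ennreal2) (auto intro: summable_geometric)
    then show ?thesis by simp
  qed
  finally have "AE x in M. (\<Sum>m. ennreal (?d m x)) \<noteq> \<infinity>"
    by (intro nn_integral_PInf_AE) (auto simp: infinity_ennreal_def)
  then show ?thesis
  proof eventually_elim
    case (elim x)
    then have "summable (\<lambda>m. ?d m x)" by (intro summable_suminf_not_top) auto
    then have "summable (\<lambda>m. v (Suc (m + m0)) x - v (m + m0) x)" by (rule summable_rabs_cancel)
    then have "convergent (\<lambda>n. \<Sum>m<n. v (Suc (m + m0)) x - v (m + m0) x)" by (simp add: summable_iff_convergent)
    also have "(\<lambda>n. \<Sum>m<n. v (Suc (m + m0)) x - v (m + m0) x) = (\<lambda>n. v (n + m0) x - v m0 x)"
      using sum_lessThan_telescope[of "\<lambda>m. v (m + m0) x"] by simp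
    finally have "convergent (\<lambda>n. (v (n + m0) x - v m0 x) + v m0 x)" by (intro convergent_add convergent_const)
    then have "convergent (\<lambda>n. v (n + m0) x)" by simp
    then show ?case by (subst (asm) convergent_ignore_initial_segment)
  qed
qed

text \<open>Pythagoras again: \<open>orth\<close> says that later functions differ from
  \<open>u i\<close> by something orthogonal to it.\<close>

lemma (in prob_space) L2_increment:
  fixes u :: "nat \<Rightarrow> 'a \<Rightarrow> real"
  assumes u [measurable]: "\<And>j. u j \<in> borel_measurable M" and b: "\<And>j x. \<bar>u j x\<bar> \<le> 1"
    and orth: "\<And>i j. i \<le> j \<Longrightarrow> (\<integral>x. u j x * u i x \<partial>M) = (\<integral>x. u i x * u i x \<partial>M)" and ij: "i \<le> j"
  shows "(\<integral>x. (u j x - u i x)\<^sup>2 \<partial>M) = (\<integral>x. u j x * u j x \<partial>M) - (\<integral>x. u i x * u i x \<partial>M)"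
proof -
  have int: "integrable M (\<lambda>x. u i x * u j x)" for i j
    using b by (intro integrable_const_bound[of _ 1]) (auto simp: abs_mult intro!: mult_le_one)
  have "(\<integral>x. (u j x - u i x)\<^sup>2 \<partial>M) = (\<integral>x. u j x * u j x - 2 * (u j x * u i x) + u i x * u i x \<partial>M)"
    by (simp add: power2_eq_square algebra_simps)
  also have "\<dots> = (\<integral>x. u j x * u j x \<partial>M) - 2 * (\<integral>x. u j x * u i x \<partial>M) + (\<integral>x. u i x * u i x \<partial>M)"
    using int by simp
  finally show ?thesis by (simp add: orth[OF ij])
qed

lemma (in prob_space) convergent_energy:
  fixes u :: "nat \<Rightarrow> 'a \<Rightarrow> real"
  assumes u [measurable]: "\<And>j. u j \<in> borel_measurable M" and b: "\<And>j x. \<bar>u j x\<bar> \<le> 1"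
    and orth: "\<And>i j. i \<le> j \<Longrightarrow> (\<integral>x. u j x * u i x \<partial>M) = (\<integral>x. u i x * u i x \<partial>M)"
  shows "incseq (\<lambda>j. \<integral>x. u j x * u j x \<partial>M)" "convergent (\<lambda>j. \<integral>x. u j x * u j x \<partial>M)"
proof -
  show inc: "incseq (\<lambda>j. \<integral>x. u j x * u j x \<partial>M)"
  proof (rule incseq_SucI)
    fix j
    have "0 \<le> (\<integral>x. (u (Suc j) x - u j x)\<^sup>2 \<partial>M)" by (intro integral_nonneg_AE) auto
    then show "(\<integral>x. u j x * u j x \<partial>M) \<le> (\<integral>x. u (Suc j) x * u (Suc j) x \<partial>M)"
      using L2_increment[of u j "Suc j", OF u b orth] by simp
  qed
  have "(\<integral>x. u j x * u j x \<partial>M) \<le> 1" for j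
  proof -
    have sq: "u j x * u j x \<le> 1" for x using b[of j x] mult_le_one[of "\<bar>u j x\<bar>" "\<bar>u j x\<bar>"] by (simp add: abs_mult_self_eq)
    have "(\<integral>x. u j x * u j x \<partial>M) \<le> (\<integral>x. 1 \<partial>M)"
      using sq by (intro integral_mono integrable_const_bound[of _ 1]) auto
    then show ?thesis by (simp add: prob_space)
  qed
  then obtain L where "(\<lambda>j. \<integral>x. u j x * u j x \<partial>M) \<longlonglongrightarrow> L" using incseq_convergent[OF inc] by metis
  then show "convergent (\<lambda>j. \<integral>x. u j x * u j x \<partial>M)" unfolding convergent_def by blast
qed

subsection \<open>The unit interval\<close>

abbreviation unit_lborel :: "real measure" where
  "unit_lborel \<equiv> restrict_space lborel {0..1}"

interpretation unit: prob_space unit_lborel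
  by (rule prob_spaceI) (simp add: emeasure_restrict_space space_restrict_space)

interpretation unit2: pair_prob_space unit_lborel unit_lborel ..

interpretation units: product_prob_space "\<lambda>_::nat. unit_lborel" UNIV ..

lemma space_unit_lborel [simp]: "space unit_lborel = {0..1}"
  by (simp add: space_restrict_space)

abbreviation cube :: "nat set \<Rightarrow> (nat \<Rightarrow> real) measure" where
  "cube I \<equiv> \<Pi>\<^sub>M i\<in>I. unit_lborel"

lemma prob_space_cube: "prob_space (cube I)"
  by (intro prob_space_PiM unit.prob_space_axioms)

text \<open>Two distinct coordinates of the cube are independent and uniform; the remaining
  coordinates integrate to 1.\<close>

lemma nn_integral_cube_pair:
  assumes I: "finite I" "i \<in> I" "j \<in> I" "i \<noteq> j"
    and [measurable]: "h \<in> borel_measurable (unit_lborel \<Otimes>\<^sub>M unit_lborel)"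
  shows "(\<integral>\<^sup>+x. h (x i, x j) \<partial>cube I) = (\<integral>\<^sup>+p. h p \<partial>(unit_lborel \<Otimes>\<^sub>M unit_lborel))"
proof -
  define J where "J = I - {i, j}"
  have J: "finite J" "j \<notin> J" "i \<notin> insert j J" "I = insert i (insert j J)" using I by (auto simp: J_def)
  interpret J: prob_space "cube J" by (rule prob_space_cube)
  have [measurable]: "(\<lambda>x. x i) \<in> cube I \<rightarrow>\<^sub>M unit_lborel" "(\<lambda>x. x j) \<in> cube I \<rightarrow>\<^sub>M unit_lborel"
    using I by (auto intro: measurable_component_singleton)
  have [measurable]: "(\<lambda>x. x j) \<in> cube (insert j J) \<rightarrow>\<^sub>M unit_lborel"
    by (auto intro: measurable_component_singleton)
  have "(\<integral>\<^sup>+x. h (x i, x j) \<partial>cube I) = (\<integral>\<^sup>+x. (\<integral>\<^sup>+u. h (u, x j) \<partial>unit_lborel) \<partial>cube (insert j J))"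
    unfolding J(4) by (subst units.product_nn_integral_insert) (use J I in \<open>auto simp flip: J(4)\<close>)
  also have "\<dots> = (\<integral>\<^sup>+x. (\<integral>\<^sup>+v. (\<integral>\<^sup>+u. h (u, v) \<partial>unit_lborel) \<partial>unit_lborel) \<partial>cube J)"
    by (subst units.product_nn_integral_insert) (use J in auto)
  also have "\<dots> = (\<integral>\<^sup>+v. (\<integral>\<^sup>+u. h (u, v) \<partial>unit_lborel) \<partial>unit_lborel)"
    by (simp add: J.emeasure_space_1)
  also have "\<dots> = (\<integral>\<^sup>+p. h p \<partial>(unit_lborel \<Otimes>\<^sub>M unit_lborel))"
    by (subst unit2.nn_integral_snd[symmetric]) auto
  finally show ?thesis .
qed

text \<open>A null set of pairs pulls back to a null set of the cube. Distinctness of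
  \<open>i\<close> and \<open>j\<close> is essential, since \<open>Q\<close> may fail on the whole
  diagonal.\<close>

lemma AE_cube_pair:
  assumes I: "finite I" "i \<in> I" "j \<in> I" "i \<noteq> j"
    and AE: "AE p in unit_lborel \<Otimes>\<^sub>M unit_lborel. Q p"
  shows "AE x in cube I. Q (x i, x j)"
proof -
  obtain N where N: "N \<in> null_sets (unit_lborel \<Otimes>\<^sub>M unit_lborel)"
    "{p \<in> space (unit_lborel \<Otimes>\<^sub>M unit_lborel). \<not> Q p} \<subseteq> N"
    using AE by (auto elim!: AE_E3 simp: eventually_ae_filter)
  then have [measurable]: "N \<in> sets (unit_lborel \<Otimes>\<^sub>M unit_lborel)" by auto
  have [measurable]: "(\<lambda>x. x i) \<in> cube I \<rightarrow>\<^sub>M unit_lborel" "(\<lambda>x. x j) \<in> cube I \<rightarrow>\<^sub>M unit_lborel"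
    using I by (auto intro: measurable_component_singleton)
  have "(\<integral>\<^sup>+x. indicator N (x i, x j) \<partial>cube I) = 0"
    using N by (subst nn_integral_cube_pair[OF I]) auto
  then have "AE x in cube I. indicator N (x i, x j) = (0::ennreal)"
    by (subst (asm) nn_integral_0_iff_AE) auto
  moreover have "AE x in cube I. x i \<in> {0..1} \<and> x j \<in> {0..1}"
    using I by (intro AE_I2) (auto simp: space_PiM PiE_iff)
  ultimately show ?thesis
  proof eventually_elim
    case (elim x)
    then have "(x i, x j) \<notin> N" by (auto simp: indicator_def split: if_splits)
    moreover have "(x i, x j) \<in> space (unit_lborel \<Otimes>\<^sub>M unit_lborel)" using elim by (auto simp: space_pair_measure)
    ultimately show ?case using N(2) by blast
  qed
qed

lemma AE_cube_component:
  assumes "i \<in> I" "AE x in unit_lborel. Q x"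
  shows "AE x in cube I. Q (x i)"
  using assms by (intro AE_PiM_component[where M = "\<lambda>_. unit_lborel"] unit.prob_space_axioms)

subsection \<open>Realising a code tree on the unit interval\<close>

context code_tree
begin

definition start :: "nat \<Rightarrow> nat \<Rightarrow> real" where
  "start j z = (\<Sum>y<z. \<mu> j y)"

text \<open>Class \<open>z\<close> becomes the interval from \<open>start j z\<close> to
  \<open>start j (Suc z)\<close>, closed on the right and, for \<open>z > 0\<close>, open on the
  left. Taking the least candidate puts the point 0 into class 0.\<close>

definition code :: "nat \<Rightarrow> real \<Rightarrow> nat" where
  "code j x = (LEAST z. x \<le> start j (Suc z))"

lemma start_mono: "y \<le> z \<Longrightarrow> start j y \<le> start j z"
  unfolding start_def by (intro sum_mono2) (auto simp: \<mu>_nonneg)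

lemma start_Suc: "start j (Suc z) = start j z + \<mu> j z"
  by (simp add: start_def)

lemma K_pos: "0 < K j"
  by (induction j) (use M_pos in \<open>auto simp: K_0 K_Suc Suc_le_eq\<close>)

lemma start_K: "start j (K j) = 1"
  by (simp add: start_def \<mu>_total)

lemma sum_lessThan_blocks: "(\<Sum>y<z * m. g y) = (\<Sum>y<z. \<Sum>r<m. g (y * m + r :: nat) :: real)"
proof -
  have "sum g {y * m..<y * m + m} = (\<Sum>r<m. g (y * m + r))" for y
    by (rule sum.reindex_bij_witness[of _ "\<lambda>r. y * m + r" "\<lambda>x. x - y * m"]) auto
  then show ?thesis by (simp flip: sum.nat_group)
qed

lemma start_split: "start (Suc j) (z * M j) = start j z"
  unfolding start_def sum_lessThan_blocks by (simp flip: \<mu>_split)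

lemma code_props:
  assumes "x \<in> {0..1}"
  shows "x \<le> start j (Suc (code j x))" "code j x < K j" "y < code j x \<Longrightarrow> start j (Suc y) < x"
proof -
  have ex: "x \<le> start j (Suc (K j - 1))" using assms K_pos[of j] by (simp add: start_K)
  show "x \<le> start j (Suc (code j x))" unfolding code_def by (rule LeastI[where P = "\<lambda>z. x \<le> start j (Suc z)", OF ex])
  have "code j x \<le> K j - 1" unfolding code_def by (rule Least_le[where P = "\<lambda>z. x \<le> start j (Suc z)", OF ex])
  then show "code j x < K j" using K_pos[of j] by simp
  show "start j (Suc y) < x" if "y < code j x" using not_less_Least[of y "\<lambda>z. x \<le> start j (Suc z)"] that by (simp add: code_def)
qed

lemma code_eqI:
  assumes "x \<le> start j (Suc z)" "\<And>y. y < z \<Longrightarrow> start j (Suc y) < x"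
  shows "code j x = z"
  unfolding code_def
proof (rule Least_equality)
  fix y assume "x \<le> start j (Suc y)"
  then show "z \<le> y" using assms(2)[of y] by (meson leD leI)
qed (rule assms(1))

text \<open>The children of a class fill its interval in order (\<open>start_split\<close>), so
  codes of points obey the same division rule as codes of vertices.\<close>

lemma code_div: 
  assumes "x \<in> {0..1}"
  shows "code (Suc j) x div M j = code j x"
proof (rule sym, rule code_eqI)
  let ?z' = "code (Suc j) x" and ?z = "code (Suc j) x div M j"
  have M: "0 < M j" using M_pos[of j] by simp
  have "Suc ?z' \<le> Suc ?z * M j" using dividend_less_div_times[OF M, of ?z'] by simp
  then have "start (Suc j) (Suc ?z') \<le> start j (Suc ?z)"
    unfolding start_split[of j "Suc ?z", symmetric] by (rule start_mono)
  then show "x \<le> start j (Suc ?z)" using code_props(1)[OF assms, of "Suc j"] by simp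
next
  fix y assume y: "y < code (Suc j) x div M j"
  have M: "0 < M j" using M_pos[of j] by simp
  have "Suc y * M j \<le> code (Suc j) x div M j * M j" using y by (intro mult_right_mono) auto
  also have "\<dots> \<le> code (Suc j) x" by simp
  \<comment> \<open>\<open>Suc y * M j - 1\<close> is the last child of class
    \<open>y\<close>.\<close>
  finally have "Suc y * M j - 1 < code (Suc j) x" "Suc (Suc y * M j - 1) = Suc y * M j" using M by simp_all
  then show "start j (Suc y) < x"
    using code_props(3)[OF assms, of "Suc y * M j - 1" "Suc j"] by (metis start_split)
qed

lemma measurable_code [measurable]: "code j \<in> unit_lborel \<rightarrow>\<^sub>M count_space UNIV"
proof -
  have "code j \<in> borel \<rightarrow>\<^sub>M count_space UNIV" unfolding code_def by measurable
  then show ?thesis by (intro measurable_restrict_space1) simp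
qed

lemma measure_code: 
  assumes "z < K j"
  shows "measure unit_lborel {x \<in> {0..1}. code j x = z} = \<mu> j z"
\<comment> \<open>Class 0 is treated separately because its interval contains the left endpoint
  0.\<close>
proof (cases z)
  case 0
  have "{x \<in> {0..1}. code j x = z} = {0..start j 1}"
  proof (rule subset_antisym; rule subsetI)
    fix x assume "x \<in> {x \<in> {0..1}. code j x = z}"
    then show "x \<in> {0..start j 1}" using code_props(1)[of x j] 0 by auto
  next
    fix x assume x: "x \<in> {0..start j 1}"
    then have "x \<in> {0..1}" using start_mono[of 1 "K j" j] assms 0 by (auto simp: start_K)
    moreover have "code j x = 0" by (rule code_eqI) (use x in auto)
    ultimately show "x \<in> {x \<in> {0..1}. code j x = z}" using 0 by auto
  qed
  moreover have "start j 1 \<le> 1" using start_mono[of 1 "K j" j] assms 0 by (simp add: start_K)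
  moreover have "0 \<le> start j 1" by (simp add: start_def \<mu>_nonneg)
  ultimately show ?thesis using 0 by (simp add: measure_restrict_space start_def)
next
  case (Suc y)
  have le: "start j (Suc z) \<le> 1" using start_mono[of "Suc z" "K j" j] assms by (simp add: start_K)
  have ge: "0 \<le> start j z" by (simp add: start_def \<mu>_nonneg sum_nonneg)
  have "{x \<in> {0..1}. code j x = z} = {start j z<..start j (Suc z)}"
  proof (rule subset_antisym; rule subsetI)
    fix x assume "x \<in> {x \<in> {0..1}. code j x = z}"
    then show "x \<in> {start j z<..start j (Suc z)}" using code_props(1)[of x j] code_props(3)[of x y j] Suc by auto
  next
    fix x assume x: "x \<in> {start j z<..start j (Suc z)}"
    then have "x \<in> {0..1}" using le ge by auto
    moreover have "code j x = z"
    proof (rule code_eqI)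
      fix y assume "y < z"
      then have "start j (Suc y) \<le> start j z" by (intro start_mono) simp
      then show "start j (Suc y) < x" using x by simp
    qed (use x in simp)
    ultimately show "x \<in> {x \<in> {0..1}. code j x = z}" by auto
  qed
  moreover have "start j z \<le> start j (Suc z)" by (rule start_mono) simp
  ultimately show ?thesis using le ge by (subst measure_restrict_space) (auto simp: start_Suc)
qed

lemma integral_code: "(\<integral>x. g (code j x) \<partial>unit_lborel) = (\<Sum>z<K j. \<mu> j z * (g z :: real))"
proof -
  have "(\<integral>x. g (code j x) \<partial>unit_lborel) = (\<integral>x. (\<Sum>z<K j. indicator {x \<in> {0..1}. code j x = z} x * g z) \<partial>unit_lborel)"
  proof (rule Bochner_Integration.integral_cong[OF refl])
    fix x assume "x \<in> space unit_lborel"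
    then have x: "x \<in> {0..1}" by simp
    have "indicator {x \<in> {0..1}. code j x = z} x * g z = (if code j x = z then g z else 0)" for z
      using x by simp
    then show "g (code j x) = (\<Sum>z<K j. indicator {x \<in> {0..1}. code j x = z} x * g z)"
      using code_props(2)[OF x, of j] by (simp add: sum.delta')
  qed
  also have "\<dots> = (\<Sum>z<K j. measure unit_lborel {x \<in> {0..1}. code j x = z} * g z)"
  proof -
    have [measurable]: "{x \<in> {0..1}. code j x = z} \<in> sets unit_lborel" for z
    proof -
      have "{x \<in> space unit_lborel. code j x = z} \<in> sets unit_lborel" by measurable
      then show ?thesis by simp
    qed
    have "integrable unit_lborel (\<lambda>x. indicator {x \<in> {0..1}. code j x = z} x * g z)" for z
    proof (rule unit.integrable_const_bound[of _ "\<bar>g z\<bar>"])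
      show "AE x in unit_lborel. norm (indicator {x \<in> {0..1}. code j x = z} x * g z) \<le> \<bar>g z\<bar>"
        by (intro AE_I2) (simp add: abs_mult mult_left_le_one_le indicator_def)
    qed measurable
    then have "(\<integral>x. (\<Sum>z<K j. indicator {x \<in> {0..1}. code j x = z} x * g z) \<partial>unit_lborel)
        = (\<Sum>z<K j. \<integral>x. indicator {x \<in> {0..1}. code j x = z} x * g z \<partial>unit_lborel)"
      by (rule Bochner_Integration.integral_sum)
    also have "\<dots> = (\<Sum>z<K j. measure unit_lborel {x \<in> {0..1}. code j x = z} * g z)"
    proof (rule sum.cong[OF refl])
      fix z
      have "{x \<in> {0..1}. code j x = z} \<inter> {0..1} = {x \<in> {0..1}. code j x = z}" by blast
      then show "(\<integral>x. indicator {x \<in> {0..1}. code j x = z} x * g z \<partial>unit_lborel) = measure unit_lborel {x \<in> {0..1}. code j x = z} * g z"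
        by (simp del: atLeastAtMost_iff)
    qed
    finally show ?thesis .
  qed
  also have "\<dots> = (\<Sum>z<K j. \<mu> j z * g z)"
    by (intro sum.cong refl) (simp add: measure_code del: atLeastAtMost_iff)
  finally show ?thesis .
qed

lemma bounded_code: 
  fixes g :: "nat \<Rightarrow> nat \<Rightarrow> real"
  shows "\<exists>C. \<forall>x\<in>{0..1}. \<forall>y\<in>{0..1}. \<bar>g (code j x) (code j y)\<bar> \<le> C"
proof (intro exI ballI)
  fix x y :: real assume "x \<in> {0..1}" "y \<in> {0..1}"
  then have "code j x < K j" "code j y < K j" by (auto intro: code_props)
  then show "\<bar>g (code j x) (code j y)\<bar> \<le> Max ((\<lambda>(z, z'). \<bar>g z z'\<bar>) ` ({..<K j} \<times> {..<K j}))"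
    by (intro Max_ge) auto
qed

lemma integral_code2:
  "(\<integral>p. g (code j (fst p)) (code j (snd p)) \<partial>(unit_lborel \<Otimes>\<^sub>M unit_lborel))
    = (\<Sum>z<K j. \<Sum>z'<K j. \<mu> j z * \<mu> j z' * (g z z' :: real))"
proof -
  obtain C where C: "\<And>x y. x \<in> {0..1} \<Longrightarrow> y \<in> {0..1} \<Longrightarrow> \<bar>g (code j x) (code j y)\<bar> \<le> C"
    using bounded_code by blast
  have "integrable (unit_lborel \<Otimes>\<^sub>M unit_lborel) (\<lambda>(x, y). g (code j x) (code j y))"
    using C by (intro unit2.integrable_const_bound[of _ C]) (auto simp: space_pair_measure intro!: AE_I2)
  from unit2.integral_fst'[OF this[unfolded case_prod_unfold]]
  have "(\<integral>p. g (code j (fst p)) (code j (snd p)) \<partial>(unit_lborel \<Otimes>\<^sub>M unit_lborel))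
      = (\<integral>x. (\<integral>y. g (code j x) (code j y) \<partial>unit_lborel) \<partial>unit_lborel)" by simp
  also have "\<dots> = (\<Sum>z<K j. \<mu> j z * (\<Sum>z'<K j. \<mu> j z' * g z z'))"
    unfolding integral_code[where g = "\<lambda>z'. g _ z'"] by (rule integral_code[where g = "\<lambda>z. \<Sum>z'<K j. \<mu> j z' * g z z'"])
  finally show ?thesis by (simp add: sum_distrib_left mult.assoc)
qed

text \<open>The level-\<open>j\<close> codes of independent uniform points are independent with
  weights \<open>\<mu> j\<close>.\<close>

lemma integral_codes:
  fixes g :: "(nat \<Rightarrow> nat) \<Rightarrow> real"
  assumes I: "finite I"
  shows "(\<integral>x. g (\<lambda>i\<in>I. code j (x i)) \<partial>cube I) = (\<Sum>z\<in>I \<rightarrow>\<^sub>E {..<K j}. (\<Prod>i\<in>I. \<mu> j (z i)) * g z)"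
proof -
  interpret cube: prob_space "cube I" by (rule prob_space_cube)
  let ?ind = "\<lambda>z x. of_bool (code j x = z) :: real"
  have fin: "finite (I \<rightarrow>\<^sub>E {..<K j})" using I by (intro finite_PiE) auto
  have [measurable]: "(\<lambda>x. x i) \<in> cube I \<rightarrow>\<^sub>M unit_lborel" if "i \<in> I" for i
    using that by (auto intro: measurable_component_singleton)
  have prod: "(\<Prod>i\<in>I. ?ind (z i) (x i)) = (of_bool (z = (\<lambda>i\<in>I. code j (x i))) :: real)" if "z \<in> I \<rightarrow>\<^sub>E {..<K j}" for z x
  proof (cases "z = (\<lambda>i\<in>I. code j (x i))")
    case False
    have "z = (\<lambda>i\<in>I. code j (x i))" if "\<forall>i\<in>I. z i = code j (x i)"
      using that PiE_arb[OF \<open>z \<in> I \<rightarrow>\<^sub>E {..<K j}\<close>] by (intro ext) (simp add: restrict_def)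
    with False have "\<exists>i\<in>I. z i \<noteq> code j (x i)" by blast
    then obtain i where i: "i \<in> I" "z i \<noteq> code j (x i)" by blast
    have "(\<Prod>i\<in>I. ?ind (z i) (x i)) = 0"
      by (rule prod_zero[OF I], rule bexI[OF _ i(1)]) (use i(2) in auto)
    with False show ?thesis by simp
  qed simp
  have meas: "(\<lambda>x. \<Prod>i\<in>I. ?ind (z i) (x i)) \<in> borel_measurable (cube I)" for z
    by (intro borel_measurable_prod) measurable
  have int: "integrable (cube I) (\<lambda>x. (\<Prod>i\<in>I. ?ind (z i) (x i)) * g z)" for z
    using meas[of z] by (intro cube.integrable_const_bound[of _ "\<bar>g z\<bar>"])
      (auto simp: abs_mult abs_prod intro!: mult_left_le_one_le prod_le_1 prod_nonneg)
  have "(\<integral>x. g (\<lambda>i\<in>I. code j (x i)) \<partial>cube I) = (\<integral>x. (\<Sum>z\<in>I \<rightarrow>\<^sub>E {..<K j}. (\<Prod>i\<in>I. ?ind (z i) (x i)) * g z) \<partial>cube I)"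
  proof (rule Bochner_Integration.integral_cong[OF refl])
    fix x assume x: "x \<in> space (cube I)"
    have mem: "(\<lambda>i\<in>I. code j (x i)) \<in> I \<rightarrow>\<^sub>E {..<K j}" using x code_props(2)[of "x _" j] by (auto simp: space_PiM PiE_iff)
    have "(\<Sum>z\<in>I \<rightarrow>\<^sub>E {..<K j}. (\<Prod>i\<in>I. ?ind (z i) (x i)) * g z)
        = (\<Sum>z\<in>I \<rightarrow>\<^sub>E {..<K j}. of_bool (z = (\<lambda>i\<in>I. code j (x i))) * g z)"
      by (rule sum.cong[OF refl]) (simp only: prod)
    also have "\<dots> = (\<Sum>z\<in>{\<lambda>i\<in>I. code j (x i)}. of_bool (z = (\<lambda>i\<in>I. code j (x i))) * g z)"
      using fin mem by (intro sum.mono_neutral_right) auto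
    finally show "g (\<lambda>i\<in>I. code j (x i)) = (\<Sum>z\<in>I \<rightarrow>\<^sub>E {..<K j}. (\<Prod>i\<in>I. ?ind (z i) (x i)) * g z)" by simp
  qed
  also have "\<dots> = (\<Sum>z\<in>I \<rightarrow>\<^sub>E {..<K j}. (\<integral>x. (\<Prod>i\<in>I. ?ind (z i) (x i)) \<partial>cube I) * g z)"
    using int by (subst Bochner_Integration.integral_sum) auto
  also have "\<dots> = (\<Sum>z\<in>I \<rightarrow>\<^sub>E {..<K j}. (\<Prod>i\<in>I. \<mu> j (z i)) * g z)"
  proof (rule sum.cong[OF refl])
    fix z assume z: "z \<in> I \<rightarrow>\<^sub>E {..<K j}"
    have "(\<integral>x. (\<Prod>i\<in>I. ?ind (z i) (x i)) \<partial>cube I) = (\<Prod>i\<in>I. \<integral>x. ?ind (z i) x \<partial>unit_lborel)"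
      by (rule units.product_integral_prod[OF I]) (intro unit.integrable_const_bound[of _ 1], auto)
    also have "\<dots> = (\<Prod>i\<in>I. \<mu> j (z i))"
    proof (rule prod.cong[OF refl])
      fix i assume "i \<in> I"
      then have zi: "z i < K j" using z by auto
      have "(\<integral>x. ?ind (z i) x \<partial>unit_lborel) = (\<Sum>y<K j. \<mu> j y * of_bool (y = z i))"
        by (rule integral_code[where g = "\<lambda>y. of_bool (y = z i)"])
      also have "\<dots> = (\<Sum>y\<in>{z i}. \<mu> j y * of_bool (y = z i))"
        using zi by (intro sum.mono_neutral_right) auto
      finally show "(\<integral>x. ?ind (z i) x \<partial>unit_lborel) = \<mu> j (z i)" by simp
    qed
    finally show "(\<integral>x. (\<Prod>i\<in>I. ?ind (z i) (x i)) \<partial>cube I) * g z = (\<Prod>i\<in>I. \<mu> j (z i)) * g z" by simp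
  qed
  finally show ?thesis .
qed

section \<open>Step functions of the levels as martingales\<close>

definition u :: "nat \<Rightarrow> nat \<Rightarrow> real \<times> real \<Rightarrow> real" where
  "u a j = (\<lambda>(x, y). U j a (code j x) (code j y))"

definition p :: "nat \<Rightarrow> nat \<Rightarrow> real \<Rightarrow> real" where
  "p a j x = P j a (code j x)"

lemma tree_density_integral:
  "tree_density K \<mu> U P j F = (\<integral>x. (\<Prod>(i, i')\<in>strict_pairs (dim_row F). u (F $$ (i, i')) j (x i, x i')) *
     (\<Prod>i<dim_row F. p (F $$ (i, i)) j (x i)) \<partial>cube {..<dim_row F})"
proof -
  let ?k = "dim_row F"
  let ?g = "\<lambda>z. (\<Prod>(i, i')\<in>strict_pairs ?k. U j (F $$ (i, i')) (z i) (z i')) * (\<Prod>i<?k. P j (F $$ (i, i)) (z i))"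
  have 1: "(\<Prod>(i, i')\<in>strict_pairs ?k. U j (F $$ (i, i')) ((\<lambda>i\<in>{..<?k}. code j (x i)) i) ((\<lambda>i\<in>{..<?k}. code j (x i)) i'))
      = (\<Prod>(i, i')\<in>strict_pairs ?k. u (F $$ (i, i')) j (x i, x i'))" for x
    by (rule prod.cong[OF refl]) (auto simp: u_def strict_pairs_def)
  have 2: "(\<Prod>i<?k. P j (F $$ (i, i)) ((\<lambda>i\<in>{..<?k}. code j (x i)) i)) = (\<Prod>i<?k. p (F $$ (i, i)) j (x i))" for x
    by (rule prod.cong[OF refl]) (auto simp: p_def)
  show ?thesis
    unfolding tree_density_def using integral_codes[of "{..<?k}" ?g j] unfolding 1 2 by simp
qed

lemma code_ancestor: "\<exists>h. \<forall>x\<in>{0..1}. code j x = h (code (j + d) x)"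
proof (induction d)
  case (Suc d)
  then obtain h where "\<forall>x\<in>{0..1}. code j x = h (code (j + d) x)" by blast
  then show ?case by (intro exI[of _ "\<lambda>z. h (z div M (j + d))"]) (simp add: code_div)
qed auto

text \<open>The martingale property in weak form, with the level-\<open>j\<close> codes as
  conditioning information. Written with class weights, it is \<open>U_split\<close> summed against
  \<open>g\<close> over pairs of parent classes.\<close>

lemma u_martingale_step:
  "(\<integral>q. u a (Suc j) q * g (code j (fst q)) (code j (snd q)) \<partial>(unit_lborel \<Otimes>\<^sub>M unit_lborel))
   = (\<integral>q. u a j q * (g (code j (fst q)) (code j (snd q)) :: real) \<partial>(unit_lborel \<Otimes>\<^sub>M unit_lborel))"
proof -
  have M: "0 < M j" using M_pos[of j] by simp
  have "(\<integral>q. u a (Suc j) q * g (code j (fst q)) (code j (snd q)) \<partial>(unit_lborel \<Otimes>\<^sub>M unit_lborel))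
      = (\<integral>q. U (Suc j) a (code (Suc j) (fst q)) (code (Suc j) (snd q)) *
           g (code (Suc j) (fst q) div M j) (code (Suc j) (snd q) div M j) \<partial>(unit_lborel \<Otimes>\<^sub>M unit_lborel))"
    by (rule Bochner_Integration.integral_cong[OF refl]) (auto simp: space_pair_measure u_def code_div)
  also have "\<dots> = (\<Sum>z<K (Suc j). \<Sum>z'<K (Suc j). \<mu> (Suc j) z * \<mu> (Suc j) z' * (U (Suc j) a z z' * g (z div M j) (z' div M j)))"
    by (rule integral_code2)
  also have "\<dots> = (\<Sum>z<K j. \<Sum>z'<K j. (\<Sum>r<M j. \<Sum>r'<M j.
      \<mu> (Suc j) (z * M j + r) * \<mu> (Suc j) (z' * M j + r') * U (Suc j) a (z * M j + r) (z' * M j + r')) * g z z')"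
    unfolding K_Suc sum_lessThan_blocks
    by (rule sum.cong[OF refl], subst sum.swap) (simp add: sum_distrib_right M div_add1_eq mult.assoc)
  also have "\<dots> = (\<Sum>z<K j. \<Sum>z'<K j. \<mu> j z * \<mu> j z' * (U j a z z' * g z z'))"
    unfolding U_split[symmetric] by (simp add: mult.assoc)
  also have "\<dots> = (\<integral>q. U j a (code j (fst q)) (code j (snd q)) * g (code j (fst q)) (code j (snd q)) \<partial>(unit_lborel \<Otimes>\<^sub>M unit_lborel))"
    by (rule integral_code2[symmetric])
  finally show ?thesis by (simp add: u_def case_prod_unfold)
qed

lemma p_martingale_step:
  "(\<integral>x. p a (Suc j) x * g (code j x) \<partial>unit_lborel) = (\<integral>x. p a j x * (g (code j x) :: real) \<partial>unit_lborel)"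
proof -
  have M: "0 < M j" using M_pos[of j] by simp
  have "(\<integral>x. p a (Suc j) x * g (code j x) \<partial>unit_lborel)
      = (\<integral>x. P (Suc j) a (code (Suc j) x) * g (code (Suc j) x div M j) \<partial>unit_lborel)"
    by (rule Bochner_Integration.integral_cong[OF refl]) (auto simp: p_def code_div)
  also have "\<dots> = (\<Sum>z<K (Suc j). \<mu> (Suc j) z * (P (Suc j) a z * g (z div M j)))"
    by (rule integral_code)
  also have "\<dots> = (\<Sum>z<K j. (\<Sum>r<M j. \<mu> (Suc j) (z * M j + r) * P (Suc j) a (z * M j + r)) * g z)"
    unfolding K_Suc sum_lessThan_blocks by (simp add: sum_distrib_right M div_add1_eq mult.assoc)
  also have "\<dots> = (\<Sum>z<K j. \<mu> j z * (P j a z * g z))"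
    unfolding P_split[symmetric] by (simp add: mult.assoc)
  also have "\<dots> = (\<integral>x. P j a (code j x) * g (code j x) \<partial>unit_lborel)"
    by (rule integral_code[symmetric])
  finally show ?thesis by (simp add: p_def)
qed

lemma u_martingale:
  "(\<integral>q. u a (j + d) q * g (code j (fst q)) (code j (snd q)) \<partial>(unit_lborel \<Otimes>\<^sub>M unit_lborel))
   = (\<integral>q. u a j q * (g (code j (fst q)) (code j (snd q)) :: real) \<partial>(unit_lborel \<Otimes>\<^sub>M unit_lborel))"
proof (induction d)
  case (Suc d)
  obtain h where h: "\<And>x. x \<in> {0..1} \<Longrightarrow> code j x = h (code (j + d) x)" using code_ancestor by blast
  have "(\<integral>q. u a (j + d') q * g (code j (fst q)) (code j (snd q)) \<partial>(unit_lborel \<Otimes>\<^sub>M unit_lborel))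
      = (\<integral>q. u a (j + d') q * g (h (code (j + d) (fst q))) (h (code (j + d) (snd q))) \<partial>(unit_lborel \<Otimes>\<^sub>M unit_lborel))" for d'
    by (rule Bochner_Integration.integral_cong[OF refl]) (auto simp: space_pair_measure h)
  from this[of "Suc d"] this[of d] show ?case
    using u_martingale_step[of a "j + d" "\<lambda>z z'. g (h z) (h z')"] Suc by simp
qed simp

lemma p_martingale:
  "(\<integral>x. p a (j + d) x * g (code j x) \<partial>unit_lborel) = (\<integral>x. p a j x * (g (code j x) :: real) \<partial>unit_lborel)"
proof (induction d)
  case (Suc d)
  obtain h where h: "\<And>x. x \<in> {0..1} \<Longrightarrow> code j x = h (code (j + d) x)" using code_ancestor by blast
  have "(\<integral>x. p a (j + d') x * g (code j x) \<partial>unit_lborel) = (\<integral>x. p a (j + d') x * g (h (code (j + d) x)) \<partial>unit_lborel)" for d'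
    by (rule Bochner_Integration.integral_cong[OF refl]) (auto simp: h)
  from this[of "Suc d"] this[of d] show ?case
    using p_martingale_step[of a "j + d" "\<lambda>z. g (h z)"] Suc by simp
qed simp

text \<open>\<open>u_martingale\<close> tested with \<open>u a i\<close> itself, which is a function
  of the level-\<open>i\<close> codes.\<close>

lemma u_orth: "i \<le> j \<Longrightarrow> (\<integral>q. u a j q * u a i q \<partial>(unit_lborel \<Otimes>\<^sub>M unit_lborel)) = (\<integral>q. u a i q * u a i q \<partial>(unit_lborel \<Otimes>\<^sub>M unit_lborel))"
  using u_martingale[of a i "j - i" "\<lambda>z z'. U i a z z'"] by (simp add: u_def[of a i] case_prod_unfold)

lemma p_orth: "i \<le> j \<Longrightarrow> (\<integral>x. p a j x * p a i x \<partial>unit_lborel) = (\<integral>x. p a i x * p a i x \<partial>unit_lborel)"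
  using p_martingale[of a i "j - i" "\<lambda>z. P i a z"] by (simp add: p_def[of a i])

lemma u_bounds: "0 \<le> u a j q" "u a j q \<le> 1"
  by (simp_all add: u_def case_prod_unfold U_nonneg U_le_1)

lemma p_bounds: "0 \<le> p a j x" "p a j x \<le> 1"
  by (simp_all add: p_def P_nonneg P_le_1)

lemma measurable_code_borel [measurable]: "code j \<in> borel \<rightarrow>\<^sub>M count_space UNIV"
  unfolding code_def by measurable

lemma measurable_u [measurable]: "u a j \<in> borel_measurable (borel \<Otimes>\<^sub>M borel)"
  unfolding u_def by measurable

lemma measurable_p [measurable]: "p a j \<in> borel_measurable borel"
  unfolding p_def by measurable

lemma exists_convergent_subsequence:
  obtains r where "strict_mono (r :: nat \<Rightarrow> nat)"
    "\<And>a. AE q in unit_lborel \<Otimes>\<^sub>M unit_lborel. convergent (\<lambda>m. u a (r m) q)"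
    "\<And>a. AE x in unit_lborel. convergent (\<lambda>m. p a (r m) x)"
proof -
  have mu [measurable]: "u a j \<in> borel_measurable (unit_lborel \<Otimes>\<^sub>M unit_lborel)" for a j unfolding u_def by measurable
  have mp [measurable]: "p a j \<in> borel_measurable unit_lborel" for a j unfolding p_def by measurable
  have ub: "\<bar>u a j q\<bar> \<le> 1" for a j q using u_bounds[of a j q] by simp
  have pb: "\<bar>p a j q\<bar> \<le> 1" for a j q using p_bounds[of a j q] by simp
  define Eu where "Eu = (\<lambda>a j. \<integral>q. u a j q * u a j q \<partial>(unit_lborel \<Otimes>\<^sub>M unit_lborel))"
  define Ep where "Ep = (\<lambda>a j. \<integral>x. p a j x * p a j x \<partial>unit_lborel)"
  have cu: "incseq (Eu a)" "convergent (Eu a)" for a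
    unfolding Eu_def by (rule unit2.convergent_energy[OF mu ub u_orth]; assumption)+
  have cp: "incseq (Ep a)" "convergent (Ep a)" for a
    unfolding Ep_def by (rule unit.convergent_energy[OF mp pb p_orth]; assumption)+
  \<comment> \<open>Both energies increase, so controlling the increments of their sum controls each
    of them, and one subsequence serves edges and loops alike.\<close>
  have "convergent (\<lambda>j. Eu a j + Ep a j)" for a using cu cp by (intro convergent_add)
  from fast_subsequence[of "\<lambda>a j. Eu a j + Ep a j", OF this] obtain r where r: "strict_mono (r :: nat \<Rightarrow> nat)"
    "\<And>a m. a \<le> m \<Longrightarrow> \<bar>(Eu a (r (Suc m)) + Ep a (r (Suc m))) - (Eu a (r m) + Ep a (r m))\<bar> \<le> (1/4) ^ m"
    by blast
  have le: "r m \<le> r (Suc m)" for m using r(1) by (simp add: strict_mono_less_eq)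
  have inc: "Eu a (r m) \<le> Eu a (r (Suc m))" "Ep a (r m) \<le> Ep a (r (Suc m))" for a m
    by (rule incseqD[OF cu(1) le], rule incseqD[OF cp(1) le])
  have incu: "(\<integral>q. (u a (r (Suc m)) q - u a (r m) q)\<^sup>2 \<partial>(unit_lborel \<Otimes>\<^sub>M unit_lborel)) \<le> (1/4) ^ m" if "a \<le> m" for a m
    using unit2.L2_increment[OF mu ub u_orth le] r(2)[OF that] inc[of a m] unfolding Eu_def by fastforce
  have incp: "(\<integral>x. (p a (r (Suc m)) x - p a (r m) x)\<^sup>2 \<partial>unit_lborel) \<le> (1/4) ^ m" if "a \<le> m" for a m
    using unit.L2_increment[OF mp pb p_orth le] r(2)[OF that] inc[of a m] unfolding Ep_def by fastforce
  show ?thesis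
  proof (rule that[OF r(1)])
    show "AE q in unit_lborel \<Otimes>\<^sub>M unit_lborel. convergent (\<lambda>m. u a (r m) q)" for a
      by (rule unit2.AE_convergent_of_L2_increments[of "\<lambda>m. u a (r m)" a]) (use mu ub incu in auto)
    show "AE x in unit_lborel. convergent (\<lambda>m. p a (r m) x)" for a
      by (rule unit.AE_convergent_of_L2_increments[of "\<lambda>m. p a (r m)" a]) (use mp pb incp in auto)
  qed
qed

end

subsection \<open>From tail functions to a multigraphon\<close>

text \<open>Tail functions of probability distributions on the natural numbers. Convergence to 0 is
  expressed by countable quantifiers over strict inequalities, which suffices by monotonicity and
  keeps the condition measurable in a parameter.\<close>

definition tail_seq :: "(nat \<Rightarrow> real) \<Rightarrow> bool" where
  "tail_seq t \<longleftrightarrow> t 0 = 1 \<and> (\<forall>a. 0 \<le> t a \<and> t (Suc a) \<le> t a) \<and> (\<forall>n. \<exists>a. t a < inverse (real (Suc n)))"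

lemma tail_seq_of_bool: "tail_seq (\<lambda>a. of_bool (a = 0))"
  unfolding tail_seq_def by (auto intro!: exI[of _ "1::nat"])

lemma tail_seq_antimono:
  assumes "tail_seq t" "a \<le> b"
  shows "t b \<le> t a"
proof -
  have "t (Suc n) \<le> t n" for n using assms(1) by (simp add: tail_seq_def)
  then show ?thesis using assms(2) by (rule lift_Suc_antimono_le)
qed

lemma tail_seq_bounds: "tail_seq t \<Longrightarrow> 0 \<le> t a" "tail_seq t \<Longrightarrow> t a \<le> 1"
  using tail_seq_antimono[of t 0 a] by (auto simp: tail_seq_def)

lemma tail_seq_tendsto:
  assumes "tail_seq t"
  shows "t \<longlonglongrightarrow> 0"
proof (rule LIMSEQ_I)
  fix e :: real assume "0 < e"
  then obtain n where n: "inverse (real (Suc n)) < e" using reals_Archimedean by blast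
  obtain a where a: "t a < inverse (real (Suc n))" using assms unfolding tail_seq_def by blast
  have "norm (t b - 0) < e" if "a \<le> b" for b
    using tail_seq_antimono[OF assms that] tail_seq_bounds(1)[OF assms, of b] a n by simp
  then show "\<exists>N. \<forall>b\<ge>N. norm (t b - 0) < e" by blast
qed

text \<open>The successive differences are the point probabilities of the distribution with tail
  \<open>t\<close>.\<close>

lemma tail_seq_sums:
  assumes "tail_seq t"
  shows "(\<lambda>l. t (a + l) - t (Suc (a + l))) sums t a"
proof -
  have "(\<lambda>l. t (l + a)) \<longlonglongrightarrow> 0" by (rule LIMSEQ_ignore_initial_segment[OF tail_seq_tendsto[OF assms]])
  from telescope_sums'[OF this] show ?thesis by (simp add: add.commute)
qed

lemma prod_lower_triangle:
  "(\<Prod>j<k. \<Prod>i\<le>j. g i j :: real) = (\<Prod>(i, j)\<in>strict_pairs k. g i j) * (\<Prod>i<k. g i i)"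
proof (induction k)
  case (Suc k)
  have sp: "strict_pairs (Suc k) = strict_pairs k \<union> (\<lambda>i. (i, k)) ` {..<k}"
    by (auto simp: strict_pairs_def less_Suc_eq)
  have "(\<Prod>(i, j)\<in>(\<lambda>i. (i, k)) ` {..<k}. g i j) = (\<Prod>i<k. g i k)"
    by (subst prod.reindex) (auto simp: inj_on_def)
  then have "(\<Prod>(i, j)\<in>strict_pairs (Suc k). g i j) = (\<Prod>(i, j)\<in>strict_pairs k. g i j) * (\<Prod>i<k. g i k)"
    unfolding sp by (subst prod.union_disjoint) (auto, auto simp: strict_pairs_def)
  then show ?case using Suc by (simp add: lessThan_Suc_atMost[symmetric])
qed (simp add: strict_pairs_def)

lemma integral_cube_pair:
  fixes h :: "real \<times> real \<Rightarrow> real"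
  assumes I: "finite I" "i \<in> I" "j \<in> I" "i \<noteq> j"
    and h [measurable]: "h \<in> borel_measurable (unit_lborel \<Otimes>\<^sub>M unit_lborel)" and pos: "\<And>q. 0 \<le> h q"
  shows "(\<integral>x. h (x i, x j) \<partial>cube I) = (\<integral>q. h q \<partial>(unit_lborel \<Otimes>\<^sub>M unit_lborel))"
proof -
  have [measurable]: "(\<lambda>x. x i) \<in> cube I \<rightarrow>\<^sub>M unit_lborel" "(\<lambda>x. x j) \<in> cube I \<rightarrow>\<^sub>M unit_lborel"
    using I by (auto intro: measurable_component_singleton)
  have "(\<integral>x. h (x i, x j) \<partial>cube I) = enn2real (\<integral>\<^sup>+x. ennreal (h (x i, x j)) \<partial>cube I)"
    by (rule integral_eq_nn_integral) (use pos in auto)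
  also have "(\<integral>\<^sup>+x. ennreal (h (x i, x j)) \<partial>cube I) = (\<integral>\<^sup>+q. ennreal (h q) \<partial>(unit_lborel \<Otimes>\<^sub>M unit_lborel))"
    by (rule nn_integral_cube_pair[OF I, of "\<lambda>q. ennreal (h q)"]) measurable
  also have "enn2real \<dots> = (\<integral>q. h q \<partial>(unit_lborel \<Otimes>\<^sub>M unit_lborel))"
    by (rule integral_eq_nn_integral[symmetric]) (use pos in auto)
  finally show ?thesis .
qed

text \<open>Markov's inequality on the set where all \<open>t x a\<close> stay above a fixed
  \<open>?c\<close>: its measure times \<open>?c\<close> lies below every one of the integrals,
  which become arbitrarily small.\<close>

lemma (in prob_space) AE_small_of_integral_tendsto_0:
  fixes t :: "'a \<Rightarrow> nat \<Rightarrow> real"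
  assumes [measurable]: "\<And>a. (\<lambda>x. t x a) \<in> borel_measurable M"
    and b: "AE x in M. \<forall>a. 0 \<le> t x a \<and> t x a \<le> 1"
    and lim: "\<And>e. 0 < e \<Longrightarrow> \<exists>a. (\<integral>x. t x a \<partial>M) < e"
  shows "AE x in M. \<forall>n. \<exists>a. t x a < inverse (real (Suc n))"
proof (rule AE_all_countable[THEN iffD2], rule allI)
  fix n :: nat
  let ?c = "inverse (real (Suc n))"
  define A where "A = {x \<in> space M. \<forall>a. ?c \<le> t x a}"
  have [measurable]: "A \<in> sets M" unfolding A_def by measurable
  have "measure M A * ?c \<le> (\<integral>x. t x a \<partial>M)" for a
  proof -
    have "(\<integral>x. indicator A x * ?c \<partial>M) \<le> (\<integral>x. t x a \<partial>M)"
    proof (rule integral_mono_AE)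
      show "integrable M (\<lambda>x. indicator A x * ?c)"
        by (rule integrable_const_bound[of _ 1]) (auto simp: indicator_def field_simps)
      show "integrable M (\<lambda>x. t x a)"
        by (rule integrable_const_bound[of _ 1]) (use b in auto)
      show "AE x in M. indicator A x * ?c \<le> t x a"
        using b by eventually_elim (auto simp: A_def indicator_def)
    qed
    then show ?thesis by simp
  qed
  note le = this
  have "measure M A * ?c \<le> 0"
  proof (rule field_le_epsilon)
    fix e :: real assume "0 < e"
    then obtain a where "(\<integral>x. t x a \<partial>M) < e" using lim by blast
    then show "measure M A * ?c \<le> 0 + e" using le[of a] by linarith
  qed
  moreover have "0 < ?c" by simp
  ultimately have "measure M A \<le> 0" by (metis mult_le_0_iff not_le)
  then have "measure M A = 0" using measure_nonneg[of M A] by linarith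
  then have "A \<in> null_sets M" by (simp add: null_sets_def emeasure_eq_measure)
  from AE_not_in[OF this] show "AE x in M. \<exists>a. t x a < ?c"
    using AE_space by eventually_elim (auto simp: A_def not_le)
qed

text \<open>The diagonal is null, so placing the loop law there is invisible to edge
  factors.\<close>

lemma AE_neq_unit: "AE q in unit_lborel \<Otimes>\<^sub>M unit_lborel. fst q \<noteq> snd q"
proof (rule unit2.AE_pair_measure)
  have [measurable]: "(\<lambda>x. x) \<in> unit_lborel \<rightarrow>\<^sub>M borel" by (rule measurable_restrict_space1) simp
  show "{q \<in> space (unit_lborel \<Otimes>\<^sub>M unit_lborel). fst q \<noteq> snd q} \<in> sets (unit_lborel \<Otimes>\<^sub>M unit_lborel)"
    by measurable
  have "AE y in unit_lborel. x \<noteq> y" for x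
    using AE_lborel_singleton[of x] by (subst AE_restrict_space_iff) (auto elim: eventually_mono)
  then show "AE x in unit_lborel. AE y in unit_lborel. fst (x, y) \<noteq> snd (x, y)" by simp
qed

lemma measurable_unit_pair:
  "h \<in> borel_measurable (borel \<Otimes>\<^sub>M borel) \<Longrightarrow> h \<in> borel_measurable (unit_lborel \<Otimes>\<^sub>M unit_lborel)"
proof -
  have [measurable]: "(\<lambda>x. x) \<in> unit_lborel \<rightarrow>\<^sub>M borel" by (rule measurable_restrict_space1) simp
  have "(\<lambda>q. (fst q, snd q)) \<in> unit_lborel \<Otimes>\<^sub>M unit_lborel \<rightarrow>\<^sub>M borel \<Otimes>\<^sub>M borel"
    by (intro measurable_Pair measurable_compose[OF measurable_fst] measurable_compose[OF measurable_snd]) measurable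
  from measurable_compose[OF this] show "h \<in> borel_measurable (borel \<Otimes>\<^sub>M borel) \<Longrightarrow> ?thesis" by simp
qed

text \<open>The diagonal carries the loop law with tail \<open>s\<close>, all other points the edge
  law with tail \<open>t\<close>; since the diagonal is null, both can be prescribed
  independently.\<close>

definition multigraphon_of :: "(real \<Rightarrow> nat \<Rightarrow> real) \<Rightarrow> (real \<times> real \<Rightarrow> nat \<Rightarrow> real) \<Rightarrow> real \<Rightarrow> real \<Rightarrow> nat \<Rightarrow> real" where
  "multigraphon_of s t x y k = (if x = y then s x k - s x (Suc k) else t (x, y) k - t (x, y) (Suc k))"

lemma multigraphon_multigraphon_of:
  assumes s: "\<And>x. tail_seq (s x)" "\<And>x a. s x (Suc (2 * a)) = s x (2 * a + 2)"
    and t: "\<And>q. tail_seq (t q)" "\<And>x y. t (x, y) = t (y, x)"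
    and ms [measurable]: "\<And>a. (\<lambda>x. s x a) \<in> borel_measurable borel"
    and mt [measurable]: "\<And>a. (\<lambda>q. t q a) \<in> borel_measurable (borel \<Otimes>\<^sub>M borel)"
  shows "multigraphon (multigraphon_of s t)"
  unfolding multigraphon_def
proof (intro conjI ballI allI)
  let ?W = "multigraphon_of s t"
  have 1: "(\<lambda>(x, y). ?W x y k) \<in> borel_measurable (borel \<Otimes>\<^sub>M borel)" for k
    unfolding multigraphon_of_def by measurable
  have pr: "(\<lambda>p :: real \<times> real \<times> nat. (fst p, fst (snd p))) \<in> borel \<rightarrow>\<^sub>M borel \<Otimes>\<^sub>M borel"
    unfolding borel_prod by (intro borel_measurable_continuous_onI continuous_intros)
  have "(\<lambda>p :: real \<times> real \<times> nat. snd (snd p)) \<in> borel \<rightarrow>\<^sub>M borel"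
    by (intro borel_measurable_continuous_onI continuous_intros)
  also have "(borel \<rightarrow>\<^sub>M borel :: (real \<times> real \<times> nat \<Rightarrow> nat) set) = borel \<rightarrow>\<^sub>M count_space UNIV"
    by (rule measurable_cong_sets) (simp_all add: sets_borel_eq_count_space)
  finally have idx: "(\<lambda>p :: real \<times> real \<times> nat. snd (snd p)) \<in> borel \<rightarrow>\<^sub>M count_space UNIV" .
  \<comment> \<open>The third argument takes countably many values, so joint measurability reduces
    to that of the slices.\<close>
  have "(\<lambda>p. (\<lambda>(x, y). ?W x y (snd (snd p))) (fst p, fst (snd p))) \<in> borel_measurable borel"
    by (rule measurable_compose_countable[OF measurable_compose[OF pr 1] idx])
  then have "(\<lambda>(x, y, k). ?W x y k) \<in> borel_measurable borel" by (simp add: case_prod_unfold)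
  then show "(\<lambda>(x, y, k). ?W x y k) \<in> borel_measurable (restrict_space borel ({0..1} \<times> {0..1} \<times> UNIV))"
    by (rule measurable_restrict_space1)
next
  fix x y :: real and k
  have "0 \<le> v k - v (Suc k) \<and> v k - v (Suc k) \<le> 1" if "tail_seq v" for v
    using tail_seq_antimono[OF that, of k "Suc k"] tail_seq_bounds[OF that] by (smt (verit) le_add2 plus_1_eq_Suc)
  then show "multigraphon_of s t x y k \<in> {0..1}" using s(1) t(1) by (simp add: multigraphon_of_def)
  show "multigraphon_of s t x y k = multigraphon_of s t y x k" using t(2) by (simp add: multigraphon_of_def)
next
  fix x y :: real
  show "multigraphon_of s t x y sums 1"
  proof (cases "x = y")
    case True
    then have "multigraphon_of s t x y = (\<lambda>l. s x l - s x (Suc l))" by (simp add: fun_eq_iff multigraphon_of_def)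
    then show ?thesis using tail_seq_sums[OF s(1), of x 0] s(1)[of x] by (simp add: tail_seq_def)
  next
    case False
    then have "multigraphon_of s t x y = (\<lambda>l. t (x, y) l - t (x, y) (Suc l))" by (simp add: fun_eq_iff multigraphon_of_def)
    then show ?thesis using tail_seq_sums[OF t(1), of "(x, y)" 0] t(1)[of "(x, y)"] by (simp add: tail_seq_def)
  qed
next
  fix x k show "multigraphon_of s t x x (2 * k + 1) = 0" using s(2) by (simp add: multigraphon_of_def)
qed

lemma multigraphon_density_multigraphon_of:
  assumes s: "\<And>x. tail_seq (s x)" and t: "\<And>q. tail_seq (t q)"
  shows "multigraphon_density F (multigraphon_of s t) = (\<integral>x. (\<Prod>(i, j)\<in>strict_pairs (dim_row F).
      if x i = x j then s (x i) (F $$ (i, j)) else t (x i, x j) (F $$ (i, j))) *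
      (\<Prod>i<dim_row F. s (x i) (F $$ (i, i))) \<partial>cube {..<dim_row F})"
proof -
  have "(\<Sum>l. multigraphon_of s t x y (a + l)) = (if x = y then s x a else t (x, y) a)" for x y a
    using tail_seq_sums[OF s, of y a] tail_seq_sums[OF t, of "(x, y)" a]
    by (simp add: multigraphon_of_def sums_iff)
  then show ?thesis unfolding multigraphon_density_def by (simp add: prod_lower_triangle)
qed

section \<open>Existence of the limiting multigraphon\<close>

context code_tree
begin

text \<open>These test graphs identify limits of integrated tail functions with values of
  \<open>f\<close>, to which non-defectiveness applies. A vertex with \<open>a\<close> loops has
  diagonal entry \<open>2 * a\<close>.\<close>

lemma edge_loop_densities_tendsto:
  assumes F: "\<And>F. F \<in> multigraphs \<Longrightarrow> (\<lambda>j. tree_density K \<mu> U P j F) \<longlonglongrightarrow> f F"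
  shows "(\<lambda>j. \<integral>q. u a j q \<partial>(unit_lborel \<Otimes>\<^sub>M unit_lborel)) \<longlonglongrightarrow> f (edge_mat 2 (\<lambda>e. if e = (0, 1) then a else 0))" (is ?A)
    and "(\<lambda>j. \<integral>x. p (2 * a) j x \<partial>unit_lborel) \<longlonglongrightarrow> f (edge_mat 1 (\<lambda>_. a))" (is ?B)
proof -
  let ?E = "edge_mat 2 (\<lambda>e. if e = (0, 1) then a else 0)"
  have sp: "strict_pairs 2 = {(0, 1)}" by (auto simp: strict_pairs_def)
  have two: "{..<2::nat} = {0, 1}" by auto
  have "tree_density K \<mu> U P j ?E = (\<integral>q. u a j q \<partial>(unit_lborel \<Otimes>\<^sub>M unit_lborel))" for j
  proof -
    have "tree_density K \<mu> U P j ?E = (\<integral>x. u a j (x 0, x 1) \<partial>cube {..<2})"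
      by (simp add: tree_density_integral sp two edge_mat_index p_def P_0)
    also have "\<dots> = (\<integral>q. u a j q \<partial>(unit_lborel \<Otimes>\<^sub>M unit_lborel))"
      by (rule integral_cube_pair) (auto intro!: measurable_unit_pair u_bounds)
    finally show ?thesis .
  qed
  then show ?A using F[of ?E] by (simp add: adjacency_mats_multigraphs[OF edge_mat_in])
  let ?L = "edge_mat 1 (\<lambda>_. a)"
  have "tree_density K \<mu> U P j ?L = (\<integral>x. p (2 * a) j x \<partial>unit_lborel)" for j
  proof -
    have mp: "p (2 * a) j \<in> borel_measurable unit_lborel" unfolding p_def by measurable
    have "strict_pairs (Suc 0) = {}" by (auto simp: strict_pairs_def)
    then have "tree_density K \<mu> U P j ?L = (\<integral>x. p (2 * a) j (x 0) \<partial>cube {0})"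
      by (simp add: tree_density_integral edge_mat_index lessThan_Suc)
    also have "\<dots> = (\<integral>x. p (2 * a) j x \<partial>unit_lborel)"
      by (rule units.product_integral_singleton) (rule mp)
    finally show ?thesis .
  qed
  then show ?B using F[of ?L] by (simp add: adjacency_mats_multigraphs[OF edge_mat_in])
qed

lemma exists_multigraphon:
  assumes F: "\<And>F. F \<in> multigraphs \<Longrightarrow> (\<lambda>j. tree_density K \<mu> U P j F) \<longlonglongrightarrow> f F"
    and nd: "non_defective f"
  shows "\<exists>W. multigraphon W \<and> (\<forall>F\<in>multigraphs. f F = multigraphon_density F W)"
proof -
  let ?I2 = "unit_lborel \<Otimes>\<^sub>M unit_lborel"
  obtain r where r: "strict_mono (r :: nat \<Rightarrow> nat)"
    and cu: "\<And>a. AE q in ?I2. convergent (\<lambda>m. u a (r m) q)"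
    and cp: "\<And>a. AE x in unit_lborel. convergent (\<lambda>m. p a (r m) x)"
    using exists_convergent_subsequence by blast
  define uu where "uu = (\<lambda>q a. lim (\<lambda>m. u a (r m) q))"
  define pp where "pp = (\<lambda>x a. lim (\<lambda>m. p a (r m) x))"
  have id_meas [measurable]: "(\<lambda>x. x) \<in> unit_lborel \<rightarrow>\<^sub>M borel" by (rule measurable_restrict_space1) simp
  have [measurable]: "(\<lambda>q. uu q a) \<in> borel_measurable (borel \<Otimes>\<^sub>M borel)" "(\<lambda>x. pp x a) \<in> borel_measurable borel" for a
    unfolding uu_def pp_def by (intro borel_measurable_lim_metric; measurable)+
  have uuI2 [measurable]: "(\<lambda>q. uu q a) \<in> borel_measurable ?I2" for a by (intro measurable_unit_pair) measurable
  have ppI [measurable]: "(\<lambda>x. pp x a) \<in> borel_measurable unit_lborel" for a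
    by (intro measurable_compose[OF id_meas]) measurable
  have uI2 [measurable]: "u a j \<in> borel_measurable ?I2" for a j by (intro measurable_unit_pair) measurable
  have pI [measurable]: "p a j \<in> borel_measurable unit_lborel" for a j
    by (rule measurable_compose[OF id_meas measurable_p])
  have AEu: "AE q in ?I2. \<forall>a. (\<lambda>m. u a (r m) q) \<longlonglongrightarrow> uu q a"
    using cu unfolding AE_all_countable uu_def convergent_LIMSEQ_iff by blast
  have AEp: "AE x in unit_lborel. \<forall>a. (\<lambda>m. p a (r m) x) \<longlonglongrightarrow> pp x a"
    using cp unfolding AE_all_countable pp_def convergent_LIMSEQ_iff by blast
  have uu_props: "AE q in ?I2. uu q 0 = 1 \<and> (\<forall>a. 0 \<le> uu q a \<and> uu q a \<le> 1 \<and> uu q (Suc a) \<le> uu q a)"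
    using AEu
  proof eventually_elim
    case (elim q)
    then have l: "(\<lambda>m. u a (r m) q) \<longlonglongrightarrow> uu q a" for a by blast
    have "uu q 0 = 1" using l[of 0] by (simp add: u_def case_prod_unfold U_0 LIMSEQ_const_iff)
    moreover have "0 \<le> uu q a" for a by (rule LIMSEQ_le_const[OF l]) (use u_bounds in blast)
    moreover have "uu q a \<le> 1" for a by (rule LIMSEQ_le_const2[OF l]) (use u_bounds in blast)
    moreover have "uu q (Suc a) \<le> uu q a" for a
      by (rule LIMSEQ_le[OF l l]) (auto simp: u_def case_prod_unfold U_Suc_le)
    ultimately show ?case by blast
  qed
  have pp_props: "AE x in unit_lborel. pp x 0 = 1 \<and> (\<forall>a. 0 \<le> pp x a \<and> pp x a \<le> 1 \<and> pp x (Suc a) \<le> pp x a)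
      \<and> (\<forall>a. pp x (Suc (2 * a)) = pp x (2 * a + 2))"
    using AEp
  proof eventually_elim
    case (elim x)
    then have l: "(\<lambda>m. p a (r m) x) \<longlonglongrightarrow> pp x a" for a by blast
    have "pp x 0 = 1" using l[of 0] by (simp add: p_def P_0 LIMSEQ_const_iff)
    moreover have "0 \<le> pp x a" for a by (rule LIMSEQ_le_const[OF l]) (use p_bounds in blast)
    moreover have "pp x a \<le> 1" for a by (rule LIMSEQ_le_const2[OF l]) (use p_bounds in blast)
    moreover have "pp x (Suc a) \<le> pp x a" for a
      by (rule LIMSEQ_le[OF l l]) (auto simp: p_def P_Suc_le)
    moreover have "pp x (Suc (2 * a)) = pp x (2 * a + 2)" for a
      using l[of "Suc (2 * a)"] l[of "2 * a + 2"] unfolding p_def P_odd by (rule LIMSEQ_unique)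
    ultimately show ?case by blast
  qed
  have f_edge: "(\<integral>q. uu q a \<partial>?I2) = f (edge_mat 2 (\<lambda>e. if e = (0, 1) then a else 0))" for a
  proof -
    have "(\<lambda>m. \<integral>q. u a (r m) q \<partial>?I2) \<longlonglongrightarrow> (\<integral>q. uu q a \<partial>?I2)"
    proof (rule integral_dominated_convergence[where w = "\<lambda>_. 1"])
      show "AE q in ?I2. (\<lambda>m. u a (r m) q) \<longlonglongrightarrow> uu q a" using AEu by eventually_elim blast
      show "AE q in ?I2. norm (u a (r m) q) \<le> 1" for m using u_bounds by simp
    qed (auto simp: unit2.integrable_const)
    moreover have "(\<lambda>m. \<integral>q. u a (r m) q \<partial>?I2) \<longlonglongrightarrow> f (edge_mat 2 (\<lambda>e. if e = (0, 1) then a else 0))"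
      using LIMSEQ_subseq_LIMSEQ[OF edge_loop_densities_tendsto(1)[OF F] r, of a] by (simp add: o_def)
    ultimately show ?thesis by (rule LIMSEQ_unique)
  qed
  have f_loop: "(\<integral>x. pp x (2 * a) \<partial>unit_lborel) = f (edge_mat 1 (\<lambda>_. a))" for a
  proof -
    have "(\<lambda>m. \<integral>x. p (2 * a) (r m) x \<partial>unit_lborel) \<longlonglongrightarrow> (\<integral>x. pp x (2 * a) \<partial>unit_lborel)"
    proof (rule integral_dominated_convergence[where w = "\<lambda>_. 1"])
      show "AE x in unit_lborel. (\<lambda>m. p (2 * a) (r m) x) \<longlonglongrightarrow> pp x (2 * a)" using AEp by eventually_elim blast
      show "AE x in unit_lborel. norm (p (2 * a) (r m) x) \<le> 1" for m using p_bounds by simp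
    qed (auto simp: unit.integrable_const)
    moreover have "(\<lambda>m. \<integral>x. p (2 * a) (r m) x \<partial>unit_lborel) \<longlonglongrightarrow> f (edge_mat 1 (\<lambda>_. a))"
      using LIMSEQ_subseq_LIMSEQ[OF edge_loop_densities_tendsto(2)[OF F] r, of a] by (simp add: o_def)
    ultimately show ?thesis by (rule LIMSEQ_unique)
  qed
  \<comment> \<open>Here non-defectiveness excludes that edge multiplicities escape to infinity;
    \<open>lim_loop\<close> does the same for loops.\<close>
  have lim_edge: "(\<lambda>a. f (edge_mat 2 (\<lambda>e. if e = (0, 1) then a else 0))) \<longlonglongrightarrow> 0"
  proof -
    have "num_edges (edge_mat 2 (\<lambda>e. if e = (0, 1) then a else 0)) = a" for a
    proof -
      have "(0, 1) \<in> vertex_pairs 2" by (simp add: vertex_pairs_def)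
      then show ?thesis by (simp add: num_edges_edge_mat)
    qed
    then show ?thesis using nd edge_mat_in unfolding non_defective_def
      by (auto simp: filterlim_ident elim!: allE[of _ "2::nat"])
  qed
  have lim_loop: "(\<lambda>a. f (edge_mat 1 (\<lambda>_. a))) \<longlonglongrightarrow> 0"
  proof -
    have "vertex_pairs 1 = {(0, 0)}" by (auto simp: vertex_pairs_def)
    then have "num_edges (edge_mat 1 (\<lambda>_. a)) = a" for a by (simp add: num_edges_edge_mat)
    then show ?thesis using nd edge_mat_in unfolding non_defective_def
      by (auto simp: filterlim_ident elim!: allE[of _ "1::nat"])
  qed
  have uu_small: "AE q in ?I2. \<forall>n. \<exists>a. uu q a < inverse (real (Suc n))"
  proof (rule unit2.AE_small_of_integral_tendsto_0)
    show "AE q in ?I2. \<forall>a. 0 \<le> uu q a \<and> uu q a \<le> 1" using uu_props by eventually_elim blast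
    show "\<exists>a. (\<integral>q. uu q a \<partial>?I2) < e" if "0 < e" for e
      unfolding f_edge using order_tendstoD(2)[OF lim_edge that] by (auto dest: eventually_happens)
  qed measurable
  have pp_small: "AE x in unit_lborel. \<forall>n. \<exists>a. pp x a < inverse (real (Suc n))"
  proof (rule unit.AE_small_of_integral_tendsto_0)
    show "AE x in unit_lborel. \<forall>a. 0 \<le> pp x a \<and> pp x a \<le> 1" using pp_props by eventually_elim blast
    show "\<exists>a. (\<integral>x. pp x a \<partial>unit_lborel) < e" if "0 < e" for e
    proof -
      from order_tendstoD(2)[OF lim_loop that] obtain a where "f (edge_mat 1 (\<lambda>_. a)) < e"
        by (auto dest: eventually_happens)
      then show ?thesis unfolding f_loop[symmetric] by blast
    qed
  qed measurable
  \<comment> \<open>Where the limit is not a tail function, the law of a pair without edges takes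
    its place. The multigraphon conditions then hold everywhere and not only almost
    everywhere.\<close>
  define t where "t = (\<lambda>q. if tail_seq (uu q) then uu q else (\<lambda>a. of_bool (a = 0)))"
  define s where "s = (\<lambda>x. if tail_seq (pp x) \<and> (\<forall>a. pp x (Suc (2 * a)) = pp x (2 * a + 2)) then pp x else (\<lambda>a. of_bool (a = 0)))"
  have t_tail: "tail_seq (t q)" for q by (simp add: t_def tail_seq_of_bool)
  have s_tail: "tail_seq (s x)" for x by (simp add: s_def tail_seq_of_bool)
  have s_odd: "s x (Suc (2 * a)) = s x (2 * a + 2)" for x a by (simp add: s_def)
  \<comment> \<open>Symmetry holds at every pair, because the approximating step functions are
    symmetric everywhere and \<open>lim\<close> depends only on the sequence.\<close>
  have t_sym: "t (x, y) = t (y, x)" for x y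
  proof -
    have "u a j (x, y) = u a j (y, x)" for a j by (simp add: u_def U_sym)
    then have "uu (x, y) = uu (y, x)" by (simp add: uu_def)
    then show ?thesis by (simp add: t_def)
  qed
  have mt [measurable]: "(\<lambda>q. t q a) \<in> borel_measurable (borel \<Otimes>\<^sub>M borel)" for a
  proof -
    have "(\<lambda>q. t q a) = (\<lambda>q. if tail_seq (uu q) then uu q a else of_bool (a = 0))" by (auto simp: t_def)
    then show ?thesis unfolding tail_seq_def by simp
  qed
  have ms [measurable]: "(\<lambda>x. s x a) \<in> borel_measurable borel" for a
  proof -
    have "(\<lambda>x. s x a) = (\<lambda>x. if tail_seq (pp x) \<and> (\<forall>a. pp x (Suc (2 * a)) = pp x (2 * a + 2)) then pp x a else of_bool (a = 0))"
      by (auto simp: s_def)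
    then show ?thesis unfolding tail_seq_def by simp
  qed
  \<comment> \<open>Off the diagonal \<open>multigraphon_of\<close> takes the edge branch, so the
    inequality of the coordinates is recorded together with the convergence.\<close>
  have AEt: "AE q in ?I2. fst q \<noteq> snd q \<and> (\<forall>a. (\<lambda>m. u a (r m) q) \<longlonglongrightarrow> t q a)"
    using AE_neq_unit AEu uu_props uu_small
    by eventually_elim (simp add: t_def tail_seq_def)
  have AEs: "AE x in unit_lborel. \<forall>a. (\<lambda>m. p a (r m) x) \<longlonglongrightarrow> s x a"
    using AEp pp_props pp_small by eventually_elim (simp add: s_def tail_seq_def)
  have "f F = multigraphon_density F (multigraphon_of s t)" if Fm: "F \<in> multigraphs" for F
  proof -
    let ?k = "dim_row F"
    interpret cube: prob_space "cube {..<?k}" by (rule prob_space_cube)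
    have comp [measurable]: "(\<lambda>x. x i) \<in> cube {..<?k} \<rightarrow>\<^sub>M borel" if "i < ?k" for i
      using measurable_compose[OF measurable_component_singleton[of i "{..<?k}" "\<lambda>_. unit_lborel"] id_meas] that by simp
    have pairs: "i < ?k \<and> j < ?k" if "(i, j) \<in> strict_pairs ?k" for i j using that by (auto simp: strict_pairs_def)
    define h where "h = (\<lambda>m x. (\<Prod>(i, j)\<in>strict_pairs ?k. u (F $$ (i, j)) (r m) (x i, x j)) * (\<Prod>i<?k. p (F $$ (i, i)) (r m) (x i)))"
    define g where "g = (\<lambda>x. (\<Prod>(i, j)\<in>strict_pairs ?k. if x i = x j then s (x i) (F $$ (i, j)) else t (x i, x j) (F $$ (i, j))) *
        (\<Prod>i<?k. s (x i) (F $$ (i, i))))"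
    \<comment> \<open>Dominated convergence: the products stay in \<open>[0, 1]\<close>, and
      finitely many pairs and vertices have a common exceptional null set.\<close>
    have "(\<lambda>m. \<integral>x. h m x \<partial>cube {..<?k}) \<longlonglongrightarrow> (\<integral>x. g x \<partial>cube {..<?k})"
    proof (rule integral_dominated_convergence[where w = "\<lambda>_. 1"])
      have c: "(\<lambda>x. if x i = x j then s (x i) a else t (x i, x j) a) \<in> borel_measurable (cube {..<?k})"
        if "(i, j) \<in> strict_pairs ?k" for i j a
      proof -
        note [measurable] = comp[OF conjunct1[OF pairs[OF that]]] comp[OF conjunct2[OF pairs[OF that]]]
        show ?thesis by measurable
      qed
      show "g \<in> borel_measurable (cube {..<?k})"
        unfolding g_def case_prod_unfold by (intro borel_measurable_times borel_measurable_prod) (auto intro!: c measurable_compose[OF comp ms])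
      have d: "(\<lambda>x. u a j (x i, x i')) \<in> borel_measurable (cube {..<?k})" if "(i, i') \<in> strict_pairs ?k" for i i' a j
      proof -
        note [measurable] = comp[OF conjunct1[OF pairs[OF that]]] comp[OF conjunct2[OF pairs[OF that]]]
        show ?thesis by measurable
      qed
      show "h m \<in> borel_measurable (cube {..<?k})" for m
        unfolding h_def case_prod_unfold by (intro borel_measurable_times borel_measurable_prod) (auto intro!: d measurable_compose[OF comp measurable_p])
      show "integrable (cube {..<?k}) (\<lambda>_. 1::real)" by simp
      have "\<bar>h m x\<bar> \<le> 1" for m x
        unfolding h_def case_prod_unfold abs_mult abs_prod
        using u_bounds p_bounds by (intro mult_le_one prod_le_1 prod_nonneg) auto
      then show "AE x in cube {..<?k}. norm (h m x) \<le> 1" for m by simp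
      have "AE x in cube {..<?k}. \<forall>(i, j)\<in>strict_pairs ?k. x i \<noteq> x j \<and> (\<forall>a. (\<lambda>m. u a (r m) (x i, x j)) \<longlonglongrightarrow> t (x i, x j) a)"
      proof (rule AE_finite_allI[OF finite_strict_pairs], clarify)
        fix i j assume "(i, j) \<in> strict_pairs ?k"
        then show "AE x in cube {..<?k}. x i \<noteq> x j \<and> (\<forall>a. (\<lambda>m. u a (r m) (x i, x j)) \<longlonglongrightarrow> t (x i, x j) a)"
          using AE_cube_pair[of "{..<?k}" i j, OF _ _ _ _ AEt] by (auto simp: strict_pairs_def)
      qed
      moreover have "AE x in cube {..<?k}. \<forall>i\<in>{..<?k}. \<forall>a. (\<lambda>m. p a (r m) (x i)) \<longlonglongrightarrow> s (x i) a"
        by (rule AE_finite_allI) (auto intro!: AE_cube_component[OF _ AEs])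
      ultimately show "AE x in cube {..<?k}. (\<lambda>m. h m x) \<longlonglongrightarrow> g x"
      proof eventually_elim
        case (elim x)
        show ?case unfolding h_def g_def case_prod_unfold
          by (intro tendsto_mult tendsto_prod) (use elim in \<open>auto simp: case_prod_unfold\<close>)
      qed
    qed
    moreover have "(\<lambda>m. \<integral>x. h m x \<partial>cube {..<?k}) \<longlonglongrightarrow> f F"
      using LIMSEQ_subseq_LIMSEQ[OF F[OF Fm] r] by (simp add: o_def tree_density_integral h_def)
    ultimately have "f F = (\<integral>x. g x \<partial>cube {..<?k})" using LIMSEQ_unique by blast
    then show ?thesis by (simp add: multigraphon_density_multigraphon_of[OF s_tail t_tail] g_def)
  qed
  moreover have "multigraphon (multigraphon_of s t)"
    by (rule multigraphon_multigraphon_of[OF s_tail s_odd t_tail t_sym ms mt])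
  ultimately show ?thesis by blast
qed

end

lemma density_limit_imp_multigraphon:
  assumes "is_density_limit f" "non_defective f"
  shows "\<exists>W. multigraphon W \<and> (\<forall>F\<in>multigraphs. f F = multigraphon_density F W)"
proof -
  obtain M K \<mu> U P where T: "code_tree M K \<mu> U P" and
    lim: "\<And>F. F \<in> multigraphs \<Longrightarrow> (\<lambda>j. tree_density K \<mu> U P j F) \<longlonglongrightarrow> f F"
    using density_limit_imp_code_tree[OF assms(1)] by metis
  show ?thesis by (rule code_tree.exists_multigraphon[OF T lim assms(2)])
qed

subsection \<open>Densities in a multigraphon\<close>

text \<open>Expansion of a product of differences: \<open>S\<close> records the factors from which
  the subtracted term is taken.\<close>

lemma alternating_sum_prod:
  fixes g :: "'a \<Rightarrow> bool \<Rightarrow> real"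
  assumes "finite A"
  shows "(\<Sum>S\<in>Pow A. (-1) ^ card S * (\<Prod>p\<in>A. g p (p \<in> S))) = (\<Prod>p\<in>A. g p False - g p True)"
  using assms
proof (induction A)
  case (insert a A)
  have "(-1) ^ card S * (\<Prod>p\<in>insert a A. g p (p \<in> S)) + (-1) ^ card (insert a S) * (\<Prod>p\<in>insert a A. g p (p \<in> insert a S))
      = (g a False - g a True) * ((-1) ^ card S * (\<Prod>p\<in>A. g p (p \<in> S)))" if S: "S \<in> Pow A" for S
  proof -
    have a: "a \<notin> S" "finite S" using S insert.hyps by (auto intro: finite_subset)
    then have c: "card (insert a S) = Suc (card S)" by simp
    have "(\<Prod>p\<in>A. g p (p \<in> insert a S)) = (\<Prod>p\<in>A. g p (p \<in> S))"
    proof (rule prod.cong[OF refl])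
      fix p assume "p \<in> A"
      then have "p \<noteq> a" using insert.hyps by auto
      then show "g p (p \<in> insert a S) = g p (p \<in> S)" by simp
    qed
    then show ?thesis using insert.hyps a by (simp add: c algebra_simps)
  qed
  then show ?case
    unfolding sum_Pow_insert[OF insert.hyps] using insert.hyps by (simp add: insert.IH sum_distrib_left[symmetric])
qed auto

lemma prod_vertex_pairs: "(\<Prod>j<k. \<Prod>i\<le>j. g i j :: real) = (\<Prod>(i, j)\<in>vertex_pairs k. g i j)"
proof -
  have "inj_on prod.swap (SIGMA j:{..<k}. {..j})" by (auto simp: inj_on_def)
  then have "(\<Prod>(i, j)\<in>vertex_pairs k. g i j) = (\<Prod>(j, i)\<in>(SIGMA j:{..<k}. {..j}). g i j)"
    unfolding vertex_pairs_Sigma by (subst prod.reindex) (auto simp: case_prod_unfold)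
  also have "\<dots> = (\<Prod>j<k. \<Prod>i\<le>j. g i j)" by (subst prod.Sigma) auto
  finally show ?thesis ..
qed

definition graphon_tail :: "(real \<Rightarrow> real \<Rightarrow> nat \<Rightarrow> real) \<Rightarrow> real \<Rightarrow> real \<Rightarrow> nat \<Rightarrow> real" where
  "graphon_tail W x y a = (\<Sum>l. W x y (a + l))"

definition density_integrand :: "(real \<Rightarrow> real \<Rightarrow> nat \<Rightarrow> real) \<Rightarrow> nat mat \<Rightarrow> (nat \<Rightarrow> real) \<Rightarrow> real" where
  "density_integrand W F x = (\<Prod>j<dim_row F. \<Prod>i\<le>j. graphon_tail W (x i) (x j) (F $$ (i, j)))"

lemma multigraphon_density_integrand:
  "multigraphon_density F W = (\<integral>x. density_integrand W F x \<partial>cube {..<dim_row F})"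
  by (simp add: multigraphon_density_def density_integrand_def graphon_tail_def)

context
  fixes W :: "real \<Rightarrow> real \<Rightarrow> nat \<Rightarrow> real"
  assumes W: "multigraphon W"
begin

lemma multigraphon_props:
  assumes "x \<in> {0..1}" "y \<in> {0..1}"
  shows "0 \<le> W x y k" "W x y sums 1" "W x x (2 * k + 1) = 0"
  using W assms unfolding multigraphon_def by auto

lemma summable_multigraphon: "x \<in> {0..1} \<Longrightarrow> y \<in> {0..1} \<Longrightarrow> summable (\<lambda>l. W x y (a + l))"
  using multigraphon_props(2)[of x y] summable_ignore_initial_segment[of "W x y" a] by (simp add: sums_iff add.commute)

lemma tail_0: "x \<in> {0..1} \<Longrightarrow> y \<in> {0..1} \<Longrightarrow> graphon_tail W x y 0 = 1"
  using multigraphon_props(2)[of x y] by (simp add: graphon_tail_def sums_iff)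

lemma tail_Suc:
  assumes "x \<in> {0..1}" "y \<in> {0..1}"
  shows "graphon_tail W x y a = W x y a + graphon_tail W x y (Suc a)"
  using suminf_split_head[OF summable_multigraphon[OF assms, of a]] by (simp add: graphon_tail_def)

lemma tail_nonneg: "x \<in> {0..1} \<Longrightarrow> y \<in> {0..1} \<Longrightarrow> 0 \<le> graphon_tail W x y a"
  unfolding graphon_tail_def by (intro suminf_nonneg summable_multigraphon multigraphon_props)

lemma tail_antimono:
  assumes "x \<in> {0..1}" "y \<in> {0..1}" "a \<le> b"
  shows "graphon_tail W x y b \<le> graphon_tail W x y a"
proof -
  have "graphon_tail W x y (Suc n) \<le> graphon_tail W x y n" for n
    using tail_Suc[OF assms(1,2), of n] multigraphon_props(1)[OF assms(1,2), of n] by simp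
  then show ?thesis using assms(3) by (rule lift_Suc_antimono_le)
qed

lemma tail_le_1: "x \<in> {0..1} \<Longrightarrow> y \<in> {0..1} \<Longrightarrow> graphon_tail W x y a \<le> 1"
  using tail_antimono[of x y 0 a] tail_0[of x y] by simp

lemma tail_tendsto:
  assumes "x \<in> {0..1}" "y \<in> {0..1}"
  shows "graphon_tail W x y \<longlonglongrightarrow> 0"
proof -
  have "graphon_tail W x y a = 1 - (\<Sum>l<a. W x y l)" for a
  proof (induction a)
    case (Suc a)
    then show ?case using tail_Suc[OF assms, of a] by simp
  qed (simp add: tail_0[OF assms])
  then have eq: "graphon_tail W x y = (\<lambda>a. 1 - (\<Sum>l<a. W x y l))" by (rule ext)
  have "(\<lambda>a. 1 - (\<Sum>l<a. W x y l)) \<longlonglongrightarrow> 1 - 1"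
    using multigraphon_props(2)[OF assms] by (intro tendsto_intros) (simp add: sums_def)
  then show ?thesis unfolding eq by simp
qed

lemma measurable_tail: "(\<lambda>q. graphon_tail W (fst q) (snd q) a) \<in> borel_measurable (unit_lborel \<Otimes>\<^sub>M unit_lborel)"
  unfolding graphon_tail_def
proof (rule borel_measurable_suminf)
  fix l
  have m: "(\<lambda>(x, y, k). W x y k) \<in> borel_measurable (restrict_space borel ({0..1} \<times> {0..1} \<times> UNIV))"
    using W by (simp add: multigraphon_def)
  have [measurable]: "(\<lambda>x. x) \<in> unit_lborel \<rightarrow>\<^sub>M borel" by (rule measurable_restrict_space1) simp
  have "(\<lambda>q. (fst q, snd q, a + l)) \<in> unit_lborel \<Otimes>\<^sub>M unit_lborel \<rightarrow>\<^sub>M borel \<Otimes>\<^sub>M (borel \<Otimes>\<^sub>M borel)"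
    by (intro measurable_Pair measurable_const measurable_compose[OF measurable_fst] measurable_compose[OF measurable_snd]) auto
  then have "(\<lambda>q. (fst q, snd q, a + l)) \<in> unit_lborel \<Otimes>\<^sub>M unit_lborel \<rightarrow>\<^sub>M borel" by (simp add: borel_prod)
  then have "(\<lambda>q. (fst q, snd q, a + l)) \<in> unit_lborel \<Otimes>\<^sub>M unit_lborel \<rightarrow>\<^sub>M restrict_space borel ({0..1} \<times> {0..1} \<times> UNIV)"
    by (intro measurable_restrict_space2) (auto simp: space_pair_measure)
  from measurable_compose[OF this m] show "(\<lambda>q. W (fst q) (snd q) (a + l)) \<in> borel_measurable (unit_lborel \<Otimes>\<^sub>M unit_lborel)"
    by simp
qed

lemma measurable_tail_cube:
  assumes "i \<in> I" "j \<in> I"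
  shows "(\<lambda>x. graphon_tail W (x i) (x j) a) \<in> borel_measurable (cube I)"
proof -
  have "(\<lambda>x. (x i, x j)) \<in> cube I \<rightarrow>\<^sub>M unit_lborel \<Otimes>\<^sub>M unit_lborel"
    by (intro measurable_Pair measurable_component_singleton assms)
  from measurable_compose[OF this measurable_tail] show ?thesis by simp
qed

lemma measurable_integrand: "density_integrand W F \<in> borel_measurable (cube {..<dim_row F})"
  unfolding density_integrand_def by (intro borel_measurable_prod measurable_tail_cube) auto

lemma cube_mem: "x \<in> space (cube I) \<Longrightarrow> i \<in> I \<Longrightarrow> x i \<in> {0..1}"
  by (auto simp: space_PiM PiE_iff)

lemma integrand_bounds:
  assumes "\<And>i. i < dim_row F \<Longrightarrow> x i \<in> {0..1}"
  shows "0 \<le> density_integrand W F x" "density_integrand W F x \<le> 1"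
  unfolding density_integrand_def
  using assms by (auto intro!: prod_nonneg prod_le_1 tail_nonneg tail_le_1 simp: prod_nonneg simp del: atLeastAtMost_iff)

lemma integrable_integrand: "integrable (cube {..<dim_row F}) (density_integrand W F)"
proof -
  interpret cube: prob_space "cube {..<dim_row F}" by (rule prob_space_cube)
  show ?thesis
  proof (rule cube.integrable_const_bound[of _ 1])
    show "AE x in cube {..<dim_row F}. norm (density_integrand W F x) \<le> 1"
    proof (rule AE_I2)
      fix x assume x: "x \<in> space (cube {..<dim_row F})"
      have "x i \<in> {0..1}" if "i < dim_row F" for i using cube_mem[OF x] that by simp
      from integrand_bounds[of F x, OF this] show "norm (density_integrand W F x) \<le> 1" by simp
    qed
  qed (rule measurable_integrand)
qed

section \<open>Multigraphon densities as parameters\<close>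

lemma density_normalized: "multigraphon_density (0\<^sub>m 1 1) W = 1"
proof -
  interpret cube: prob_space "cube {..<1}" by (rule prob_space_cube)
  have "density_integrand W (0\<^sub>m 1 1) x = 1" if x: "x \<in> space (cube {..<1})" for x
    using cube_mem[OF x, of 0] by (simp add: density_integrand_def tail_0 del: atLeastAtMost_iff)
  then have "multigraphon_density (0\<^sub>m 1 1) W = (\<integral>x. 1 \<partial>cube {..<1})"
    unfolding multigraphon_density_integrand index_zero_mat
    by (rule Bochner_Integration.integral_cong[OF refl])
  also have "\<dots> = 1" using cube.prob_space by simp
  finally show ?thesis .
qed

text \<open>Pairs between the two parts carry multiplicity 0, and a tail at threshold 0 is 1, so
  only the factors inside each part remain.\<close>

lemma integrand_disjoint_union:
  assumes F: "F \<in> multigraphs" and G: "G \<in> multigraphs"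
    and x: "\<And>i. i < dim_row F + dim_row G \<Longrightarrow> x i \<in> {0..1}"
  shows "density_integrand W (disjoint_union F G) x
    = density_integrand W F x * density_integrand W G (\<lambda>i. x (dim_row F + i))"
proof -
  let ?m = "dim_row F" and ?g = "dim_row G"
  have d: "dim_col F = ?m" "dim_col G = ?g"
    using F G adjacency_mats_dim(2) by (auto simp: multigraphs_iff)
  let ?H = "disjoint_union F G"
  have dH: "dim_row ?H = ?m + ?g" by (simp add: disjoint_union_def)
  have "(+) ?m ` {..<?g} = {?m..<?m + ?g}"
    using image_add_atLeastLessThan[of ?m 0 ?g] by (simp add: lessThan_atLeast0 add.commute)
  then have split: "{..<?m + ?g} = {..<?m} \<union> (+) ?m ` {..<?g}" by auto
  have H1: "?H $$ (i, j) = F $$ (i, j)" if "i < ?m" "j < ?m" for i j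
    using that d by (simp add: disjoint_union_def)
  have H2: "?H $$ (i, ?m + j) = 0" if "i < ?m" "j < ?g" for i j
    using that d by (simp add: disjoint_union_def)
  have H3: "?H $$ (?m + i, ?m + j) = G $$ (i, j)" if "i < ?g" "j < ?g" for i j
    using that d by (simp add: disjoint_union_def)
  have inner: "(\<Prod>i\<le>?m + j. graphon_tail W (x i) (x (?m + j)) (?H $$ (i, ?m + j)))
      = (\<Prod>i\<le>j. graphon_tail W (x (?m + i)) (x (?m + j)) (G $$ (i, j)))" if j: "j < ?g" for j
  proof -
    have "(+) ?m ` {..j} = {?m..?m + j}"
      using image_add_atLeastAtMost[of ?m 0 j] by (simp add: atMost_atLeast0 add.commute)
    then have s: "{..?m + j} = {..<?m} \<union> (+) ?m ` {..j}" by auto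
    have "(\<Prod>i\<le>?m + j. graphon_tail W (x i) (x (?m + j)) (?H $$ (i, ?m + j)))
       = (\<Prod>i<?m. graphon_tail W (x i) (x (?m + j)) (?H $$ (i, ?m + j))) *
         (\<Prod>i\<in>(+) ?m ` {..j}. graphon_tail W (x i) (x (?m + j)) (?H $$ (i, ?m + j)))"
      unfolding s by (rule prod.union_disjoint) auto
    also have "(\<Prod>i<?m. graphon_tail W (x i) (x (?m + j)) (?H $$ (i, ?m + j))) = 1"
      by (rule prod.neutral) (use j x in \<open>auto simp: H2 intro!: tail_0 simp del: atLeastAtMost_iff\<close>)
    also have "(\<Prod>i\<in>(+) ?m ` {..j}. graphon_tail W (x i) (x (?m + j)) (?H $$ (i, ?m + j)))
       = (\<Prod>i\<le>j. graphon_tail W (x (?m + i)) (x (?m + j)) (?H $$ (?m + i, ?m + j)))"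
      by (subst prod.reindex) auto
    also have "\<dots> = (\<Prod>i\<le>j. graphon_tail W (x (?m + i)) (x (?m + j)) (G $$ (i, j)))"
      by (rule prod.cong[OF refl]) (use j in \<open>simp add: H3\<close>)
    finally show ?thesis by simp
  qed
  have "density_integrand W ?H x = (\<Prod>j<?m. \<Prod>i\<le>j. graphon_tail W (x i) (x j) (?H $$ (i, j))) *
      (\<Prod>j\<in>(+) ?m ` {..<?g}. \<Prod>i\<le>j. graphon_tail W (x i) (x j) (?H $$ (i, j)))"
    unfolding density_integrand_def dH split by (rule prod.union_disjoint) auto
  also have "(\<Prod>j<?m. \<Prod>i\<le>j. graphon_tail W (x i) (x j) (?H $$ (i, j))) = density_integrand W F x"
    unfolding density_integrand_def by (rule prod.cong[OF refl], rule prod.cong[OF refl]) (simp add: H1)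
  also have "(\<Prod>j\<in>(+) ?m ` {..<?g}. \<Prod>i\<le>j. graphon_tail W (x i) (x j) (?H $$ (i, j)))
      = density_integrand W G (\<lambda>i. x (?m + i))"
    unfolding density_integrand_def by (subst prod.reindex) (auto simp: inner intro!: prod.cong)
  finally show ?thesis .
qed

lemma density_multiplicative:
  assumes F: "F \<in> multigraphs" and G: "G \<in> multigraphs"
  shows "multigraphon_density (disjoint_union F G) W = multigraphon_density F W * multigraphon_density G W"
proof -
  let ?m = "dim_row F" and ?g = "dim_row G"
  let ?I = "{..<?m}" and ?J = "{?m..<?m + ?g}"
  let ?H = "disjoint_union F G"
  have dH: "dim_row ?H = ?m + ?g" by (simp add: disjoint_union_def)
  have IJ: "?I \<inter> ?J = {}" "{..<?m + ?g} = ?I \<union> ?J" by auto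
  have int: "integrable (cube (?I \<union> ?J)) (density_integrand W ?H)"
    using integrable_integrand[of ?H] unfolding dH IJ(2) .
  have merge: "density_integrand W ?H (merge ?I ?J (x, y))
      = density_integrand W F x * density_integrand W G (\<lambda>i\<in>{..<?g}. y (?m + i))"
    if x: "x \<in> space (cube ?I)" and y: "y \<in> space (cube ?J)" for x y
  proof -
    have "density_integrand W ?H (merge ?I ?J (x, y))
      = density_integrand W F (merge ?I ?J (x, y)) * density_integrand W G (\<lambda>i. merge ?I ?J (x, y) (?m + i))"
    proof (rule integrand_disjoint_union[OF F G])
      fix i assume "i < ?m + ?g"
      then show "merge ?I ?J (x, y) i \<in> {0..1}" using cube_mem[OF x, of i] cube_mem[OF y, of i] by (auto simp: merge_def)
    qed
    also have "density_integrand W F (merge ?I ?J (x, y)) = density_integrand W F x"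
      unfolding density_integrand_def by (intro prod.cong refl) (simp add: merge_def)
    also have "density_integrand W G (\<lambda>i. merge ?I ?J (x, y) (?m + i)) = density_integrand W G (\<lambda>i\<in>{..<?g}. y (?m + i))"
      unfolding density_integrand_def by (intro prod.cong refl) (simp add: merge_def)
    finally show ?thesis .
  qed
  \<comment> \<open>The coordinates of the second part start at \<open>?m\<close>; shifting the
    index carries their cube to the standard one.\<close>
  have re: "distr (cube ?J) (cube {..<?g}) (\<lambda>y. \<lambda>i\<in>{..<?g}. y (?m + i)) = cube {..<?g}"
    by (rule distr_PiM_reindex[where f = "\<lambda>i. ?m + i" and M = "\<lambda>_. unit_lborel"])
      (auto intro!: unit.prob_space_axioms)
  have meas: "(\<lambda>y. \<lambda>i\<in>{..<?g}. y (?m + i)) \<in> cube ?J \<rightarrow>\<^sub>M cube {..<?g}"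
    by (rule measurable_restrict) (auto intro!: measurable_component_singleton)
  have "multigraphon_density ?H W = (\<integral>x. (\<integral>y. density_integrand W ?H (merge ?I ?J (x, y)) \<partial>cube ?J) \<partial>cube ?I)"
    unfolding multigraphon_density_integrand dH IJ(2) using IJ(1) int
    by (intro units.product_integral_fold) auto
  also have "\<dots> = (\<integral>x. (\<integral>y. density_integrand W F x * density_integrand W G (\<lambda>i\<in>{..<?g}. y (?m + i)) \<partial>cube ?J) \<partial>cube ?I)"
    by (rule Bochner_Integration.integral_cong[OF refl], rule Bochner_Integration.integral_cong[OF refl]) (rule merge)
  also have "\<dots> = multigraphon_density F W * (\<integral>y. density_integrand W G (\<lambda>i\<in>{..<?g}. y (?m + i)) \<partial>cube ?J)"
    by (simp add: multigraphon_density_integrand)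
  also have "(\<integral>y. density_integrand W G (\<lambda>i\<in>{..<?g}. y (?m + i)) \<partial>cube ?J)
      = (\<integral>y. density_integrand W G y \<partial>distr (cube ?J) (cube {..<?g}) (\<lambda>y. \<lambda>i\<in>{..<?g}. y (?m + i)))"
    by (rule integral_distr[symmetric, OF meas measurable_integrand])
  also have "\<dots> = multigraphon_density G W" unfolding re multigraphon_density_integrand ..
  finally show ?thesis .
qed

text \<open>Under the integral the alternating sum factors into differences of tails, which are
  nonnegative because tails decrease.\<close>

lemma density_moebius_nonneg:
  assumes f: "\<And>F. F \<in> multigraphs \<Longrightarrow> f F = multigraphon_density F W" and k: "1 \<le> k" and A: "A \<in> adjacency_mats k"
  shows "0 \<le> moebius_transform f A"
proof -
  define h where "h = edge_count A"
  have A_eq: "A = edge_mat k h" using A by (simp add: h_def edge_mat_edge_count)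
  let ?P = "vertex_pairs k"
  let ?E = "\<lambda>S. edge_mat k (add_ind h S)"
  have int: "integrable (cube {..<k}) (density_integrand W (?E S))" for S
    using integrable_integrand[of "?E S"] by simp
  have "moebius_transform f A = (\<Sum>S\<in>Pow ?P. (-1) ^ card S * (\<integral>x. density_integrand W (?E S) x \<partial>cube {..<k}))"
    unfolding A_eq moebius_transform_edge_mat
    using f adjacency_mats_multigraphs[OF edge_mat_in k] by (simp add: multigraphon_density_integrand)
  also have "\<dots> = (\<integral>x. (\<Sum>S\<in>Pow ?P. (-1) ^ card S * density_integrand W (?E S) x) \<partial>cube {..<k})"
    using int by simp
  also have "0 \<le> \<dots>"
  proof (intro integral_nonneg_AE AE_I2)
    fix x assume x: "x \<in> space (cube {..<k})"
    have mem: "x i \<in> {0..1}" if "i < k" for i using cube_mem[OF x] that by simp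
    \<comment> \<open>An added loop raises the diagonal entry by 2, so a diagonal factor is a
      difference across two thresholds.\<close>
    define g where "g = (\<lambda>e b. graphon_tail W (x (fst e)) (x (snd e))
       (if fst e = snd e then 2 * (h e + of_bool b) else h e + of_bool b))"
    have "density_integrand W (?E S) x = (\<Prod>e\<in>?P. g e (e \<in> S))" for S
      unfolding density_integrand_def dim_edge_mat prod_vertex_pairs
      by (rule prod.cong[OF refl]) (auto simp: g_def vertex_pairs_def edge_mat_index)
    then have "(\<Sum>S\<in>Pow ?P. (-1) ^ card S * density_integrand W (?E S) x) = (\<Prod>e\<in>?P. g e False - g e True)"
      by (simp add: alternating_sum_prod)
    also have "0 \<le> \<dots>"
    proof (rule prod_nonneg)
      fix e assume "e \<in> ?P"
      then have "fst e < k" "snd e < k" by (auto simp: vertex_pairs_def)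
      then have "g e True \<le> g e False" unfolding g_def by (intro tail_antimono mem) auto
      then show "0 \<le> g e False - g e True" by simp
    qed
    finally show "0 \<le> (\<Sum>S\<in>Pow ?P. (-1) ^ card S * density_integrand W (?E S) x)" .
  qed
  finally show ?thesis .
qed

text \<open>Any single factor dominates the integrand, and its integral tends to 0 as its entry
  grows. Many edges on a bounded number of pairs force a large entry; the pair may vary with
  \<open>n\<close>, so the threshold \<open>a0\<close> is chosen for all pairs at once.\<close>

lemma density_non_defective:
  assumes f: "\<And>F. F \<in> multigraphs \<Longrightarrow> f F = multigraphon_density F W"
  shows "non_defective f"
  unfolding non_defective_def
proof (intro allI impI)
  fix k :: nat and A assume k: "1 \<le> k" and A: "\<forall>n::nat. A n \<in> adjacency_mats k"
    and lim: "filterlim (\<lambda>n. num_edges (A n)) at_top sequentially"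
  interpret cube: prob_space "cube {..<k}" by (rule prob_space_cube)
  let ?P = "vertex_pairs k"
  define s where "s = (\<lambda>e a. \<integral>x. graphon_tail W (x (fst e)) (x (snd e)) a \<partial>cube {..<k})"
  have P: "fst e < k \<and> snd e < k" if "e \<in> ?P" for e using that by (auto simp: vertex_pairs_def)
  have int: "integrable (cube {..<k}) (\<lambda>x. graphon_tail W (x (fst e)) (x (snd e)) a)" if e: "e \<in> ?P" for e a
  proof (rule cube.integrable_const_bound[of _ 1])
    show "AE x in cube {..<k}. norm (graphon_tail W (x (fst e)) (x (snd e)) a) \<le> 1"
    proof (rule AE_I2)
      fix x assume "x \<in> space (cube {..<k})"
      then have "x (fst e) \<in> {0..1}" "x (snd e) \<in> {0..1}" using P[OF e] cube_mem[of x "{..<k}"] by blast+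
      then show "norm (graphon_tail W (x (fst e)) (x (snd e)) a) \<le> 1" using tail_nonneg tail_le_1 by simp
    qed
  qed (use P[OF e] in \<open>auto intro: measurable_tail_cube\<close>)
  have s0: "s e \<longlonglongrightarrow> 0" if e: "e \<in> ?P" for e
  proof -
    have "(\<lambda>a. \<integral>x. graphon_tail W (x (fst e)) (x (snd e)) a \<partial>cube {..<k}) \<longlonglongrightarrow> (\<integral>x. 0 \<partial>cube {..<k})"
    proof (rule integral_dominated_convergence[where w = "\<lambda>_. 1"])
      show "AE x in cube {..<k}. (\<lambda>a. graphon_tail W (x (fst e)) (x (snd e)) a) \<longlonglongrightarrow> 0"
      proof (rule AE_I2)
        fix x assume "x \<in> space (cube {..<k})"
        then have "x (fst e) \<in> {0..1}" "x (snd e) \<in> {0..1}" using P[OF e] cube_mem[of x "{..<k}"] by blast+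
        then show "(\<lambda>a. graphon_tail W (x (fst e)) (x (snd e)) a) \<longlonglongrightarrow> 0" by (rule tail_tendsto)
      qed
      show "AE x in cube {..<k}. norm (graphon_tail W (x (fst e)) (x (snd e)) a) \<le> 1" for a
      proof (rule AE_I2)
        fix x assume "x \<in> space (cube {..<k})"
        then have "x (fst e) \<in> {0..1}" "x (snd e) \<in> {0..1}" using P[OF e] cube_mem[of x "{..<k}"] by blast+
        then show "norm (graphon_tail W (x (fst e)) (x (snd e)) a) \<le> 1" using tail_nonneg tail_le_1 by simp
      qed
    qed (use int[OF e] in \<open>auto intro: borel_measurable_integrable\<close>)
    then show ?thesis by (simp add: s_def)
  qed
  have le: "f B \<le> s (i, j) (B $$ (i, j))" "0 \<le> f B" if B: "B \<in> adjacency_mats k" and e: "(i, j) \<in> ?P" for B i j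
  proof -
    have dB: "dim_row B = k" using adjacency_mats_dim[OF B] by simp
    have fB: "f B = (\<integral>x. density_integrand W B x \<partial>cube {..<k})"
      using f[OF adjacency_mats_multigraphs[OF B k]] by (simp add: multigraphon_density_integrand dB)
    show "0 \<le> f B" unfolding fB
    proof (intro integral_nonneg_AE AE_I2)
      fix x assume "x \<in> space (cube {..<k})"
      then show "0 \<le> density_integrand W B x" using cube_mem[of x "{..<k}"] by (intro integrand_bounds) (auto simp: dB)
    qed
    have "f B \<le> (\<integral>x. graphon_tail W (x i) (x j) (B $$ (i, j)) \<partial>cube {..<k})"
      unfolding fB
    proof (rule integral_mono)
      show "integrable (cube {..<k}) (density_integrand W B)" using integrable_integrand[of B] dB by simp
      show "integrable (cube {..<k}) (\<lambda>x. graphon_tail W (x i) (x j) (B $$ (i, j)))" using int[OF e] by simp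
      fix x assume x: "x \<in> space (cube {..<k})"
      have mem: "x i \<in> {0..1}" if "i < k" for i using cube_mem[OF x] that by simp
      let ?t = "\<lambda>e. graphon_tail W (x (fst e)) (x (snd e)) (B $$ e)"
      have "density_integrand W B x = (\<Prod>e\<in>?P. ?t e)"
        unfolding density_integrand_def dB prod_vertex_pairs by (simp add: case_prod_unfold)
      also have "\<dots> = ?t (i, j) * (\<Prod>e\<in>?P - {(i, j)}. ?t e)" by (rule prod.remove[OF finite_vertex_pairs e])
      also have "\<dots> \<le> ?t (i, j) * 1"
      proof (rule mult_left_mono)
        show "(\<Prod>e\<in>?P - {(i, j)}. ?t e) \<le> 1"
          using P by (intro prod_le_1 conjI tail_nonneg tail_le_1 mem) auto
        show "0 \<le> ?t (i, j)" using P[OF e] by (intro tail_nonneg mem) auto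
      qed
      finally show "density_integrand W B x \<le> graphon_tail W (x i) (x j) (B $$ (i, j))" by simp
    qed
    then show "f B \<le> s (i, j) (B $$ (i, j))" by (simp add: s_def)
  qed
  have Pne: "(0, 0) \<in> ?P" using k by (auto simp: vertex_pairs_def)
  show "(\<lambda>n. f (A n)) \<longlonglongrightarrow> 0"
  proof (rule order_tendstoI)
    fix e :: real assume e: "e < 0"
    have "e < f (A n)" for n using le(2)[OF A[rule_format] Pne, of n] e by linarith
    then show "eventually (\<lambda>n. e < f (A n)) sequentially" by simp
  next
    fix e :: real assume e: "0 < e"
    have "eventually (\<lambda>a. \<forall>p\<in>?P. s p a < e) sequentially"
      by (intro eventually_ball_finite finite_vertex_pairs ballI order_tendstoD(2)[OF s0 e])
    then obtain a0 where a0: "\<And>a p. a0 \<le> a \<Longrightarrow> p \<in> ?P \<Longrightarrow> s p a < e"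
      unfolding eventually_sequentially by blast
    \<comment> \<open>Pigeonhole: if every pair had fewer than \<open>a0\<close> edges, the total
      would not exceed \<open>card ?P * a0\<close>.\<close>
    have "eventually (\<lambda>n. Suc (card ?P * a0) \<le> num_edges (A n)) sequentially"
      using lim unfolding filterlim_at_top by blast
    then show "eventually (\<lambda>n. f (A n) < e) sequentially"
    proof eventually_elim
      case (elim n)
      define h where "h = edge_count (A n)"
      have An: "A n = edge_mat k h" using A by (simp add: h_def edge_mat_edge_count)
      have "\<exists>p\<in>?P. a0 \<le> h p"
      proof (rule ccontr)
        assume "\<not> ?thesis"
        then have "(\<Sum>p\<in>?P. h p) \<le> card ?P * a0" using sum_bounded_above[of ?P h a0] by force
        then show False using elim by (simp add: An num_edges_edge_mat)
      qed
      then obtain i j where ij: "(i, j) \<in> ?P" "a0 \<le> h (i, j)" by auto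
      then have "i \<le> j" "i < k" "j < k" by (auto simp: vertex_pairs_def)
      \<comment> \<open>On the diagonal the entry is twice the loop count, hence still at least
        \<open>a0\<close>.\<close>
      then have "h (i, j) \<le> A n $$ (i, j)" by (simp add: An edge_mat_index)
      then have "a0 \<le> A n $$ (i, j)" using ij(2) by simp
      then have "s (i, j) (A n $$ (i, j)) < e" using a0 ij(1) by blast
      then show ?case using le(1)[OF A[rule_format] ij(1), of n] by linarith
    qed
  qed
qed

end

lemma multigraphon_imp_moebius_nonneg:
  assumes W: "multigraphon W" and f: "\<And>F. F \<in> multigraphs \<Longrightarrow> f F = multigraphon_density F W"
  shows "normalized f" "multiplicative f" "non_defective f"
    "\<And>k A. 1 \<le> k \<Longrightarrow> A \<in> adjacency_mats k \<Longrightarrow> 0 \<le> moebius_transform f A"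
proof -
  show "normalized f"
    using f[OF single_vertex_in_multigraphs] density_normalized[OF W] by (simp add: normalized_def)
  show "multiplicative f"
    unfolding multiplicative_def
    using f disjoint_union_in_multigraphs density_multiplicative[OF W] by simp
  show "non_defective f" by (rule density_non_defective[OF W f])
  show "\<And>k A. 1 \<le> k \<Longrightarrow> A \<in> adjacency_mats k \<Longrightarrow> 0 \<le> moebius_transform f A"
    by (rule density_moebius_nonneg[OF W f])
qed

subsection \<open>The equivalence\<close>

theorem theorem1:
  fixes f :: "nat mat \<Rightarrow> real"
  assumes "multigraph_parameter f"
  shows
    "((is_density_limit f \<and> non_defective f) \<longleftrightarrow>
      (\<exists>W. multigraphon W \<and> (\<forall>F\<in>multigraphs. f F = multigraphon_density F W))) \<and>
     ((\<exists>W. multigraphon W \<and> (\<forall>F\<in>multigraphs. f F = multigraphon_density F W)) \<longleftrightarrow>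
      (normalized f \<and> multiplicative f \<and> non_defective f \<and> reflection_positive f)) \<and>
     ((normalized f \<and> multiplicative f \<and> non_defective f \<and> reflection_positive f) \<longleftrightarrow>
      (normalized f \<and> multiplicative f \<and> non_defective f \<and>
       (\<forall>k\<ge>1. \<forall>A\<in>adjacency_mats k. 0 \<le> moebius_transform f A)))"
proof -
  let ?a = "is_density_limit f \<and> non_defective f"
  let ?b = "\<exists>W. multigraphon W \<and> (\<forall>F\<in>multigraphs. f F = multigraphon_density F W)"
  let ?c = "normalized f \<and> multiplicative f \<and> non_defective f \<and> reflection_positive f"
  let ?d = "normalized f \<and> multiplicative f \<and> non_defective f \<and>
       (\<forall>k\<ge>1. \<forall>A\<in>adjacency_mats k. 0 \<le> moebius_transform f A)"
  have ac: ?c if ?a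
    using that density_limit_imp_normalized density_limit_imp_multiplicative
      density_limit_imp_reflection_positive by blast
  have cd: ?d if ?c
    using that reflection_positive_imp_moebius_nonneg by blast
  have da: ?a if ?d
    using that moebius_nonneg_imp_density_limit[OF assms] by blast
  have ab: ?b if ?a
    using that density_limit_imp_multigraphon by blast
  have bd: ?d if b: ?b
  proof -
    from b obtain W where "multigraphon W" "\<And>F. F \<in> multigraphs \<Longrightarrow> f F = multigraphon_density F W"
      by blast
    note d = multigraphon_imp_moebius_nonneg[of W f, OF this]
    show ?thesis using d(1-3) by (intro conjI allI impI ballI) (auto intro: d(4))
  qed
  \<comment> \<open>The cycle from a through c and d back to a, together with a to b and b to d,
    connects all four conditions.\<close>
  show ?thesis using ac cd da ab bd by argo
qed

end
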